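(* For each $n \geq 2$ and $k \geq 1$, there exist $\theta = \theta(n,k) \in (0,\frac{\pi}{2})$ and $C = C(n,k)$ with the following property. Suppose that $X \subset \mathbb{R}^n$ is an ISGN which is a $k$-cover, is $\theta$-flat, and has $|X_{\mathrm{sing}}| < \infty$. Then $|X_{\mathrm{sing}}| \leq C$.
   Context: $E_1,\dots,E_n$ is the standard orthonormal basis of $\mathbb{R}^n$ and $\pi(x) = x_1$ is the projection onto the first coordinate. A geodesic network in $\mathbb{R}^n$ is a closed subset $X \subset \mathbb{R}^n$ which is locally a finite embedded graph, each of whose edges is a geodesic of $\mathbb{R}^n$ (a straight segment, ray, or complete line). $X_{\mathrm{reg}} \subset X$ is the set of points around which $X$ is locally a straight segment, and $X_{\mathrm{sing}} = X \setminus X_{\mathrm{reg}}$ is the set of singular points. A geodesic network with multiplicity also carries a locally constant function $\Theta : X_{\mathrm{reg}} \to (0,\infty)$; it is integral if $\Theta$ takes only positive integer values on $X_{\mathrm{reg}}$. $\Theta$ is extended to all of $\mathbb{R}^n$ by $\Theta(x) = \frac12\sum_j \Theta_j$ at $x \in X_{\mathrm{sing}}$, where $\Theta_1,\dots,\Theta_m$ are the multiplicities of the geodesics touching $x$, and by $\Theta = 0$ off $X$. The associated measure $\mu_X = \Theta\, d\mathcal{H}^1$ has support $X$. $X$ is stationary if at each $x \in X_{\mathrm{sing}}$, with $s_1,\dots,s_m$ the unit vectors at $x$ pointing along the geodesics leaving $x$ and $\Theta_1,\dots,\Theta_m$ their multiplicities, $\sum_{i} \Theta_i s_i = 0$. ISGN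 means integral stationary geodesic network: a geodesic network with multiplicity that is both integral and stationary. For $\theta \in [0,\frac{\pi}{2})$, $X$ is $\theta$-flat if every edge (segment, ray or line) of $X$ makes an angle at most $\theta$ with the $E_1$-axis. $X$ is a $k$-cover if for every $t \in \mathbb{R}$, $|X \cap \pi^{-1}(t)| \leq k$ and $\sum_{x \in X \cap \pi^{-1}(t)} \Theta(x) = k$, and at every $x \in X_{\mathrm{sing}}$ the total multiplicity of the geodesics entering $x$ from one side (with respect to the $E_1$ direction) equals the total multiplicity of the geodesics leaving $x$ from the other side. *)

theory Defs
  imports "HOL-Analysis.Analysis"
begin

text \<open>
  A network is given by its point set \<open>X\<close> together with a function \<open>m\<close> whose values on the regular
  part of \<open>X\<close> are the multiplicities; the values of \<open>m\<close> elsewhere are never used.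
\<close>

text \<open>
  Finite embedded graphs with straight edges, as sets of endpoint pairs. Edges are nondegenerate, so
  a set that is locally of the form \<open>graph_support S\<close> has no isolated points.
\<close>

definition segment_graph :: "((real ^ 'n) \<times> (real ^ 'n)) set \<Rightarrow> bool" where
  "segment_graph S \<longleftrightarrow>
     finite S \<and>
     (\<forall>(a, b) \<in> S. a \<noteq> b) \<and>
     (\<forall>(a, b) \<in> S. \<forall>(c, d) \<in> S. (a, b) \<noteq> (c, d) \<longrightarrow>
        closed_segment a b \<inter> closed_segment c d \<subseteq> {a, b} \<inter> {c, d})"

definition graph_support :: "((real ^ 'n) \<times> (real ^ 'n)) set \<Rightarrow> (real ^ 'n) set" where
  "graph_support S = (\<Union>(a, b) \<in> S. closed_segment a b)"

definition geodesic_network :: "(real ^ 'n) set \<Rightarrow> bool" where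
  "geodesic_network X \<longleftrightarrow>
     closed X \<and>
     (\<forall>x \<in> X. \<exists>U S. open U \<and> x \<in> U \<and> segment_graph S \<and> X \<inter> U = graph_support S \<inter> U)"

definition reg :: "(real ^ 'n) set \<Rightarrow> (real ^ 'n) set" where
  "reg X = {x \<in> X. \<exists>U a b. open U \<and> x \<in> U \<and> X \<inter> U = open_segment a b}"

definition sing :: "(real ^ 'n) set \<Rightarrow> (real ^ 'n) set" where
  "sing X = X - reg X"

text \<open>
  For a geodesic network, the connected components of the regular part are exactly the relatively
  open segments, the open rays and the complete lines that make up the network.
\<close>

definition edges :: "(real ^ 'n) set \<Rightarrow> (real ^ 'n) set set" where
  "edges X = components (reg X)"

definition multiplicity_on :: "(real ^ 'n) set \<Rightarrow> (real ^ 'n \<Rightarrow> real) \<Rightarrow> bool" where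
  "multiplicity_on X m \<longleftrightarrow>
     (\<forall>x \<in> reg X. m x > 0) \<and>
     (\<forall>x \<in> reg X. \<exists>U. open U \<and> x \<in> U \<and> (\<forall>y \<in> reg X \<inter> U. m y = m x))"

definition integral_multiplicity :: "(real ^ 'n) set \<Rightarrow> (real ^ 'n \<Rightarrow> real) \<Rightarrow> bool" where
  "integral_multiplicity X m \<longleftrightarrow> (\<forall>x \<in> reg X. \<exists>j::nat. j > 0 \<and> m x = real j)"

text \<open>
  The unit vectors at \<open>x\<close> pointing along the geodesics leaving \<open>x\<close>. No edge has both of its ends
  at \<open>x\<close>, so each geodesic touching \<open>x\<close> corresponds to exactly one such vector.
\<close>

definition directions :: "(real ^ 'n) set \<Rightarrow> real ^ 'n \<Rightarrow> (real ^ 'n) set" where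
  "directions X x = {s. norm s = 1 \<and> (\<forall>\<^sub>F t in at_right 0. x + t *\<^sub>R s \<in> reg X)}"

text \<open>
  The multiplicity of the geodesic leaving \<open>x\<close> in direction \<open>s\<close>. Since \<open>m\<close> is locally constant on
  the regular part, it is constant along that geodesic and the limit is its value there.
\<close>

definition dir_mult :: "(real ^ 'n \<Rightarrow> real) \<Rightarrow> real ^ 'n \<Rightarrow> real ^ 'n \<Rightarrow> real" where
  "dir_mult m x s = Lim (at_right 0) (\<lambda>t. m (x + t *\<^sub>R s))"

definition extended_mult :: "(real ^ 'n) set \<Rightarrow> (real ^ 'n \<Rightarrow> real) \<Rightarrow> real ^ 'n \<Rightarrow> real" where
  "extended_mult X m x =
     (if x \<in> reg X then m x
      else if x \<in> sing X then (1 / 2) * (\<Sum>s \<in> directions X x. dir_mult m x s)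
      else 0)"

definition stationary :: "(real ^ 'n) set \<Rightarrow> (real ^ 'n \<Rightarrow> real) \<Rightarrow> bool" where
  "stationary X m \<longleftrightarrow> (\<forall>x \<in> sing X. (\<Sum>s \<in> directions X x. dir_mult m x s *\<^sub>R s) = 0)"

definition isgn :: "(real ^ 'n) set \<Rightarrow> (real ^ 'n \<Rightarrow> real) \<Rightarrow> bool" where
  "isgn X m \<longleftrightarrow>
     geodesic_network X \<and> multiplicity_on X m \<and> integral_multiplicity X m \<and> stationary X m"

text \<open>
  The index \<open>i\<close> below designates the coordinate that is called the first one, so that \<open>E\<^sub>1\<close> is
  \<open>axis i 1\<close> and the projection \<open>\<pi>\<close> is \<open>\<lambda>x. x $ i\<close>. The axis is an unoriented line, whence the
  absolute value in the angle.
\<close>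

definition angle_with_axis :: "'n \<Rightarrow> real ^ 'n \<Rightarrow> real" where
  "angle_with_axis i v = arccos (\<bar>v \<bullet> axis i 1\<bar> / norm v)"

definition theta_flat :: "'n \<Rightarrow> real \<Rightarrow> (real ^ 'n) set \<Rightarrow> bool" where
  "theta_flat i \<theta> X \<longleftrightarrow>
     (\<forall>E \<in> edges X. \<forall>x \<in> E. \<forall>y \<in> E. x \<noteq> y \<longrightarrow> angle_with_axis i (y - x) \<le> \<theta>)"

definition slice :: "'n \<Rightarrow> (real ^ 'n) set \<Rightarrow> real \<Rightarrow> (real ^ 'n) set" where
  "slice i X t = X \<inter> (\<lambda>x. x $ i) -` {t}"

definition k_cover :: "'n \<Rightarrow> nat \<Rightarrow> (real ^ 'n) set \<Rightarrow> (real ^ 'n \<Rightarrow> real) \<Rightarrow> bool" where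
  "k_cover i k X m \<longleftrightarrow>
     (\<forall>t. finite (slice i X t) \<and> card (slice i X t) \<le> k \<and>
          (\<Sum>x \<in> slice i X t. extended_mult X m x) = real k) \<and>
     (\<forall>x \<in> sing X.
        (\<Sum>s \<in> {s \<in> directions X x. s $ i < 0}. dir_mult m x s) =
        (\<Sum>s \<in> {s \<in> directions X x. s $ i > 0}. dir_mult m x s))"

end

theory Submission
  imports Defs
begin

text \<open>
  Cut \<open>X\<close> at its singular times and label the pieces: \<open>X\<close> becomes the space-time diagram of \<open>k\<close>
  particles that move uniformly between meetings, and at each meeting the number of particles and
  the sum of their unit tangents are preserved. The assertion becomes a bound, depending only on
  \<open>k\<close> and the maximal slope, on the number of meetings, and it is proved by induction on \<open>k\<close>.

  The sum \<open>V\<close> of all unit tangents is constant, hence so is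
  \<open>\<omega>\<^sup>2 = \<Sum>\<^sub>a\<^sub>,\<^sub>b \<bar>s\<^sub>a - s\<^sub>b\<bar>\<^sup>2 = 2 k\<^sup>2 - 2 \<bar>V\<bar>\<^sup>2\<close>, the scale of all relative velocities. Let \<open>t\<^sub>0\<close> be a
  meeting time at which the particles are closest together, at mutual distance about \<open>\<rho>\<close>, and put
  \<open>r\<^sub>0 = \<rho> / \<omega>\<close>. In a time interval that is a small multiple of \<open>r\<^sub>0\<close> relative positions
  change by less than \<open>\<rho> / k\<close>, so the particles fall into two groups that do not meet there. For
  \<open>t \<ge> t\<^sub>0 + A r\<^sub>0\<close> use positions \<open>x\<^sub>a\<close> relative to a point at time \<open>t\<^sub>0\<close>: the quantity
  \<open>\<Sum>\<^sub>a \<bar>x\<^sub>a\<bar> - x\<^sub>a \<bullet> s\<^sub>a\<close> does not increase and is \<open>O(\<omega>\<^sup>2 r\<^sub>0)\<close>, so the angle between \<open>x\<^sub>a\<close> and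
  \<open>s\<^sub>a\<close> is \<open>O(\<omega> (r\<^sub>0 / t)\<^sup>\<onehalf>)\<close>. Integrating against \<open>dt / t\<close>, the directions of the \<open>x\<^sub>a\<close> drift by
  \<open>O(\<omega> A\<^sup>-\<^sup>\<onehalf>)\<close> in total; if the particles did not fall into two groups that no longer meet, all the
  \<open>s\<^sub>a\<close> would agree up to \<open>O(\<omega> A\<^sup>-\<^sup>\<onehalf>)\<close>, contradicting the definition of \<open>\<omega>\<close> for large \<open>A\<close>. So a
  bounded number of time intervals suffices, and in each one the induction hypothesis applies to two
  smaller groups. Any \<open>\<theta> < \<pi> / 2\<close> works.
\<close>

section \<open>Unit vectors and induction over intervals\<close>

text \<open>Bisection of \<open>[s, t]\<close> reduces the claim to short intervals around one time.
  Statements about piecewise affine motion can thus be proved without listing breakpoints.\<close>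

lemma interval_local_induct:
  fixes P :: "real \<Rightarrow> real \<Rightarrow> bool"
  assumes Q: "is_interval Q" and st: "s \<in> Q" "t \<in> Q" "s \<le> t"
    and refl: "\<And>t. t \<in> Q \<Longrightarrow> P t t"
    and trans: "\<And>r s t. \<lbrakk>r \<in> Q; s \<in> Q; t \<in> Q; r \<le> s; s \<le> t; P r s; P s t\<rbrakk> \<Longrightarrow> P r t"
    and right: "\<And>t. t \<in> Q \<Longrightarrow> \<forall>\<^sub>F \<tau> in at_right t. \<tau> \<in> Q \<longrightarrow> P t \<tau>"
    and left: "\<And>t. t \<in> Q \<Longrightarrow> \<forall>\<^sub>F \<tau> in at_left t. \<tau> \<in> Q \<longrightarrow> P \<tau> t"
  shows "P s t"
proof -
  have mem: "x \<in> Q" if "a \<in> Q" "b \<in> Q" "a \<le> x" "x \<le> b" for a b x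
    using Q that by (meson mem_is_interval_1_I)
  have "s \<in> Q \<longrightarrow> t \<in> Q \<longrightarrow> P s t"
  proof (rule Bolzano[where P = "\<lambda>s t. s \<in> Q \<longrightarrow> t \<in> Q \<longrightarrow> P s t"])
    show "s \<le> t" by fact
  next
    fix a b c assume "a \<in> Q \<longrightarrow> b \<in> Q \<longrightarrow> P a b" "b \<in> Q \<longrightarrow> c \<in> Q \<longrightarrow> P b c" "a \<le> b" "b \<le> c"
    then show "a \<in> Q \<longrightarrow> c \<in> Q \<longrightarrow> P a c"
      using trans mem by blast
  next
    fix x assume "s \<le> x" "x \<le> t"
    then have x: "x \<in> Q" using mem st by blast
    obtain b where b: "b > x" "\<And>\<tau>. x < \<tau> \<Longrightarrow> \<tau> < b \<Longrightarrow> \<tau> \<in> Q \<Longrightarrow> P x \<tau>"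
      using right[OF x] unfolding eventually_at_right_field by blast
    obtain a where a: "a < x" "\<And>\<tau>. a < \<tau> \<Longrightarrow> \<tau> < x \<Longrightarrow> \<tau> \<in> Q \<Longrightarrow> P \<tau> x"
      using left[OF x] unfolding eventually_at_left_field by blast
    show "\<exists>d>0. \<forall>a b. a \<le> x \<and> x \<le> b \<and> b - a < d \<longrightarrow> a \<in> Q \<longrightarrow> b \<in> Q \<longrightarrow> P a b"
    proof (intro exI[of _ "min (b - x) (x - a)"] conjI allI impI)
      show "0 < min (b - x) (x - a)" using a b by simp
      fix c d assume *: "c \<le> x \<and> x \<le> d \<and> d - c < min (b - x) (x - a)" "c \<in> Q" "d \<in> Q"
      have "P c x" using a(2)[of c] * refl[OF x] by (cases "c = x") auto
      moreover have "P x d" using b(2)[of d] * refl[OF x] by (cases "d = x") auto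
      ultimately show "P c d" using trans x * by blast
    qed
  qed
  with st show ?thesis by blast
qed

text \<open>Multiplied by \<open>norm u\<close>, the difference is \<open>u - v\<close> plus a
  radial correction, each of norm at most \<open>norm (u - v)\<close>. The case \<open>v = 0\<close>
  is included, with \<open>sgn 0 = 0\<close>.\<close>

lemma norm_sgn_diff_le:
  fixes u v :: "'v::real_inner"
  assumes "u \<noteq> 0"
  shows "norm (sgn u - sgn v) \<le> 2 * norm (u - v) / norm u"
proof -
  have "norm u * norm (sgn u - sgn v) = norm (norm u *\<^sub>R sgn u - norm u *\<^sub>R sgn v)"
    by (simp flip: scaleR_diff_right)
  also have "norm u *\<^sub>R sgn u - norm u *\<^sub>R sgn v = (u - v) + (norm v - norm u) *\<^sub>R sgn v"
    using assms by (cases "v = 0") (auto simp: sgn_div_norm algebra_simps)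
  also have "norm \<dots> \<le> norm (u - v) + \<bar>norm v - norm u\<bar> * norm (sgn v)"
    by (metis norm_scaleR norm_triangle_ineq)
  also have "\<dots> \<le> norm (u - v) + norm (u - v) * 1"
    using norm_triangle_ineq3[of v u]
    by (intro add_mono mult_mono) (auto simp: norm_sgn norm_minus_commute)
  finally show ?thesis using assms by (simp add: field_simps)
qed

text \<open>A vector with inner product one with \<open>e\<close> is its unit vector divided by the
  component of that along \<open>e\<close>, so normalisation has a Lipschitz inverse on bounded
  parts of this hyperplane. Velocities can then be compared through unit tangents.\<close>

lemma norm_diff_le_sgn:
  fixes e u v :: "'v::real_inner"
  assumes e: "norm e = 1" and u: "u \<bullet> e = 1" "norm u \<le> L" and v: "v \<bullet> e = 1" "norm v \<le> L"
  shows "norm (u - v) \<le> 2 * L\<^sup>2 * norm (sgn u - sgn v)"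
proof -
  let ?a = "sgn u" and ?b = "sgn v"
  have nz: "u \<noteq> 0" "v \<noteq> 0" using u v by auto
  have ue: "u = norm u *\<^sub>R ?a" "v = norm v *\<^sub>R ?b" using nz by (simp_all add: sgn_div_norm)
  have ae: "norm u * (?a \<bullet> e) = 1" "norm v * (?b \<bullet> e) = 1"
    using u v ue by (metis inner_scaleR_left)+
  have "u - v = (norm u * norm v) *\<^sub>R ((?b \<bullet> e) *\<^sub>R ?a - (?a \<bullet> e) *\<^sub>R ?b)"
  proof -
    have "(norm u * norm v) *\<^sub>R ((?b \<bullet> e) *\<^sub>R ?a - (?a \<bullet> e) *\<^sub>R ?b)
        = (norm u * (norm v * (?b \<bullet> e))) *\<^sub>R ?a - (norm v * (norm u * (?a \<bullet> e))) *\<^sub>R ?b"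
      by (simp add: scaleR_diff_right mult_ac)
    also have "\<dots> = u - v" unfolding ae using ue by simp
    finally show ?thesis by simp
  qed
  also have "norm \<dots> = norm u * norm v * norm ((?b \<bullet> e) *\<^sub>R ?a - (?a \<bullet> e) *\<^sub>R ?b)"
    by simp
  also have "(?b \<bullet> e) *\<^sub>R ?a - (?a \<bullet> e) *\<^sub>R ?b = (?b \<bullet> e) *\<^sub>R (?a - ?b) + ((?b - ?a) \<bullet> e) *\<^sub>R ?b"
    by (simp add: algebra_simps)
  also have "norm u * norm v * norm \<dots> \<le> (L * L) * (1 * norm (?a - ?b) + norm (?a - ?b) * 1)"
  proof -
    have be: "\<bar>?b \<bullet> e\<bar> \<le> 1"
      using Cauchy_Schwarz_ineq2[of ?b e] e nz by (simp add: norm_sgn)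
    have de: "\<bar>(?b - ?a) \<bullet> e\<bar> \<le> norm (?a - ?b)"
      using Cauchy_Schwarz_ineq2[of "?b - ?a" e] e by (simp add: norm_minus_commute)
    have "norm ((?b \<bullet> e) *\<^sub>R (?a - ?b) + ((?b - ?a) \<bullet> e) *\<^sub>R ?b)
        \<le> \<bar>?b \<bullet> e\<bar> * norm (?a - ?b) + \<bar>(?b - ?a) \<bullet> e\<bar> * norm ?b"
      by (metis norm_scaleR norm_triangle_ineq)
    also have "\<dots> \<le> 1 * norm (?a - ?b) + norm (?a - ?b) * 1"
      using be de nz by (intro add_mono mult_mono) (auto simp: norm_sgn)
    finally show ?thesis
      using u(2) v(2) order_trans[OF norm_ge_zero u(2)]
      by (intro mult_mono) auto
  qed
  finally show ?thesis by (simp add: power2_eq_square)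
qed

text \<open>One minus the cosine of an angle is half the squared chord. This converts the excess in
  the monotonicity formula into an angle.\<close>

lemma norm_minus_inner_sgn:
  fixes y u :: "'v::real_inner"
  assumes "y \<noteq> 0" "u \<noteq> 0"
  shows "norm y - y \<bullet> sgn u = norm y * (norm (sgn y - sgn u))\<^sup>2 / 2"
proof -
  have y: "y = norm y *\<^sub>R sgn y" using assms by (simp add: sgn_div_norm)
  have "sgn y \<bullet> sgn y = 1" "sgn u \<bullet> sgn u = 1"
    using assms by (simp_all add: norm_sgn dot_square_norm)
  then have "(norm (sgn y - sgn u))\<^sup>2 = 2 - 2 * (sgn y \<bullet> sgn u)"
    by (simp add: power2_norm_eq_inner inner_diff inner_commute)
  moreover have "y \<bullet> sgn u = norm y * (sgn y \<bullet> sgn u)"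
    using y by (metis inner_scaleR_left)
  ultimately show ?thesis by (simp add: right_diff_distrib)
qed

text \<open>Each term is \<open>2 - 2 * (s a \<bullet> s b)\<close>, so the total deviation depends
  only on the sum of the unit vectors, which is the conserved quantity.\<close>

lemma sum_sum_norm_diff_unit:
  fixes s :: "'a \<Rightarrow> 'v::real_inner"
  assumes "finite I" "\<And>a. a \<in> I \<Longrightarrow> norm (s a) = 1"
  shows "(\<Sum>a\<in>I. \<Sum>b\<in>I. (norm (s a - s b))\<^sup>2) = 2 * (real (card I))\<^sup>2 - 2 * (norm (\<Sum>a\<in>I. s a))\<^sup>2"
proof -
  have "(\<Sum>a\<in>I. \<Sum>b\<in>I. (norm (s a - s b))\<^sup>2) = (\<Sum>a\<in>I. \<Sum>b\<in>I. 2 - 2 * (s a \<bullet> s b))"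
    using assms by (intro sum.cong refl)
      (auto simp: power2_norm_eq_inner inner_diff inner_commute norm_eq_1)
  also have "\<dots> = 2 * (real (card I))\<^sup>2 - 2 * (\<Sum>a\<in>I. \<Sum>b\<in>I. s a \<bullet> s b)"
    by (simp add: sum_subtractf sum_distrib_left power2_eq_square)
  also have "(\<Sum>a\<in>I. \<Sum>b\<in>I. s a \<bullet> s b) = (norm (\<Sum>a\<in>I. s a))\<^sup>2"
    by (simp add: power2_norm_eq_inner inner_sum_left inner_sum_right inner_commute)
  finally show ?thesis .
qed

lemma norm_diff_unit_le:
  fixes s :: "'a \<Rightarrow> 'v::real_inner"
  assumes "finite I" "\<And>a. a \<in> I \<Longrightarrow> norm (s a) = 1" "a \<in> I" "b \<in> I"
  shows "norm (s a - s b) \<le> sqrt (2 * (real (card I))\<^sup>2 - 2 * (norm (\<Sum>a\<in>I. s a))\<^sup>2)"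
proof -
  have "(norm (s a - s b))\<^sup>2 \<le> (\<Sum>b\<in>I. (norm (s a - s b))\<^sup>2)"
    using assms by (intro member_le_sum) auto
  also have "\<dots> \<le> (\<Sum>a\<in>I. \<Sum>b\<in>I. (norm (s a - s b))\<^sup>2)"
    using assms by (intro member_le_sum[where f = "\<lambda>a. \<Sum>b\<in>I. (norm (s a - s b))\<^sup>2"]) (auto intro: sum_nonneg)
  also have "\<dots> = 2 * (real (card I))\<^sup>2 - 2 * (norm (\<Sum>a\<in>I. s a))\<^sup>2"
    using assms by (intro sum_sum_norm_diff_unit) auto
  finally show ?thesis by (rule real_le_rsqrt)
qed

text \<open>Averages the pairwise bound over \<open>b\<close>. The mean survives meetings, so it
  links unit tangents at different times.\<close>

lemma norm_diff_mean_unit_le: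
  fixes s :: "'a \<Rightarrow> 'v::real_inner"
  assumes "finite I" "\<And>a. a \<in> I \<Longrightarrow> norm (s a) = 1" "a \<in> I"
  shows "norm (s a - (\<Sum>b\<in>I. s b) /\<^sub>R card I) \<le> sqrt (2 * (real (card I))\<^sup>2 - 2 * (norm (\<Sum>a\<in>I. s a))\<^sup>2)"
    (is "_ \<le> ?w")
proof -
  have c: "card I > 0" using assms card_gt_0_iff by blast
  have "norm (\<Sum>b\<in>I. s a - s b) \<le> (\<Sum>b\<in>I. ?w)"
    using assms by (intro sum_norm_le norm_diff_unit_le) auto
  also have "(\<Sum>b\<in>I. s a - s b) = card I *\<^sub>R (s a - (\<Sum>b\<in>I. s b) /\<^sub>R card I)"
    using c by (simp add: sum_subtractf scaleR_diff_right scaleR_left.sum sum_constant_scaleR)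
  finally show ?thesis using c by simp
qed

lemma deviation_le_of_norm_diff_le:
  fixes s :: "'a \<Rightarrow> 'v::real_inner" and c :: real
  assumes "finite I" "\<And>a. a \<in> I \<Longrightarrow> norm (s a) = 1" "c \<ge> 0"
    and "\<And>a b. a \<in> I \<Longrightarrow> b \<in> I \<Longrightarrow> norm (s a - s b) \<le> c"
  shows "sqrt (2 * (real (card I))\<^sup>2 - 2 * (norm (\<Sum>a\<in>I. s a))\<^sup>2) \<le> card I * c"
proof -
  have "(\<Sum>a\<in>I. \<Sum>b\<in>I. (norm (s a - s b))\<^sup>2) \<le> (\<Sum>a\<in>I. \<Sum>b\<in>I. c\<^sup>2)"
    using assms by (intro sum_mono power_mono) auto
  also have "\<dots> = (card I * c)\<^sup>2" by (simp add: power2_eq_square)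
  finally show ?thesis
    using assms sum_sum_norm_diff_unit[of I s] by (intro real_le_lsqrt) auto
qed

text \<open>A finite set that cannot be split into two unrelated parts is exhausted by adding related
  elements one at a time, starting from any given element.\<close>

lemma unsplit_norm_diff_le:
  fixes f :: "'a \<Rightarrow> 'v::real_normed_vector" and c :: real
  assumes fin: "finite I" and c: "c \<ge> 0"
    and unsplit: "\<And>J. J \<subset> I \<Longrightarrow> J \<noteq> {} \<Longrightarrow> \<exists>a\<in>J. \<exists>b\<in>I - J. R a b"
    and R: "\<And>a b. a \<in> I \<Longrightarrow> b \<in> I \<Longrightarrow> R a b \<Longrightarrow> norm (f a - f b) \<le> c"
    and ab: "a \<in> I" "b \<in> I"
  shows "norm (f a - f b) \<le> card I * c"
proof -
  have *: "\<exists>B\<subseteq>I. a \<in> B \<and> card B = Suc j \<and> (\<forall>b\<in>B. norm (f a - f b) \<le> j * c)" if "j < card I" for j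
    using that
  proof (induction j)
    case 0
    show ?case using ab by (intro exI[of _ "{a}"]) auto
  next
    case (Suc j)
    then obtain B where B: "B \<subseteq> I" "a \<in> B" "card B = Suc j" "\<forall>b\<in>B. norm (f a - f b) \<le> j * c"
      by auto
    have "B \<subset> I" using B Suc.prems by auto
    then obtain p q where pq: "p \<in> B" "q \<in> I - B" "R p q" using unsplit[of B] B by blast
    have "norm (f a - f q) \<le> norm (f a - f p) + norm (f p - f q)"
      by (metis diff_add_cancel add_diff_eq norm_triangle_ineq)
    also have "\<dots> \<le> j * c + c" using B pq R[of p q] by (intro add_mono) auto
    finally have q: "norm (f a - f q) \<le> Suc j * c" by (simp add: algebra_simps)
    have m: "j * c \<le> Suc j * c" using c by (simp add: algebra_simps)
    have "finite B" using B fin finite_subset by blast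
    then show ?case using B pq q m by (intro exI[of _ "insert q B"]) (auto intro: order_trans)
  qed
  have "card I > 0" using ab fin card_gt_0_iff by blast
  then obtain B where B: "B \<subseteq> I" "card B = card I" "\<forall>b\<in>B. norm (f a - f b) \<le> (card I - 1) * c"
    using *[of "card I - 1"] by auto
  then have "B = I" using fin by (simp add: card_subset_eq)
  then have "norm (f a - f b) \<le> (card I - 1) * c" using B ab by auto
  also have "\<dots> \<le> card I * c" using c by (intro mult_right_mono) auto
  finally show ?thesis .
qed

section \<open>Particles with conserved sum of unit tangents\<close>

text \<open>The components orthogonal to \<open>e\<close> are point particles and the
  component along \<open>e\<close> is time; \<open>vl\<close> and \<open>vr\<close> are the one-sided velocities. At a meeting point
  the velocities may change in any way that preserves the sum of the unit tangents.\<close>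

locale strands =
  fixes e :: "'v::real_inner" and L :: real and I :: "'a set"
    and x vl vr :: "'a \<Rightarrow> real \<Rightarrow> 'v" and Q :: "real set"
  assumes norm_e: "norm e = 1" and finite_I: "finite I" and interval_Q: "is_interval Q"
    and position: "\<And>a t. a \<in> I \<Longrightarrow> t \<in> Q \<Longrightarrow> x a t \<bullet> e = t"
    and vr: "\<And>a t. a \<in> I \<Longrightarrow> t \<in> Q \<Longrightarrow> vr a t \<bullet> e = 1" "\<And>a t. a \<in> I \<Longrightarrow> t \<in> Q \<Longrightarrow> norm (vr a t) \<le> L"
    and vl: "\<And>a t. a \<in> I \<Longrightarrow> t \<in> Q \<Longrightarrow> vl a t \<bullet> e = 1" "\<And>a t. a \<in> I \<Longrightarrow> t \<in> Q \<Longrightarrow> norm (vl a t) \<le> L"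
    and right: "\<And>a t. a \<in> I \<Longrightarrow> t \<in> Q \<Longrightarrow> \<forall>\<^sub>F \<tau> in at_right t.
       x a \<tau> = x a t + (\<tau> - t) *\<^sub>R vr a t \<and> vr a \<tau> = vr a t \<and> vl a \<tau> = vr a t"
    and left: "\<And>a t. a \<in> I \<Longrightarrow> t \<in> Q \<Longrightarrow> \<forall>\<^sub>F \<tau> in at_left t.
       x a \<tau> = x a t + (\<tau> - t) *\<^sub>R vl a t \<and> vr a \<tau> = vl a t \<and> vl a \<tau> = vl a t"
    and balance: "\<And>t z. t \<in> Q \<Longrightarrow>
       (\<Sum>a\<in>{a \<in> I. x a t = z}. sgn (vl a t)) = (\<Sum>a\<in>{a \<in> I. x a t = z}. sgn (vr a t))"
begin

text \<open>Since \<open>a\<close> and \<open>b\<close> may be equal or distinct, a crossing without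
  any change of velocity counts too, and the notion does not depend on how labels pass through a
  meeting.\<close>

definition event :: "real \<Rightarrow> bool" where
  "event t \<longleftrightarrow> (\<exists>a\<in>I. \<exists>b\<in>I. x a t = x b t \<and> vl a t \<noteq> vr b t)"

definition spread :: "real \<Rightarrow> real" where
  "spread t = (\<Sum>a\<in>I. \<Sum>b\<in>I. norm (x a t - x b t))"

text \<open>By \<open>sum_sum_norm_diff_unit\<close> this is the root of the sum of all squared
  differences of unit tangents; the form through their sum makes conservation immediate.\<close>

definition tilt :: "real \<Rightarrow> real" where
  "tilt t = sqrt (2 * (real (card I))\<^sup>2 - 2 * (norm (\<Sum>a\<in>I. sgn (vr a t)))\<^sup>2)"

definition separated :: "'a set \<Rightarrow> real set \<Rightarrow> bool" where
  "separated J R \<longleftrightarrow> (\<forall>t\<in>R. \<forall>a\<in>J. \<forall>b\<in>I - J. x a t \<noteq> x b t)"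

lemma Q_mem: "s \<in> Q \<Longrightarrow> t \<in> Q \<Longrightarrow> s \<le> \<tau> \<Longrightarrow> \<tau> \<le> t \<Longrightarrow> \<tau> \<in> Q"
  using interval_Q by (meson mem_is_interval_1_I)

lemma right_all: "t \<in> Q \<Longrightarrow> \<forall>\<^sub>F \<tau> in at_right t. t < \<tau> \<and> (\<forall>a\<in>I.
    x a \<tau> = x a t + (\<tau> - t) *\<^sub>R vr a t \<and> vr a \<tau> = vr a t \<and> vl a \<tau> = vr a t)"
  using right finite_I
  by (intro eventually_conj eventually_at_right_less eventually_ball_finite) auto

lemma left_all: "t \<in> Q \<Longrightarrow> \<forall>\<^sub>F \<tau> in at_left t. \<tau> < t \<and> (\<forall>a\<in>I.
    x a \<tau> = x a t + (\<tau> - t) *\<^sub>R vl a t \<and> vr a \<tau> = vl a t \<and> vl a \<tau> = vl a t)"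
  using left finite_I
  by (intro eventually_conj eventually_at_left_field[THEN iffD2] eventually_ball_finite)
    (auto intro: exI[of _ "t - 1"])

text \<open>Both step cases are phrased as free motion from the earlier to the later time with
  velocity \<open>vr\<close> of the earlier one; only in the case \<open>left\<close> can the
  velocity jump, at the final time.\<close>

lemma strand_induct [consumes 3, case_names refl trans right left]:
  assumes st: "s \<in> Q" "t \<in> Q" "s \<le> t"
    and refl: "\<And>t. t \<in> Q \<Longrightarrow> P t t"
    and trans: "\<And>r s t. \<lbrakk>r \<in> Q; s \<in> Q; t \<in> Q; r \<le> s; s \<le> t; P r s; P s t\<rbrakk> \<Longrightarrow> P r t"
    and right: "\<And>t \<tau>. \<lbrakk>t \<in> Q; \<tau> \<in> Q; t < \<tau>;
       \<forall>a\<in>I. x a \<tau> = x a t + (\<tau> - t) *\<^sub>R vr a t \<and> vr a \<tau> = vr a t \<and> vl a \<tau> = vr a t\<rbrakk> \<Longrightarrow> P t \<tau>"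
    and left: "\<And>t \<tau>. \<lbrakk>t \<in> Q; \<tau> \<in> Q; \<tau> < t;
       \<forall>a\<in>I. x a t = x a \<tau> + (t - \<tau>) *\<^sub>R vr a \<tau> \<and> vr a \<tau> = vl a t \<and> vl a \<tau> = vl a t\<rbrakk> \<Longrightarrow> P \<tau> t"
  shows "P s t"
  using interval_Q st
proof (rule interval_local_induct)
  fix t assume t: "t \<in> Q"
  show "\<forall>\<^sub>F \<tau> in at_right t. \<tau> \<in> Q \<longrightarrow> P t \<tau>"
    using right_all[OF t] by eventually_elim (use right t in blast)
  show "\<forall>\<^sub>F \<tau> in at_left t. \<tau> \<in> Q \<longrightarrow> P \<tau> t"
    using left_all[OF t]
  proof eventually_elim
    case (elim \<tau>)
    then have "\<forall>a\<in>I. x a t = x a \<tau> + (t - \<tau>) *\<^sub>R vr a \<tau>"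
      by (auto simp: algebra_simps)
    then show ?case using left[of t \<tau>] t elim by blast
  qed
qed (use refl trans in blast)+

text \<open>Time reversal together with a point reflection of space. This keeps the component along
  \<open>e\<close> equal to time and leaves velocities unchanged, apart from swapping
  \<open>vl\<close> and \<open>vr\<close>.\<close>

lemma reflect:
  "strands e L I (\<lambda>a t. - x a (- t)) (\<lambda>a t. vr a (- t)) (\<lambda>a t. vl a (- t)) (uminus ` Q)"
proof
  show "is_interval (uminus ` Q)"
    using interval_Q is_interval_uminus by blast
  fix a t assume a: "a \<in> I" and "t \<in> uminus ` Q"
  then have t: "- t \<in> Q" by auto
  show "\<forall>\<^sub>F \<tau> in at_right t. - x a (- \<tau>) = - x a (- t) + (\<tau> - t) *\<^sub>R vl a (- t) \<and>
     vl a (- \<tau>) = vl a (- t) \<and> vr a (- \<tau>) = vl a (- t)"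
  proof -
    have "\<forall>\<^sub>F \<tau> in at_right t. x a (- \<tau>) = x a (- t) + ((- \<tau>) - (- t)) *\<^sub>R vl a (- t) \<and>
       vr a (- \<tau>) = vl a (- t) \<and> vl a (- \<tau>) = vl a (- t)"
      using left[OF a t] by (simp add: at_left_minus eventually_filtermap)
    then show ?thesis by eventually_elim (auto simp: algebra_simps)
  qed
  show "\<forall>\<^sub>F \<tau> in at_left t. - x a (- \<tau>) = - x a (- t) + (\<tau> - t) *\<^sub>R vr a (- t) \<and>
     vl a (- \<tau>) = vr a (- t) \<and> vr a (- \<tau>) = vr a (- t)"
  proof -
    have "\<forall>\<^sub>F \<tau> in at_left t. x a (- \<tau>) = x a (- t) + ((- \<tau>) - (- t)) *\<^sub>R vr a (- t) \<and>
       vr a (- \<tau>) = vr a (- t) \<and> vl a (- \<tau>) = vr a (- t)"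
      using right[OF a t] by (simp add: at_left_minus eventually_filtermap add.commute)
    then show ?thesis by eventually_elim (auto simp: algebra_simps)
  qed
next
  fix t z assume "t \<in> uminus ` Q"
  then have t: "- t \<in> Q" by auto
  have "{a \<in> I. - x a (- t) = z} = {a \<in> I. x a (- t) = - z}" by auto
  then show "(\<Sum>a | a \<in> I \<and> - x a (- t) = z. sgn (vr a (- t)))
      = (\<Sum>a | a \<in> I \<and> - x a (- t) = z. sgn (vl a (- t)))"
    using balance[OF t, of "- z"] by simp
qed (use norm_e finite_I position vl vr in auto)

text \<open>All particles at a meeting belong to the same group, so the balance at a point is either
  that of the full system or one of empty sums.\<close>

lemma subsystem:
  assumes J: "J \<subseteq> I" "separated J R" and R: "is_interval R" "R \<subseteq> Q"
  shows "strands e L J x vl vr R"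
proof
  show "norm e = 1" "finite J" "is_interval R" using norm_e finite_I J R by (auto intro: finite_subset)
  fix a t assume "a \<in> J" "t \<in> R"
  then have a: "a \<in> I" "t \<in> Q" using J R by auto
  note position[OF a] vr[OF a] vl[OF a] right[OF a] left[OF a]
  then show "x a t \<bullet> e = t" "vr a t \<bullet> e = 1" "norm (vr a t) \<le> L" "vl a t \<bullet> e = 1" "norm (vl a t) \<le> L"
    "\<forall>\<^sub>F \<tau> in at_right t. x a \<tau> = x a t + (\<tau> - t) *\<^sub>R vr a t \<and> vr a \<tau> = vr a t \<and> vl a \<tau> = vr a t"
    "\<forall>\<^sub>F \<tau> in at_left t. x a \<tau> = x a t + (\<tau> - t) *\<^sub>R vl a t \<and> vr a \<tau> = vl a t \<and> vl a \<tau> = vl a t"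
    by blast+
next
  fix t z assume t: "t \<in> R"
  have "{a \<in> J. x a t = z} = {a \<in> I. x a t = z} \<or> {a \<in> J. x a t = z} = {}"
    using J t unfolding separated_def by blast
  then show "(\<Sum>a\<in>{a \<in> J. x a t = z}. sgn (vl a t)) = (\<Sum>a\<in>{a \<in> J. x a t = z}. sgn (vr a t))"
  proof
    assume eq: "{a \<in> J. x a t = z} = {a \<in> I. x a t = z}"
    show ?thesis unfolding eq using balance t R by blast
  next
    assume eq: "{a \<in> J. x a t = z} = {}"
    show ?thesis unfolding eq by simp
  qed
qed

lemma separated_compl: "J \<subseteq> I \<Longrightarrow> separated J R \<Longrightarrow> separated (I - J) R"
  unfolding separated_def by (metis Diff_iff)

section \<open>Conserved quantities and the monotonicity formula\<close>

text \<open>Grouping by position lets \<open>balance\<close> be applied at each meeting point;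
  factors that depend on the position alone are constant on a group.\<close>

lemma sum_by_position:
  "(\<Sum>a\<in>I. f (x a t) (g a)) = (\<Sum>z\<in>(\<lambda>a. x a t) ` I. \<Sum>a\<in>{a \<in> I. x a t = z}. f z (g a))"
  by (subst sum.image_gen[OF finite_I, of _ "\<lambda>a. x a t"]) (auto intro!: sum.cong)

lemma sum_sgn_vl:
  assumes "t \<in> Q" shows "(\<Sum>a\<in>I. sgn (vl a t)) = (\<Sum>a\<in>I. sgn (vr a t))"
  using sum_by_position[of "\<lambda>z g. g" t "\<lambda>a. sgn (vl a t)"]
    sum_by_position[of "\<lambda>z g. g" t "\<lambda>a. sgn (vr a t)"] balance[OF assms] by simp

lemma sum_inner_sgn_vl:
  assumes "t \<in> Q"
  shows "(\<Sum>a\<in>I. (x a t - z0) \<bullet> sgn (vl a t)) = (\<Sum>a\<in>I. (x a t - z0) \<bullet> sgn (vr a t))"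
  using sum_by_position[of "\<lambda>z g. (z - z0) \<bullet> g" t "\<lambda>a. sgn (vl a t)"]
    sum_by_position[of "\<lambda>z g. (z - z0) \<bullet> g" t "\<lambda>a. sgn (vr a t)"] balance[OF assms]
  by (simp flip: inner_sum_right)

lemma sum_sgn_const:
  assumes "s \<in> Q" "t \<in> Q"
  shows "(\<Sum>a\<in>I. sgn (vr a s)) = (\<Sum>a\<in>I. sgn (vr a t))"
proof -
  have *: "(\<Sum>a\<in>I. sgn (vr a s)) = (\<Sum>a\<in>I. sgn (vr a t))" if "s \<in> Q" "t \<in> Q" "s \<le> t" for s t
    using that
  proof (induction rule: strand_induct)
    case (right t \<tau>)
    then show ?case by simp
  next
    case (left t \<tau>)
    then show ?case using sum_sgn_vl[of t] by simp
  qed auto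
  show ?thesis
  proof (cases "s \<le> t")
    case True
    then show ?thesis using assms by (intro *)
  next
    case False
    then show ?thesis using assms by (intro *[symmetric]) auto
  qed
qed

lemma tilt_const: "s \<in> Q \<Longrightarrow> t \<in> Q \<Longrightarrow> tilt s = tilt t"
  unfolding tilt_def using sum_sgn_const by metis

lemma tilt_nonneg: "tilt t \<ge> 0"
proof -
  have "norm (\<Sum>a\<in>I. sgn (vr a t)) \<le> (\<Sum>a\<in>I. 1)"
    by (intro sum_norm_le) (auto simp: norm_sgn)
  then show ?thesis unfolding tilt_def by (simp add: power_mono)
qed

lemma vr_nonzero: "vr a t \<noteq> 0" and vl_nonzero: "vl a t \<noteq> 0" if "a \<in> I" "t \<in> Q"
  using vr(1)[OF that] vl(1)[OF that] by auto

lemma L_ge_1: "L \<ge> 1" if "a \<in> I" "t \<in> Q"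
  using vr[OF that] norm_e Cauchy_Schwarz_ineq2[of "vr a t" e] by simp

text \<open>Both tangents lie within \<open>tilt t\<close> of the mean, and the mean is the same at
  the times \<open>s\<close> and \<open>t\<close>.\<close>

lemma norm_sgn_vr_diff:
  assumes "a \<in> I" "b \<in> I" "s \<in> Q" "t \<in> Q"
  shows "norm (sgn (vr a s) - sgn (vr b t)) \<le> 2 * tilt t"
proof -
  have "norm (sgn (vr a s) - (\<Sum>b\<in>I. sgn (vr b s)) /\<^sub>R card I) \<le> tilt s"
    unfolding tilt_def using assms finite_I vr_nonzero by (intro norm_diff_mean_unit_le) (auto simp: norm_sgn)
  moreover have "norm (sgn (vr b t) - (\<Sum>b\<in>I. sgn (vr b t)) /\<^sub>R card I) \<le> tilt t"
    unfolding tilt_def using assms finite_I vr_nonzero by (intro norm_diff_mean_unit_le) (auto simp: norm_sgn)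
  ultimately show ?thesis
    using sum_sgn_const[of s t] tilt_const[of s t] assms
      norm_triangle_sub norm_diff_triangle_le[of "sgn (vr a s)" "(\<Sum>b\<in>I. sgn (vr b s)) /\<^sub>R card I" "tilt t" "sgn (vr b t)" "tilt t"]
    by (simp add: norm_minus_commute)
qed

lemma norm_vr_diff:
  assumes "a \<in> I" "b \<in> I" "s \<in> Q" "t \<in> Q"
  shows "norm (vr a s - vr b t) \<le> 4 * L\<^sup>2 * tilt t"
proof -
  have "norm (vr a s - vr b t) \<le> 2 * L\<^sup>2 * norm (sgn (vr a s) - sgn (vr b t))"
    using assms norm_e vr by (intro norm_diff_le_sgn) auto
  also have "\<dots> \<le> 2 * L\<^sup>2 * (2 * tilt t)"
    using assms by (intro mult_left_mono norm_sgn_vr_diff) auto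
  finally show ?thesis by simp
qed

text \<open>Zero tilt makes all incoming and all outgoing tangents equal to the mean, hence all
  velocities equal.\<close>

lemma no_event_if_tilt_zero:
  assumes "t \<in> Q" "tilt t = 0"
  shows "\<not> event t"
proof -
  let ?c = "(\<Sum>b\<in>I. sgn (vr b t)) /\<^sub>R card I"
  have "vl a t = vr b t" if "a \<in> I" "b \<in> I" for a b
  proof -
    have "norm (sgn (vl a t) - (\<Sum>b\<in>I. sgn (vl b t)) /\<^sub>R card I) \<le> tilt t"
      unfolding tilt_def sum_sgn_vl[OF assms(1), symmetric]
      using assms that finite_I vl_nonzero by (intro norm_diff_mean_unit_le) (auto simp: norm_sgn)
    then have 1: "sgn (vl a t) = ?c" using sum_sgn_vl[OF assms(1)] assms by simp
    have "norm (sgn (vr b t) - ?c) \<le> tilt t"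
      unfolding tilt_def
      using assms that finite_I vr_nonzero by (intro norm_diff_mean_unit_le) (auto simp: norm_sgn)
    then have 2: "sgn (vr b t) = ?c" using assms by simp
    have "norm (vl a t - vr b t) \<le> 2 * L\<^sup>2 * norm (sgn (vl a t) - sgn (vr b t))"
      using assms that norm_e vr vl by (intro norm_diff_le_sgn) auto
    then show ?thesis using 1 2 by simp
  qed
  then show ?thesis unfolding event_def by blast
qed

text \<open>A mean value inequality, additive over consecutive intervals. The frame \<open>u\<close>
  is free: zero gives a speed bound, another velocity a bound on relative motion.\<close>

lemma norm_displacement:
  assumes st: "s \<in> Q" "t \<in> Q" "s \<le> t" and a: "a \<in> I"
    and u: "\<And>\<tau>. \<tau> \<in> Q \<Longrightarrow> norm (vr a \<tau> - u) \<le> c"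
  shows "norm (x a t - x a s - (t - s) *\<^sub>R u) \<le> c * (t - s)"
  using st
proof (induction rule: strand_induct)
  case (trans r s t)
  have "x a t - x a r - (t - r) *\<^sub>R u = (x a t - x a s - (t - s) *\<^sub>R u) + (x a s - x a r - (s - r) *\<^sub>R u)"
    by (simp add: algebra_simps)
  also have "norm \<dots> \<le> c * (t - s) + c * (s - r)"
    using trans by (intro norm_triangle_mono) auto
  finally show ?case by (simp add: algebra_simps)
next
  case (right t \<tau>)
  then have "x a \<tau> = x a t + (\<tau> - t) *\<^sub>R vr a t" using a by blast
  then have "x a \<tau> - x a t - (\<tau> - t) *\<^sub>R u = (\<tau> - t) *\<^sub>R (vr a t - u)"
    by (simp add: algebra_simps)
  then show ?case using u[of t] right by (simp add: mult.commute)
next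
  case (left t \<tau>)
  then have "x a t = x a \<tau> + (t - \<tau>) *\<^sub>R vr a \<tau>" using a by blast
  then have "x a t - x a \<tau> - (t - \<tau>) *\<^sub>R u = (t - \<tau>) *\<^sub>R (vr a \<tau> - u)"
    by (simp add: algebra_simps)
  then show ?case using u[of \<tau>] left by (simp add: mult.commute)
qed auto

text \<open>The monotonicity formula: between meetings \<open>y \<bullet> sgn v\<close> grows with speed \<open>norm v\<close>, which is the
  largest possible speed of \<open>norm y\<close>, and balance makes the sum of the inner products continuous.\<close>

lemma excess_decreasing:
  assumes st: "s \<in> Q" "t \<in> Q" "s \<le> t"
  shows "(\<Sum>a\<in>I. norm (x a t - z0) - (x a t - z0) \<bullet> sgn (vr a t))
       \<le> (\<Sum>a\<in>I. norm (x a s - z0) - (x a s - z0) \<bullet> sgn (vr a s))" (is "?H t \<le> ?H s")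
proof -
  have step: "norm (y + d *\<^sub>R v) - (y + d *\<^sub>R v) \<bullet> sgn v \<le> norm y - y \<bullet> sgn v" if "d \<ge> 0" for d and y v :: 'v
  proof -
    have "norm (y + d *\<^sub>R v) \<le> norm y + d * norm v"
      using norm_triangle_ineq[of y "d *\<^sub>R v"] that by simp
    moreover have "v \<bullet> sgn v = norm v"
      by (simp add: sgn_div_norm dot_square_norm power2_eq_square field_simps)
    ultimately show ?thesis by (simp add: inner_add_left)
  qed
  show ?thesis
    using st
  proof (induction rule: strand_induct)
    case (right t \<tau>)
    have "norm (x a \<tau> - z0) - (x a \<tau> - z0) \<bullet> sgn (vr a \<tau>)
      \<le> norm (x a t - z0) - (x a t - z0) \<bullet> sgn (vr a t)" if "a \<in> I" for a
    proof -
      have "x a \<tau> = x a t + (\<tau> - t) *\<^sub>R vr a t" and v: "vr a \<tau> = vr a t"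
        using right(4) that by blast+
      then have y: "x a \<tau> - z0 = (x a t - z0) + (\<tau> - t) *\<^sub>R vr a t" by simp
      show ?thesis unfolding y v using right(3) by (intro step) simp
    qed
    then show ?case by (intro sum_mono)
  next
    case (left t \<tau>)
    have "norm (x a t - z0) - (x a t - z0) \<bullet> sgn (vl a t)
      \<le> norm (x a \<tau> - z0) - (x a \<tau> - z0) \<bullet> sgn (vr a \<tau>)" if "a \<in> I" for a
    proof -
      have "x a t = x a \<tau> + (t - \<tau>) *\<^sub>R vr a \<tau>" and "vr a \<tau> = vl a t"
        using left(4) that by blast+
      then have y: "x a t - z0 = (x a \<tau> - z0) + (t - \<tau>) *\<^sub>R vr a \<tau>" and v: "vl a t = vr a \<tau>"
        by simp_all
      show ?thesis unfolding y v using left(3) by (intro step) simp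
    qed
    then have "(\<Sum>a\<in>I. norm (x a t - z0) - (x a t - z0) \<bullet> sgn (vl a t)) \<le> ?H \<tau>" by (intro sum_mono)
    \<comment> \<open>The estimate ends with \<open>vl\<close> at time \<open>t\<close>; balance
      exchanges it for \<open>vr\<close> without affecting the norms.\<close>
    then show ?case using sum_inner_sgn_vl[OF left(1), of z0] unfolding sum_subtractf by linarith
  qed auto
qed

end

section \<open>Drift of the directions seen from a base point\<close>

text \<open>The product of \<open>2 * (2 * k + L)\<^sup>2\<close> from
  \<open>norm_diff_le_sgn\<close> and \<open>2 * sqrt k * (1 + 4 * L\<^sup>2)\<close> from
  \<open>sgn_close\<close>.\<close>

definition ray_const :: "nat \<Rightarrow> real \<Rightarrow> real" where
  "ray_const k L = 4 * (2 * k + L)\<^sup>2 * sqrt k * (1 + 4 * L\<^sup>2)"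

text \<open>The factor 13 only has to exceed the factor 12 that arises in \<open>far_separated\<close>; likewise 9 in
  \<open>piece_count\<close> has to exceed the 8 in \<open>near_separated\<close>.\<close>

definition far_const :: "nat \<Rightarrow> real \<Rightarrow> real" where
  "far_const k L = (13 * (real k)\<^sup>2 * ray_const k L)\<^sup>2"

text \<open>The right side is the integral of \<open>s powr (-3/2)\<close> from \<open>p\<close> to
  \<open>q\<close>; a bound of this form telescopes over consecutive intervals.\<close>

lemma inverse_sqrt_diff:
  fixes p q :: real
  assumes "0 < p" "p \<le> q"
  shows "(q - p) / q * (1 / sqrt p) \<le> 2 * (1 / sqrt p - 1 / sqrt q)"
proof -
  obtain a b where ab: "p = a * a" "q = b * b" "0 < a" "a \<le> b"
    using assms that[of "sqrt p" "sqrt q"] by simp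
  have "(b * b - a * a) / (b * b) * (1 / a) = ((b + a) / b) * ((b - a) / (a * b))"
    using ab(3,4) by (simp add: field_simps)
  also have "\<dots> \<le> 2 * ((b - a) / (a * b))"
    using ab(3,4) by (intro mult_right_mono) (auto simp: field_simps)
  also have "\<dots> = 2 * (1 / a - 1 / b)" using ab(3,4) by (simp add: field_simps)
  finally show ?thesis using ab(3,4) unfolding ab(1,2) by simp
qed

text \<open>\<open>z0\<close> is the origin for relative positions, and \<open>r0\<close> is the
  time in which relative velocities of order \<open>tilt t0\<close> can cover the initial
  distances.\<close>

locale strands_cone = strands +
  fixes t0 :: real and z0 :: 'a and r0 :: real
  assumes t0: "t0 \<in> Q" and z0: "z0 \<bullet> e = t0" and r0: "r0 > 0" and tilt_pos: "tilt t0 > 0"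
    and cone: "\<And>a. a \<in> I \<Longrightarrow> norm (x a t0 - z0) \<le> tilt t0 * r0"
begin

abbreviation "\<omega> \<equiv> tilt t0"
abbreviation "\<kappa> \<equiv> card I"

lemma inner_e: "a \<in> I \<Longrightarrow> t \<in> Q \<Longrightarrow> (x a t - z0) \<bullet> e = t - t0"
  by (simp add: inner_diff_left position z0)

lemma norm_ge: "a \<in> I \<Longrightarrow> t \<in> Q \<Longrightarrow> t - t0 \<le> norm (x a t - z0)"
  using Cauchy_Schwarz_ineq2[of "x a t - z0" e] norm_e inner_e[of a t] by simp

lemma norm_le:
  assumes "a \<in> I" "t \<in> Q" "t \<ge> t0"
  shows "norm (x a t - z0) \<le> \<omega> * r0 + L * (t - t0)"
proof -
  have "norm (x a t - x a t0 - (t - t0) *\<^sub>R 0) \<le> L * (t - t0)"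
    using assms t0 vr by (intro norm_displacement) auto
  then have "norm ((x a t0 - z0) + (x a t - x a t0)) \<le> \<omega> * r0 + L * (t - t0)"
    using cone[OF assms(1)] by (intro norm_triangle_mono) auto
  then show ?thesis by simp
qed

lemma tilt_le: "\<omega> \<le> 2 * \<kappa>"
  unfolding tilt_def by (intro real_le_lsqrt) (auto simp: power_mult_distrib)

lemma card_pos: "\<kappa> > 0"
  using tilt_pos finite_I by (auto simp: tilt_def card_gt_0_iff)

text \<open>At time \<open>t0 + r0\<close> the relative position is \<open>r0\<close> times the
  velocity up to an error \<open>w\<close> of order \<open>\<omega> * r0\<close>, coming from the
  initial offset and from changes of velocity. The angle is then of order \<open>\<omega>\<close>,
  and the excess is quadratic in it.\<close>

lemma excess_start:
  assumes Q: "t0 + r0 \<in> Q"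
  shows "(\<Sum>a\<in>I. norm (x a (t0 + r0) - z0) - (x a (t0 + r0) - z0) \<bullet> sgn (vr a (t0 + r0)))
     \<le> \<kappa> * (2 * (1 + 4 * L\<^sup>2)\<^sup>2 * \<omega>\<^sup>2 * r0)"
proof -
  have "norm (x a (t0 + r0) - z0) - (x a (t0 + r0) - z0) \<bullet> sgn (vr a (t0 + r0))
     \<le> 2 * (1 + 4 * L\<^sup>2)\<^sup>2 * \<omega>\<^sup>2 * r0" if a: "a \<in> I" for a
  proof -
    define y where "y = x a (t0 + r0) - z0"
    define u where "u = vr a (t0 + r0)"
    define w where "w = y - r0 *\<^sub>R u"
    have ny: "norm y \<ge> r0" using norm_ge[OF a Q] by (simp add: y_def)
    then have y0: "y \<noteq> 0" using r0 by auto
    have u0: "u \<noteq> 0" unfolding u_def using vr_nonzero a Q by blast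
    have "norm (x a (t0 + r0) - x a t0 - ((t0 + r0) - t0) *\<^sub>R u) \<le> (4 * L\<^sup>2 * \<omega>) * ((t0 + r0) - t0)"
    proof (rule norm_displacement)
      fix \<tau> assume \<tau>: "\<tau> \<in> Q"
      show "norm (vr a \<tau> - u) \<le> 4 * L\<^sup>2 * \<omega>"
        using norm_vr_diff[OF a a \<tau> Q] tilt_const[OF Q t0] by (simp add: u_def)
    qed (use t0 Q r0 a in auto)
    then have "norm ((x a t0 - z0) + (x a (t0 + r0) - x a t0 - r0 *\<^sub>R u)) \<le> \<omega> * r0 + 4 * L\<^sup>2 * \<omega> * r0"
      using cone[OF a] by (intro norm_triangle_mono) auto
    then have w: "norm w \<le> (1 + 4 * L\<^sup>2) * \<omega> * r0" by (simp add: w_def y_def algebra_simps)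
    have "norm (sgn y - sgn u) = norm (sgn y - sgn (r0 *\<^sub>R u))" using r0 by (simp add: sgn_scaleR)
    also have "\<dots> \<le> 2 * norm w / norm y" unfolding w_def using y0 by (rule norm_sgn_diff_le)
    finally have "(norm (sgn y - sgn u))\<^sup>2 \<le> (2 * norm w / norm y)\<^sup>2" by (intro power_mono) auto
    then have "norm y * (norm (sgn y - sgn u))\<^sup>2 / 2 \<le> norm y * (2 * norm w / norm y)\<^sup>2 / 2"
      by (intro divide_right_mono mult_left_mono) auto
    also have "\<dots> = 2 * (norm w)\<^sup>2 / norm y" using y0 by (simp add: power2_eq_square)
    also have "\<dots> \<le> 2 * ((1 + 4 * L\<^sup>2) * \<omega> * r0)\<^sup>2 / r0"
      using w ny r0 by (intro frac_le mult_left_mono power_mono) auto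
    also have "\<dots> = 2 * (1 + 4 * L\<^sup>2)\<^sup>2 * \<omega>\<^sup>2 * r0"
      using r0 by (simp add: power_mult_distrib power2_eq_square)
    finally show ?thesis
      using norm_minus_inner_sgn[OF y0 u0] by (simp add: y_def u_def)
  qed
  then have "(\<Sum>a\<in>I. norm (x a (t0 + r0) - z0) - (x a (t0 + r0) - z0) \<bullet> sgn (vr a (t0 + r0)))
     \<le> (\<Sum>a\<in>I. 2 * (1 + 4 * L\<^sup>2)\<^sup>2 * \<omega>\<^sup>2 * r0)" by (rule sum_mono)
  then show ?thesis by simp
qed

text \<open>All summands of the excess are nonnegative, so each is at most the total, which has not
  grown since \<open>t0 + r0\<close>. By \<open>norm_minus_inner_sgn\<close> a summand is half the
  squared chord times a length of at least \<open>t - t0\<close>.\<close>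

lemma sgn_close:
  assumes a: "a \<in> I" and t: "t \<in> Q" "t \<ge> t0 + r0"
  shows "norm (sgn (x a t - z0) - sgn (vr a t)) \<le> 2 * sqrt \<kappa> * (1 + 4 * L\<^sup>2) * \<omega> * sqrt (r0 / (t - t0))"
proof -
  let ?X = "norm (sgn (x a t - z0) - sgn (vr a t))"
  have Q: "t0 + r0 \<in> Q" using Q_mem[OF t0 t(1)] t r0 by auto
  have y0: "x b t - z0 \<noteq> 0" if "b \<in> I" for b using norm_ge[OF that t(1)] t(2) r0 by auto
  have nn: "norm (x b t - z0) - (x b t - z0) \<bullet> sgn (vr b t) \<ge> 0" if "b \<in> I" for b
    unfolding norm_minus_inner_sgn[OF y0[OF that] vr_nonzero[OF that t(1)]] by simp
  have "(t - t0) * ?X\<^sup>2 / 2 \<le> norm (x a t - z0) * ?X\<^sup>2 / 2"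
    using norm_ge[OF a t(1)] by (intro divide_right_mono mult_right_mono) auto
  also have "\<dots> = norm (x a t - z0) - (x a t - z0) \<bullet> sgn (vr a t)"
    using norm_minus_inner_sgn[OF y0[OF a] vr_nonzero[OF a t(1)]] by simp
  also have "\<dots> \<le> (\<Sum>a\<in>I. norm (x a t - z0) - (x a t - z0) \<bullet> sgn (vr a t))"
    using nn a finite_I by (intro member_le_sum[where f = "\<lambda>a. norm (x a t - z0) - (x a t - z0) \<bullet> sgn (vr a t)"]) auto
  also have "\<dots> \<le> (\<Sum>a\<in>I. norm (x a (t0 + r0) - z0) - (x a (t0 + r0) - z0) \<bullet> sgn (vr a (t0 + r0)))"
    using excess_decreasing[OF Q t(1) t(2)] .
  also have "\<dots> \<le> \<kappa> * (2 * (1 + 4 * L\<^sup>2)\<^sup>2 * \<omega>\<^sup>2 * r0)" using Q by (rule excess_start)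
  finally have "?X\<^sup>2 \<le> 4 * \<kappa> * (1 + 4 * L\<^sup>2)\<^sup>2 * \<omega>\<^sup>2 * (r0 / (t - t0))"
    using t r0 by (simp add: field_simps)
  also have "\<dots> = (2 * sqrt \<kappa> * (1 + 4 * L\<^sup>2) * \<omega> * sqrt (r0 / (t - t0)))\<^sup>2"
    using t r0 by (simp add: power_mult_distrib)
  finally show ?thesis
    by (rule power2_le_imp_le) (use tilt_pos t r0 in simp)
qed

text \<open>The mean velocity since the base point. Its component along \<open>e\<close> is one, so
  \<open>norm_diff_le_sgn\<close> compares it with \<open>vr\<close>.\<close>

abbreviation "ray a t \<equiv> (x a t - z0) /\<^sub>R (t - t0)"

lemma ray_close:
  assumes a: "a \<in> I" and t: "t \<in> Q" "t \<ge> t0 + r0"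
  shows "norm (ray a t - vr a t) \<le> ray_const \<kappa> L * \<omega> * sqrt (r0 / (t - t0))"
proof -
  have pos: "t - t0 > 0" using t r0 by simp
  have L: "L \<ge> 1" using L_ge_1[OF a t0] .
  have "norm (ray a t) = norm (x a t - z0) / (t - t0)" using pos by (simp add: divide_inverse_commute)
  also have "\<dots> \<le> (\<omega> * r0 + L * (t - t0)) / (t - t0)"
    using norm_le[OF a t(1)] pos by (intro divide_right_mono) auto
  also have "\<dots> = \<omega> * (r0 / (t - t0)) + L" using pos by (simp add: field_simps)
  \<comment> \<open>Here \<open>t - t0\<close> is at least \<open>r0\<close>, so the initial offset
    contributes at most \<open>\<omega>\<close>.\<close>
  also have "\<dots> \<le> \<omega> * 1 + L" using pos t tilt_pos by (intro add_right_mono mult_left_mono) auto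
  also have "\<dots> \<le> 2 * \<kappa> + L" using tilt_le by simp
  finally have n: "norm (ray a t) \<le> 2 * \<kappa> + L" .
  have "norm (ray a t - vr a t) \<le> 2 * (2 * \<kappa> + L)\<^sup>2 * norm (sgn (ray a t) - sgn (vr a t))"
  proof (rule norm_diff_le_sgn[OF norm_e])
    show "ray a t \<bullet> e = 1" using inner_e[OF a t(1)] pos by simp
    show "norm (vr a t) \<le> 2 * \<kappa> + L" using vr(2)[OF a t(1)] by simp
  qed (use n vr(1)[OF a t(1)] in auto)
  also have "sgn (ray a t) = sgn (x a t - z0)" using pos by (simp add: sgn_scaleR)
  also have "2 * (2 * \<kappa> + L)\<^sup>2 * norm (sgn (x a t - z0) - sgn (vr a t))
     \<le> 2 * (2 * \<kappa> + L)\<^sup>2 * (2 * sqrt \<kappa> * (1 + 4 * L\<^sup>2) * \<omega> * sqrt (r0 / (t - t0)))"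
    using sgn_close[OF a t] by (intro mult_left_mono) auto
  finally show ?thesis by (simp add: ray_const_def mult_ac)
qed

lemma ray_const_nonneg: "ray_const \<kappa> L \<ge> 0" by (simp add: ray_const_def)

text \<open>On a straight piece the new ray is a convex combination of the old ray and the velocity,
  with weight \<open>(t - s) / (t - t0)\<close> on the velocity. It moves by that weight times the
  error controlled in \<open>ray_close\<close>.\<close>

lemma ray_step:
  assumes a: "a \<in> I" and s: "s \<in> Q" "t0 + r0 \<le> s" "s \<le> t"
    and t: "x a t = x a s + (t - s) *\<^sub>R vr a s"
  shows "norm (ray a t - ray a s)
    \<le> 2 * ray_const \<kappa> L * \<omega> * sqrt r0 * (1 / sqrt (s - t0) - 1 / sqrt (t - t0))"
proof -
  define p q where "p = s - t0" and "q = t - t0"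
  have pq: "0 < p" "p \<le> q" "t - s = q - p" using s r0 by (auto simp: p_def q_def)
  have "ray a t - ray a s = ((q - p) / q) *\<^sub>R (vr a s - ray a s)"
  proof -
    have "q *\<^sub>R (ray a t - ray a s) = (x a s - z0) + (q - p) *\<^sub>R vr a s - q *\<^sub>R ray a s"
      using pq t by (simp add: scaleR_diff_right p_def[symmetric] q_def[symmetric])
    also have "x a s - z0 = p *\<^sub>R ray a s" using pq by (simp add: p_def[symmetric])
    finally have "q *\<^sub>R (ray a t - ray a s) = (q - p) *\<^sub>R (vr a s - ray a s)" by (simp add: algebra_simps)
    then have "inverse q *\<^sub>R (q *\<^sub>R (ray a t - ray a s)) = inverse q *\<^sub>R ((q - p) *\<^sub>R (vr a s - ray a s))"
      by simp
    then show ?thesis using pq by (simp add: divide_inverse_commute)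
  qed
  then have "norm (ray a t - ray a s) = (q - p) / q * norm (ray a s - vr a s)"
    using pq by (simp add: norm_minus_commute)
  also have "\<dots> \<le> (q - p) / q * (ray_const \<kappa> L * \<omega> * sqrt (r0 / p))"
    using ray_close[OF a s(1,2)] pq by (intro mult_left_mono) (auto simp: p_def)
  also have "\<dots> = ray_const \<kappa> L * \<omega> * sqrt r0 * ((q - p) / q * (1 / sqrt p))"
    by (simp add: real_sqrt_divide)
  also have "\<dots> \<le> ray_const \<kappa> L * \<omega> * sqrt r0 * (2 * (1 / sqrt p - 1 / sqrt q))"
    using pq r0 tilt_pos ray_const_nonneg by (intro mult_left_mono inverse_sqrt_diff) auto
  also have "\<dots> = 2 * ray_const \<kappa> L * \<omega> * sqrt r0 * (1 / sqrt p - 1 / sqrt q)"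
    by (simp only: mult_ac)
  finally show ?thesis by (simp only: p_def q_def)
qed

text \<open>The bounds of \<open>ray_step\<close> telescope, so the total drift stays bounded for
  arbitrarily large \<open>t\<close>.\<close>

lemma ray_drift:
  assumes a: "a \<in> I" and st: "s \<in> Q" "t \<in> Q" "s \<le> t" "t0 + r0 \<le> s"
  shows "norm (ray a t - ray a s)
    \<le> 2 * ray_const \<kappa> L * \<omega> * sqrt r0 * (1 / sqrt (s - t0) - 1 / sqrt (t - t0))"
  using st
proof (induction rule: strand_induct)
  case (trans r s t)
  let ?c = "2 * ray_const \<kappa> L * \<omega> * sqrt r0"
  have "ray a t - ray a r = (ray a t - ray a s) + (ray a s - ray a r)" by simp
  also have "norm \<dots> \<le> ?c * (1 / sqrt (s - t0) - 1 / sqrt (t - t0)) + ?c * (1 / sqrt (r - t0) - 1 / sqrt (s - t0))"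
    using trans by (intro norm_triangle_mono) auto
  also have "\<dots> = ?c * (1 / sqrt (r - t0) - 1 / sqrt (t - t0))" by (simp only: distrib_left[symmetric]) simp
  finally show ?case .
next
  case (right t \<tau>)
  then have "x a \<tau> = x a t + (\<tau> - t) *\<^sub>R vr a t" using a by blast
  then show ?case using right by (intro ray_step[OF a]) auto
next
  case (left t \<tau>)
  then have "x a t = x a \<tau> + (t - \<tau>) *\<^sub>R vr a \<tau>" using a by blast
  then show ?case using left by (intro ray_step[OF a]) auto
qed auto

text \<open>If no group split off, meetings would connect all particles. Two rays coincide at a
  meeting and drift by at most \<open>2 * K * \<omega> / B\<close> each, so all rays, and hence all
  tangents, would nearly agree at one time \<open>t1\<close>, and the tilt would be smaller than
  itself.\<close>

lemma far_separated:
  assumes far: "\<And>t. t \<in> R \<Longrightarrow> t \<in> Q \<and> t0 + far_const \<kappa> L * r0 \<le> t" and R: "R \<noteq> {}"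
  shows "\<exists>J. J \<subset> I \<and> J \<noteq> {} \<and> separated J R"
proof (rule ccontr)
  assume ns: "\<not> ?thesis"
  define K where "K = ray_const \<kappa> L"
  \<comment> \<open>The square root of \<open>far_const\<close>: beyond the far threshold
    \<open>sqrt (r0 / (t - t0))\<close> is at most \<open>1 / B\<close>, which controls both the
    drift and the error in \<open>ray_close\<close>.\<close>
  define B where "B = 13 * (real \<kappa>)\<^sup>2 * K"
  have \<kappa>: "real \<kappa> \<ge> 1" using card_pos by simp
  obtain a0 where a0: "a0 \<in> I" using card_pos card_gt_0_iff by fastforce
  have L: "L \<ge> 1" using L_ge_1[OF a0 t0] .
  have K: "K \<ge> 1"
  proof -
    have "1 * 1 * 1 * 1 \<le> 4 * (2 * \<kappa> + L)\<^sup>2 * sqrt \<kappa> * (1 + 4 * L\<^sup>2)"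
      using \<kappa> L by (intro mult_mono) auto
    then show ?thesis by (simp add: K_def ray_const_def)
  qed
  have B: "B \<ge> 1"
  proof -
    have "1 * 1 * 1 \<le> 13 * (real \<kappa>)\<^sup>2 * K" using \<kappa> K by (intro mult_mono) auto
    then show ?thesis by (simp add: B_def)
  qed
  have far': "t \<in> Q" "t0 + r0 \<le> t" "sqrt (r0 / (t - t0)) \<le> 1 / B" if t: "t \<in> R" for t
  proof -
    have *: "t \<in> Q" "B\<^sup>2 * r0 \<le> t - t0" using far[OF t] by (auto simp: far_const_def B_def K_def)
    have "1 * r0 \<le> B\<^sup>2 * r0" using B r0 by (intro mult_right_mono) auto
    then show "t \<in> Q" "t0 + r0 \<le> t" using * by auto
    have "t - t0 > 0" using \<open>t0 + r0 \<le> t\<close> r0 by simp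
    then have "r0 / (t - t0) \<le> (1 / B)\<^sup>2" using * B by (simp add: field_simps power_one_over)
    then show "sqrt (r0 / (t - t0)) \<le> 1 / B" using B by (intro real_le_lsqrt) auto
  qed
  have drift: "norm (ray a t - ray a s) \<le> 2 * K * \<omega> / B" if a: "a \<in> I" and s: "s \<in> R" and t: "t \<in> R" for a s t
  proof -
    have *: "norm (ray a t - ray a s) \<le> 2 * K * \<omega> / B" if "s \<in> R" "t \<in> R" "s \<le> t" for s t
    proof -
      have pos: "s - t0 > 0" "t - t0 > 0" using far'[of s] far'[of t] r0 that by auto
      have "norm (ray a t - ray a s) \<le> 2 * K * \<omega> * sqrt r0 * (1 / sqrt (s - t0) - 1 / sqrt (t - t0))"
        unfolding K_def using far'[of s] far'[of t] that by (intro ray_drift a) auto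
      also have "\<dots> \<le> 2 * K * \<omega> * sqrt r0 * (1 / sqrt (s - t0))"
        using pos K tilt_pos r0 by (intro mult_left_mono) auto
      also have "\<dots> = 2 * K * \<omega> * sqrt (r0 / (s - t0))" by (simp add: real_sqrt_divide)
      also have "\<dots> \<le> 2 * K * \<omega> * (1 / B)"
        using far'[of s] that K tilt_pos by (intro mult_left_mono) auto
      finally show ?thesis by simp
    qed
    show ?thesis using *[of s t] *[of t s] s t
      by (cases s t rule: linorder_le_cases) (auto simp: norm_minus_commute)
  qed
  obtain t1 where t1: "t1 \<in> R" using R by blast
  have t1Q: "t1 \<in> Q" using far'[OF t1] by blast
  have rays: "norm (ray a t1 - ray b t1) \<le> \<kappa> * (4 * K * \<omega> / B)" if "a \<in> I" "b \<in> I" for a b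
  proof (rule unsplit_norm_diff_le[where R = "\<lambda>a b. \<exists>t\<in>R. x a t = x b t", OF finite_I _ _ _ that])
    show "0 \<le> 4 * K * \<omega> / B" using K B tilt_pos by simp
    show "\<exists>a\<in>J. \<exists>b\<in>I - J. \<exists>t\<in>R. x a t = x b t" if "J \<subset> I" "J \<noteq> {}" for J
    proof -
      have "\<not> separated J R" using ns that by blast
      then show ?thesis unfolding separated_def by blast
    qed
    fix a b assume ab: "a \<in> I" "b \<in> I" "\<exists>t\<in>R. x a t = x b t"
    then obtain t where t: "t \<in> R" "x a t = x b t" by blast
    have "norm ((ray a t1 - ray a t) + (ray b t - ray b t1)) \<le> 2 * K * \<omega> / B + 2 * K * \<omega> / B"
      using ab t t1 by (intro norm_triangle_mono drift) auto
    then show "norm (ray a t1 - ray b t1) \<le> 4 * K * \<omega> / B" using t by simp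
  qed
  have close: "norm (ray a t1 - vr a t1) \<le> K * \<omega> * (1 / B)" if a: "a \<in> I" for a
  proof -
    have "norm (ray a t1 - vr a t1) \<le> K * \<omega> * sqrt (r0 / (t1 - t0))"
      unfolding K_def using ray_close[OF a] far'[OF t1] by blast
    also have "\<dots> \<le> K * \<omega> * (1 / B)" using far'[OF t1] K tilt_pos by (intro mult_left_mono) auto
    finally show ?thesis .
  qed
  have sgns: "norm (sgn (vr a t1) - sgn (vr b t1)) \<le> 12 * \<kappa> * K * \<omega> / B" if ab: "a \<in> I" "b \<in> I" for a b
  proof -
    have "vr a t1 - vr b t1 = (vr a t1 - ray a t1) + ((ray a t1 - ray b t1) + (ray b t1 - vr b t1))"
      by simp
    also have "norm \<dots> \<le> K * \<omega> * (1 / B) + (\<kappa> * (4 * K * \<omega> / B) + K * \<omega> * (1 / B))"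
      using close[of a] close[of b] rays[OF ab] ab
      by (intro norm_triangle_mono) (auto simp: norm_minus_commute)
    also have "\<dots> = (4 * \<kappa> + 2) * (K * \<omega> / B)" by (simp add: algebra_simps)
    also have "\<dots> \<le> (6 * \<kappa>) * (K * \<omega> / B)"
      using \<kappa> K B tilt_pos by (intro mult_right_mono) auto
    finally have v: "norm (vr a t1 - vr b t1) \<le> 6 * \<kappa> * (K * \<omega> / B)" by simp
    have "norm (vr a t1) \<ge> 1"
      using vr(1)[OF ab(1) t1Q] norm_e Cauchy_Schwarz_ineq2[of "vr a t1" e] by simp
    then have "2 * norm (vr a t1 - vr b t1) / norm (vr a t1) \<le> 2 * norm (vr a t1 - vr b t1) / 1"
      by (intro divide_left_mono) auto
    then have "norm (sgn (vr a t1) - sgn (vr b t1)) \<le> 2 * norm (vr a t1 - vr b t1)"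
      using norm_sgn_diff_le[OF vr_nonzero[OF ab(1) t1Q], of "vr b t1"] by linarith
    also have "\<dots> \<le> 2 * (6 * \<kappa> * (K * \<omega> / B))" using v by (intro mult_left_mono) auto
    finally show ?thesis by simp
  qed
  have "\<omega> = tilt t1" using tilt_const t0 t1Q by blast
  also have "\<dots> \<le> \<kappa> * (12 * \<kappa> * K * \<omega> / B)"
    unfolding tilt_def[of t1] using finite_I vr_nonzero t1Q sgns K B tilt_pos
    by (intro deviation_le_of_norm_diff_le) (auto simp: norm_sgn)
  \<comment> \<open>The factors \<open>\<kappa>\<close> from chaining and from
    \<open>deviation_le_of_norm_diff_le\<close> cancel against the square in
    \<open>B\<close>.\<close>
  also have "\<dots> = 12 / 13 * \<omega>" using K \<kappa> by (simp add: B_def power2_eq_square)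
  finally show False using tilt_pos by simp
qed

end

text \<open>Stated for every finite set of events, since an infinite set of events has \<open>card\<close> zero.\<close>

definition event_bound :: "'a itself \<Rightarrow> 'v::real_inner itself \<Rightarrow> real \<Rightarrow> nat \<Rightarrow> nat \<Rightarrow> bool" where
  "event_bound _ _ L k N \<longleftrightarrow>
     (\<forall>(e::'v) (I::'a set) x vl vr Q F.
        strands e L I x vl vr Q \<and> card I \<le> k \<and> finite F \<and> F \<subseteq> Q \<and>
        (\<forall>t\<in>F. strands.event I x vl vr t) \<longrightarrow> card F \<le> N)"

text \<open>Enough windows of length \<open>r0 / c\<close>, with
  \<open>c = 9 * k ^ 3 * L\<^sup>2\<close>, to cover a time span of length
  \<open>2 * far_const k L * r0\<close>.\<close>

definition piece_count :: "nat \<Rightarrow> real \<Rightarrow> nat" where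
  "piece_count k L = nat \<lceil>2 * far_const k L * (9 * real k ^ 3 * L\<^sup>2)\<rceil> + 1"

section \<open>Counting events by splitting into groups\<close>

context strands
begin

text \<open>Particles that meet lie in the same group, so each event is one of \<open>J\<close> or
  of its complement, and both have at most \<open>k\<close> particles.\<close>

lemma split_count:
  assumes N: "event_bound TYPE('a) TYPE('v) L k N" and k: "card I \<le> Suc k"
    and J: "J \<subset> I" "J \<noteq> {}" "separated J R" and R: "is_interval R" "R \<subseteq> Q"
    and F: "finite F" "F \<subseteq> R" "\<forall>t\<in>F. event t"
  shows "card F \<le> 2 * N"
proof -
  have part: "card {t \<in> F. strands.event J' x vl vr t} \<le> N"
    if J': "J' \<subset> I" "separated J' R" for J'
  proof -
    have "strands e L J' x vl vr R" using J' R by (intro subsystem) auto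
    moreover have "card J' \<le> k" using psubset_card_mono[OF finite_I J'(1)] k by simp
    moreover have "finite {t \<in> F. strands.event J' x vl vr t}" "{t \<in> F. strands.event J' x vl vr t} \<subseteq> R"
      using F by auto
    ultimately show ?thesis using N unfolding event_bound_def by blast
  qed
  have C: "I - J \<subset> I" "separated (I - J) R" using J separated_compl[of J R] by blast+
  interpret J: strands e L J x vl vr R using J R by (intro subsystem) blast+
  interpret C: strands e L "I - J" x vl vr R using C R by (intro subsystem) blast+
  have "F \<subseteq> {t \<in> F. J.event t} \<union> {t \<in> F. C.event t}"
  proof
    fix t assume t: "t \<in> F"
    then obtain a b where ab: "a \<in> I" "b \<in> I" "x a t = x b t" "vl a t \<noteq> vr b t"
      using F unfolding event_def by blast
    have "a \<in> J \<longleftrightarrow> b \<in> J" using J(3) ab t F unfolding separated_def by (metis DiffI subsetD)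
    then show "t \<in> {t \<in> F. J.event t} \<union> {t \<in> F. C.event t}"
      using ab t unfolding J.event_def C.event_def by blast
  qed
  then have "card F \<le> card {t \<in> F. J.event t} + card {t \<in> F. C.event t}"
    using F(1) by (intro order_trans[OF card_mono card_Un_le]) auto
  moreover have "card {t \<in> F. J.event t} \<le> N" using part J by blast
  moreover have "card {t \<in> F. C.event t} \<le> N"
    using part[OF C] .
  ultimately show ?thesis by simp
qed

text \<open>\<open>far_separated\<close> is applied to the whole far part of \<open>Q\<close> rather
  than to \<open>F\<close>, because \<open>split_count\<close> works over an interval.\<close>

lemma far_count:
  assumes N: "event_bound TYPE('a) TYPE('v) L k N" and k: "card I \<le> Suc k"
    and cone: "strands_cone e L I x vl vr Q t0 z0 r0"
    and F: "finite F" "F \<subseteq> Q" "\<forall>t\<in>F. event t" "\<forall>t\<in>F. t0 + far_const (card I) L * r0 \<le> t"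
  shows "card F \<le> 2 * N"
proof (cases "F = {}")
  case False
  let ?R = "{t \<in> Q. t0 + far_const (card I) L * r0 \<le> t}"
  interpret strands_cone e L I x vl vr Q t0 z0 r0 by (rule cone)
  obtain J where J: "J \<subset> I" "J \<noteq> {}" "separated J ?R"
    using far_separated[of ?R] False F by blast
  have "is_interval ?R"
    unfolding is_interval_1 using Q_mem by (auto intro: order_trans)
  then show ?thesis using J F by (intro split_count[OF N k J]) auto
qed simp

text \<open>The reflected system satisfies the same cone condition: \<open>vl\<close> and
  \<open>vr\<close> have equal sums of unit tangents at \<open>t0\<close>, so the tilt is
  unchanged.\<close>

lemma far_left_count:
  assumes N: "event_bound TYPE('a) TYPE('v) L k N" and k: "card I \<le> Suc k"
    and cone: "strands_cone e L I x vl vr Q t0 z0 r0"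
    and F: "finite F" "F \<subseteq> Q" "\<forall>t\<in>F. event t" "\<forall>t\<in>F. t \<le> t0 - far_const (card I) L * r0"
  shows "card F \<le> 2 * N"
proof -
  interpret strands_cone e L I x vl vr Q t0 z0 r0 by (rule cone)
  interpret R: strands e L I "\<lambda>a t. - x a (- t)" "\<lambda>a t. vr a (- t)" "\<lambda>a t. vl a (- t)" "uminus ` Q"
    by (rule reflect)
  have tilt: "R.tilt (- t0) = tilt t0"
    unfolding R.tilt_def tilt_def using sum_sgn_vl[OF t0] by simp
  have "strands_cone e L I (\<lambda>a t. - x a (- t)) (\<lambda>a t. vr a (- t)) (\<lambda>a t. vl a (- t)) (uminus ` Q) (- t0) (- z0) r0"
  proof unfold_locales
    fix a assume "a \<in> I"
    then show "norm (- x a (- (- t0)) - - z0) \<le> R.tilt (- t0) * r0"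
      using cone[of a] tilt by (simp add: norm_minus_commute)
  qed (use t0 z0 r0 tilt_pos tilt in auto)
  \<comment> \<open>Reflection swaps incoming and outgoing velocities, which is undone by swapping
    \<open>a\<close> and \<open>b\<close>.\<close>
  moreover have "R.event (- t) \<longleftrightarrow> event t" for t
    unfolding R.event_def event_def by (simp) metis
  ultimately have "card (uminus ` F) \<le> 2 * N"
    using F by (intro R.far_count[OF N k]) (auto simp: algebra_simps)
  then show ?thesis by (simp add: card_image)
qed

text \<open>Particles that meet within a window of length \<open>d\<close> are close at
  \<open>t1\<close>. Without a splitting, chaining and summing over all pairs would bound
  \<open>spread t1\<close> by \<open>8 * card I ^ 3 * L\<^sup>2 * d * tilt t1\<close>, which is
  below the assumed \<open>tilt t1 * r0\<close>.\<close>

lemma near_separated: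
  assumes R: "R \<subseteq> Q" "t1 \<in> R" "\<And>s t. s \<in> R \<Longrightarrow> t \<in> R \<Longrightarrow> \<bar>s - t\<bar> \<le> d"
    and d: "9 * real (card I) ^ 3 * L\<^sup>2 * d \<le> r0" and r0: "0 < r0"
    and spread: "tilt t1 * r0 \<le> spread t1" and tilt: "tilt t1 > 0"
  shows "\<exists>J. J \<subset> I \<and> J \<noteq> {} \<and> separated J R"
proof (rule ccontr)
  assume ns: "\<not> ?thesis"
  let ?w = "tilt t1" and ?k = "real (card I)"
  have t1: "t1 \<in> Q" using R by blast
  have d0: "d \<ge> 0" using R(3)[OF R(2) R(2)] by simp
  have pairs: "norm (x a t1 - x b t1) \<le> ?k * (8 * L\<^sup>2 * ?w * d)" if ab: "a \<in> I" "b \<in> I" for a b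
  proof (rule unsplit_norm_diff_le[where R = "\<lambda>a b. \<exists>t\<in>R. x a t = x b t", OF finite_I _ _ _ that])
    show "0 \<le> 8 * L\<^sup>2 * ?w * d" using tilt d0 by simp
    show "\<exists>a\<in>J. \<exists>b\<in>I - J. \<exists>t\<in>R. x a t = x b t" if "J \<subset> I" "J \<noteq> {}" for J
    proof -
      have "\<not> separated J R" using ns that by blast
      then show ?thesis unfolding separated_def by blast
    qed
    fix a b assume ab: "a \<in> I" "b \<in> I" "\<exists>t\<in>R. x a t = x b t"
    then obtain t where t: "t \<in> R" "x a t = x b t" by blast
    \<comment> \<open>One reference velocity serves both particles, so that it cancels from their
      relative displacement.\<close>
    let ?u = "vr a t1"
    have disp: "norm (x c t - x c t1 - (t - t1) *\<^sub>R ?u) \<le> 4 * L\<^sup>2 * ?w * d" if c: "c \<in> I" for c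
    proof -
      have u: "norm (vr c \<tau> - ?u) \<le> 4 * L\<^sup>2 * ?w" if "\<tau> \<in> Q" for \<tau>
        using norm_vr_diff[OF c ab(1) that t1] .
      have *: "norm (x c t - x c s - (t - s) *\<^sub>R ?u) \<le> 4 * L\<^sup>2 * ?w * d"
        if "s \<in> R" "t \<in> R" "s \<le> t" for s t
      proof -
        have "norm (x c t - x c s - (t - s) *\<^sub>R ?u) \<le> 4 * L\<^sup>2 * ?w * (t - s)"
          using that R u c by (intro norm_displacement) auto
        also have "\<dots> \<le> 4 * L\<^sup>2 * ?w * d"
          using R(3)[OF that(2,1)] tilt by (intro mult_left_mono) auto
        finally show ?thesis .
      qed
      have "x c t1 - x c t - (t1 - t) *\<^sub>R ?u = - (x c t - x c t1 - (t - t1) *\<^sub>R ?u)"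
        by (simp add: algebra_simps)
      then have "norm (x c t1 - x c t - (t1 - t) *\<^sub>R ?u) = norm (x c t - x c t1 - (t - t1) *\<^sub>R ?u)"
        by (simp only: norm_minus_cancel)
      then show ?thesis using *[OF R(2) t(1)] *[OF t(1) R(2)] by linarith
    qed
    have "x a t1 - x b t1 = (x b t - x b t1 - (t - t1) *\<^sub>R ?u) - (x a t - x a t1 - (t - t1) *\<^sub>R ?u)"
      using t by simp
    also have "norm \<dots> \<le> 4 * L\<^sup>2 * ?w * d + 4 * L\<^sup>2 * ?w * d"
      using disp ab by (intro order_trans[OF norm_triangle_ineq4 add_mono]) auto
    finally show "norm (x a t1 - x b t1) \<le> 8 * L\<^sup>2 * ?w * d" by (simp add: mult_ac)
  qed
  have "spread t1 \<le> (\<Sum>a\<in>I. \<Sum>b\<in>I. ?k * (8 * L\<^sup>2 * ?w * d))"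
    unfolding spread_def by (intro sum_mono pairs)
  also have "\<dots> = (8 / 9) * (9 * ?k ^ 3 * L\<^sup>2 * d) * ?w" by (simp add: power3_eq_cube)
  also have "\<dots> \<le> (8 / 9) * r0 * ?w"
    using d tilt by (intro mult_right_mono mult_left_mono) auto
  also have "\<dots> < ?w * r0" using tilt r0 by simp
  finally show False using spread by simp
qed

text \<open>The events far from \<open>t0\<close> on the two sides account for \<open>4 * N\<close>,
  the windows around \<open>t0\<close> for the product. The \<open>+ 1\<close> is the event
  \<open>t0\<close> itself in the case that all particles collide there.\<close>

lemma events_count:
  assumes N: "event_bound TYPE('a) TYPE('v) L k N" and k: "card I = Suc k"
    and F: "finite F" "F \<subseteq> Q" "\<forall>t\<in>F. event t"
  shows "card F \<le> piece_count (Suc k) L * (2 * N) + 4 * N + 1"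
proof (cases "F = {}")
  case False
  define A where "A = far_const (Suc k) L"
  have A: "A \<ge> 0" by (simp add: A_def far_const_def)
  \<comment> \<open>The minimum is over \<open>F\<close> only. A window that contains an event
    \<open>t1\<close> then has \<open>spread t1\<close> at least \<open>spread t0\<close>, as
    \<open>near_separated\<close> demands.\<close>
  obtain t0 where t0: "t0 \<in> F" "\<And>t. t \<in> F \<Longrightarrow> spread t0 \<le> spread t"
    using arg_min_if_finite(1)[OF F(1) False] arg_min_least[OF F(1) False] by blast
  have t0Q: "t0 \<in> Q" using t0 F by blast
  let ?w = "tilt t0"
  have w: "?w > 0" using tilt_nonneg[of t0] no_event_if_tilt_zero[OF t0Q] t0 F by fastforce
  obtain a0 where a0: "a0 \<in> I" using k by fastforce
  have L: "L \<ge> 1" using L_ge_1[OF a0 t0Q] .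
  have near: "norm (x a t0 - x a0 t0) \<le> spread t0" if a: "a \<in> I" for a
  proof -
    have "norm (x a t0 - x a0 t0) \<le> (\<Sum>b\<in>I. norm (x a t0 - x b t0))"
      using finite_I a0 by (intro member_le_sum[where f = "\<lambda>b. norm (x a t0 - x b t0)"]) auto
    also have "\<dots> \<le> spread t0" unfolding spread_def using finite_I a
      by (intro member_le_sum[where f = "\<lambda>a. \<Sum>b\<in>I. norm (x a t0 - x b t0)"]) (auto intro: sum_nonneg)
    finally show ?thesis .
  qed
  have cone: "strands_cone e L I x vl vr Q t0 (x a0 t0) r0" if "r0 > 0" "spread t0 \<le> ?w * r0" for r0
    by unfold_locales (use that near w t0Q a0 position in \<open>auto intro: order_trans\<close>)
  have outer: "card F \<le> card {t \<in> F. \<bar>t - t0\<bar> < A * r0} + 4 * N" if "r0 > 0" "spread t0 \<le> ?w * r0" for r0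
  proof -
    let ?M = "{t \<in> F. \<bar>t - t0\<bar> < A * r0}" and ?R = "{t \<in> F. t0 + A * r0 \<le> t}" and ?L = "{t \<in> F. t \<le> t0 - A * r0}"
    have "F = ?M \<union> (?R \<union> ?L)" by auto
    then have "card F \<le> card ?M + (card ?R + card ?L)"
      by (metis (no_types, lifting) add_left_mono card_Un_le le_trans)
    moreover have "card ?R \<le> 2 * N"
      using F k by (intro far_count[OF N _ cone[OF that]]) (auto simp: A_def)
    moreover have "card ?L \<le> 2 * N"
      using F k by (intro far_left_count[OF N _ cone[OF that]]) (auto simp: A_def)
    ultimately show ?thesis by simp
  qed
  show ?thesis
  proof (cases "spread t0 = 0")
    case True
    \<comment> \<open>At a total collision every positive \<open>r0\<close> satisfies the cone
      condition, so it can be taken so small that the middle part contains no event other than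
      \<open>t0\<close>.\<close>
    obtain d where d: "d > 0" "\<And>t. t \<in> F \<Longrightarrow> t \<noteq> t0 \<Longrightarrow> d \<le> dist t0 t"
      using finite_set_avoid[OF F(1), of t0] by blast
    define r0 where "r0 = d / (A + 1)"
    have r0: "r0 > 0" "A * r0 < d" using d A by (auto simp: r0_def field_simps)
    have "{t \<in> F. \<bar>t - t0\<bar> < A * r0} \<subseteq> {t0}"
      using d(2) r0 by (force simp: dist_real_def)
    then have "card {t \<in> F. \<bar>t - t0\<bar> < A * r0} \<le> 1"
      using card_mono[of "{t0}"] by fastforce
    then show ?thesis using outer[OF r0(1)] True w r0 by simp
  next
    case False
    have "spread t0 \<ge> 0" unfolding spread_def by (intro sum_nonneg) auto
    \<comment> \<open>This value meets both the cone condition, an upper bound on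
      \<open>spread t0\<close>, and the lower bound on \<open>spread t1\<close> in
      \<open>near_separated\<close>.\<close>
    define r0 where "r0 = spread t0 / ?w"
    have r0: "r0 > 0" "?w * r0 = spread t0"
      using False \<open>spread t0 \<ge> 0\<close> w by (auto simp: r0_def)
    define c where "c = 9 * real (Suc k) ^ 3 * L\<^sup>2"
    have c: "c > 0" using L by (auto simp: c_def intro!: mult_pos_pos)
    define P where "P j = {t \<in> Q. t0 - A * r0 + real j * (r0 / c) \<le> t \<and> t \<le> t0 - A * r0 + (real j + 1) * (r0 / c)}" for j :: nat
    have piece: "card (F \<inter> P j) \<le> 2 * N" for j
    proof (cases "F \<inter> P j = {}")
      case False
      then obtain t1 where t1: "t1 \<in> F" "t1 \<in> P j" by blast
      have "\<exists>J. J \<subset> I \<and> J \<noteq> {} \<and> separated J (P j)"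
      proof (rule near_separated[OF _ t1(2), where d = "r0 / c" and ?r0.0 = r0])
        show "9 * real (card I) ^ 3 * L\<^sup>2 * (r0 / c) \<le> r0"
          unfolding k c_def[symmetric] using c by simp
        have "tilt t1 = ?w" using tilt_const t1 t0Q F by blast
        then show "tilt t1 * r0 \<le> spread t1" "tilt t1 > 0" using t0(2)[OF t1(1)] r0 w by auto
        show "\<bar>s - t\<bar> \<le> r0 / c" if "s \<in> P j" "t \<in> P j" for s t
          using that by (auto simp: P_def abs_le_iff algebra_simps)
      qed (use t1 r0 in \<open>auto simp: P_def\<close>)
      then obtain J where J: "J \<subset> I" "J \<noteq> {}" "separated J (P j)" by blast
      have "is_interval (P j)"
        unfolding is_interval_1 P_def using Q_mem by (auto intro: order_trans)
      then show ?thesis using F k J by (intro split_count[OF N _ J]) (auto simp: P_def)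
    qed simp
    have "{t \<in> F. \<bar>t - t0\<bar> < A * r0} \<subseteq> (\<Union>j<piece_count (Suc k) L. F \<inter> P j)"
    proof
      fix t assume t: "t \<in> {t \<in> F. \<bar>t - t0\<bar> < A * r0}"
      \<comment> \<open>The position of \<open>t\<close> measured from the left end in units of the
        window length.\<close>
      define q where "q = (t - t0 + A * r0) * c / r0"
      have "0 \<le> t - t0 + A * r0" "t - t0 + A * r0 \<le> 2 * A * r0" using t by (auto simp: abs_less_iff)
      then have "0 \<le> q" "q \<le> 2 * A * r0 * c / r0"
        unfolding q_def using r0 c
        by (intro divide_nonneg_pos mult_nonneg_nonneg divide_right_mono mult_right_mono; linarith)+
      then have q: "0 \<le> q" "q \<le> 2 * A * c" using r0 by auto
      have tq: "t = t0 - A * r0 + q * (r0 / c)" using r0 c by (simp add: q_def field_simps)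
      define j where "j = nat \<lfloor>q\<rfloor>"
      have j: "real j \<le> q" "q \<le> real j + 1" using q by (auto simp: j_def)
      have "int j \<le> \<lceil>2 * A * c\<rceil>" using q j by linarith
      then have "j < piece_count (Suc k) L"
        unfolding piece_count_def A_def[symmetric] c_def[symmetric] by linarith
      moreover have "real j * (r0 / c) \<le> q * (r0 / c)" "q * (r0 / c) \<le> (real j + 1) * (r0 / c)"
        using j r0 c by (intro mult_right_mono; simp)+
      then have "t \<in> P j" using t F tq unfolding P_def by auto
      ultimately show "t \<in> (\<Union>j<piece_count (Suc k) L. F \<inter> P j)" using t by blast
    qed
    then have "card {t \<in> F. \<bar>t - t0\<bar> < A * r0} \<le> card (\<Union>j<piece_count (Suc k) L. F \<inter> P j)"
      using F by (intro card_mono) auto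
    also have "\<dots> \<le> (\<Sum>j<piece_count (Suc k) L. card (F \<inter> P j))"
      by (intro card_UN_le) auto
    also have "\<dots> \<le> (\<Sum>j<piece_count (Suc k) L. 2 * N)" by (intro sum_mono piece)
    finally show ?thesis using outer[OF r0(1)] r0 by simp
  qed
qed simp

end

text \<open>\<open>event_bound\<close> quantifies over \<open>I\<close> and \<open>Q\<close>, so the
  induction hypothesis is available for every smaller group over every subinterval.\<close>

lemma event_bound_exists: "\<exists>N. event_bound TYPE('a) TYPE('v::real_inner) L k N"
proof (induction k)
  case 0
  have "card F = 0" if "strands e L I x vl vr Q" "card I \<le> 0" "\<forall>t\<in>F. strands.event I x vl vr t"
    for e :: 'v and I :: "'a set" and x vl vr Q and F :: "real set"
  proof -
    interpret strands e L I x vl vr Q by fact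
    have "I = {}" using that(2) finite_I by simp
    then have "\<not> event t" for t unfolding event_def by blast
    then have "F = {}" using that(3) by blast
    then show ?thesis by simp
  qed
  then have "event_bound TYPE('a) TYPE('v) L 0 0" unfolding event_bound_def by (metis le_refl)
  then show ?case ..
next
  case (Suc k)
  then obtain N where N: "event_bound TYPE('a) TYPE('v) L k N" by blast
  define M where "M = piece_count (Suc k) L * (2 * N) + 4 * N + 1"
  have "card F \<le> M"
    if "strands e L I x vl vr Q" "card I \<le> Suc k" "finite F" "F \<subseteq> Q" "\<forall>t\<in>F. strands.event I x vl vr t"
    for e :: 'v and I :: "'a set" and x vl vr Q F
  proof (cases "card I = Suc k")
    case True
    interpret strands e L I x vl vr Q by fact
    show ?thesis unfolding M_def using that True by (intro events_count[OF N]) auto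
  next
    case False
    then have "card I \<le> k" using that by simp
    then have "card F \<le> N" using N that unfolding event_bound_def by blast
    then show ?thesis by (simp add: M_def)
  qed
  then show ?case unfolding event_bound_def by blast
qed

section \<open>Straight lines between singular times\<close>

definition line_point :: "(real ^ 'n) \<times> (real ^ 'n) \<Rightarrow> real \<Rightarrow> real ^ 'n" where
  "line_point l t = fst l + t *\<^sub>R snd l"

text \<open>Shrinking to a ball that contains neither endpoint lets the full line take the place of
  the segment.\<close>

lemma reg_local_direction:
  assumes "y \<in> reg X"
  obtains d r where "d \<noteq> 0" "r > 0" "\<And>z. z \<in> ball y r \<Longrightarrow> z \<in> X \<longleftrightarrow> (\<exists>\<tau>. z = y + \<tau> *\<^sub>R d)"
proof -
  obtain U a b where U: "open U" "y \<in> U" "X \<inter> U = open_segment a b" and yX: "y \<in> X"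
    using assms unfolding reg_def by blast
  then have y: "y \<in> open_segment a b" by blast
  then obtain s where s: "a \<noteq> b" "0 < s" "s < 1" "y = (1 - s) *\<^sub>R a + s *\<^sub>R b"
    unfolding in_segment by blast
  obtain r1 where r1: "r1 > 0" "ball y r1 \<subseteq> U" using U openE by blast
  define r where "r = min r1 (min (dist y a) (dist y b))"
  have "y \<noteq> a" "y \<noteq> b" using y by (auto simp: open_segment_def)
  then have r: "r > 0" using r1 by (simp add: r_def)
  have ya: "dist y a = s * norm (b - a)"
  proof -
    have "y - a = s *\<^sub>R (b - a)" using s by (simp add: algebra_simps)
    then show ?thesis using s by (simp add: dist_norm)
  qed
  have yb: "dist y b = (1 - s) * norm (b - a)"
  proof -
    have "y - b = (1 - s) *\<^sub>R (a - b)" using s by (simp add: algebra_simps)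
    then show ?thesis using s by (simp add: dist_norm norm_minus_commute)
  qed
  show thesis
  proof (rule that[of "b - a" r])
    fix z assume z: "z \<in> ball y r"
    then have zU: "z \<in> U" using r1 by (auto simp: r_def)
    show "z \<in> X \<longleftrightarrow> (\<exists>\<tau>. z = y + \<tau> *\<^sub>R (b - a))"
    proof
      assume "z \<in> X"
      then have "z \<in> open_segment a b" using zU U by blast
      then obtain u where "z = (1 - u) *\<^sub>R a + u *\<^sub>R b" unfolding in_segment by blast
      then have "z = y + (u - s) *\<^sub>R (b - a)" unfolding s(4) by (simp add: algebra_simps)
      then show "\<exists>\<tau>. z = y + \<tau> *\<^sub>R (b - a)" by blast
    next
      assume "\<exists>\<tau>. z = y + \<tau> *\<^sub>R (b - a)"
      then obtain \<tau> where \<tau>: "z = y + \<tau> *\<^sub>R (b - a)" by blast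
      have "\<bar>\<tau>\<bar> * norm (b - a) < r" using z unfolding \<tau> by (simp add: dist_norm)
      then have "\<bar>\<tau>\<bar> * norm (b - a) < s * norm (b - a)" "\<bar>\<tau>\<bar> * norm (b - a) < (1 - s) * norm (b - a)"
        using ya yb by (auto simp: r_def)
      then have "0 < s + \<tau>" "s + \<tau> < 1" using mult_less_cancel_right_disj[of _ "norm (b - a)"] by auto
      moreover have "z = (1 - (s + \<tau>)) *\<^sub>R a + (s + \<tau>) *\<^sub>R b" unfolding \<tau> s(4) by (simp add: algebra_simps)
      ultimately have "z \<in> open_segment a b" unfolding in_segment using s by blast
      then show "z \<in> X" using U by blast
    qed
  qed (use s r in auto)
qed

text \<open>A ball cuts the open diameter out of a line through its centre; this is the segment that
  \<open>reg\<close> asks for.\<close>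

lemma reg_if_locally_line:
  assumes d: "d \<noteq> 0" and ev: "\<forall>\<^sub>F z in nhds y. z \<in> X \<longleftrightarrow> (\<exists>\<tau>. z = y + \<tau> *\<^sub>R d)"
  shows "y \<in> reg X"
proof -
  obtain r where r: "r > 0" "\<And>z. z \<in> ball y r \<Longrightarrow> z \<in> X \<longleftrightarrow> (\<exists>\<tau>. z = y + \<tau> *\<^sub>R d)"
    using ev unfolding eventually_nhds_metric by (auto simp: dist_commute)
  define \<rho> where "\<rho> = r / norm d"
  have \<rho>: "\<rho> > 0" "\<rho> * norm d = r" using r d by (auto simp: \<rho>_def)
  have ne: "y - \<rho> *\<^sub>R d \<noteq> y + \<rho> *\<^sub>R d"
  proof
    assume "y - \<rho> *\<^sub>R d = y + \<rho> *\<^sub>R d"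
    then have "(2 * \<rho>) *\<^sub>R d = 0" by (simp add: algebra_simps flip: scaleR_2)
    then show False using \<rho> d by simp
  qed
  have "X \<inter> ball y r = open_segment (y - \<rho> *\<^sub>R d) (y + \<rho> *\<^sub>R d)"
  proof (intro set_eqI iffI)
    fix z assume z: "z \<in> X \<inter> ball y r"
    then obtain \<tau> where \<tau>: "z = y + \<tau> *\<^sub>R d" using r by blast
    have "\<bar>\<tau>\<bar> * norm d < \<rho> * norm d" using z \<rho> unfolding \<tau> by (simp add: dist_norm)
    then have "\<bar>\<tau>\<bar> < \<rho>" using mult_less_cancel_right_disj[of _ "norm d"] by auto
    then have u: "0 < (\<tau> / \<rho> + 1) / 2" "(\<tau> / \<rho> + 1) / 2 < 1"
      using \<rho> by (auto simp: field_simps abs_less_iff)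
    have "z = (1 - (\<tau> / \<rho> + 1) / 2) *\<^sub>R (y - \<rho> *\<^sub>R d) + ((\<tau> / \<rho> + 1) / 2) *\<^sub>R (y + \<rho> *\<^sub>R d)"
    proof -
      have "(1 - u) *\<^sub>R (y - \<rho> *\<^sub>R d) + u *\<^sub>R (y + \<rho> *\<^sub>R d) = y + ((2 * u - 1) * \<rho>) *\<^sub>R d" for u
        by (simp add: algebra_simps flip: scaleR_2)
      moreover have "(2 * ((\<tau> / \<rho> + 1) / 2) - 1) * \<rho> = \<tau>" using \<rho> by (simp add: field_simps)
      ultimately show ?thesis using \<tau> by simp
    qed
    then show "z \<in> open_segment (y - \<rho> *\<^sub>R d) (y + \<rho> *\<^sub>R d)"
      unfolding in_segment using u ne by blast
  next
    fix z assume "z \<in> open_segment (y - \<rho> *\<^sub>R d) (y + \<rho> *\<^sub>R d)"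
    then obtain u where u: "0 < u" "u < 1" "z = (1 - u) *\<^sub>R (y - \<rho> *\<^sub>R d) + u *\<^sub>R (y + \<rho> *\<^sub>R d)"
      unfolding in_segment by blast
    have z: "z = y + ((2 * u - 1) * \<rho>) *\<^sub>R d"
      unfolding u(3) by (simp add: algebra_simps flip: scaleR_2)
    have "\<bar>(2 * u - 1) * \<rho>\<bar> * norm d < 1 * \<rho> * norm d"
      using u \<rho> d by (intro mult_strict_right_mono) (auto simp: abs_mult)
    then have "z \<in> ball y r" unfolding z using \<rho> by (simp add: dist_norm)
    then show "z \<in> X \<inter> ball y r" using r(2)[of z] z by blast
  qed
  moreover have "y \<in> X" using r by (metis add.right_neutral centre_in_ball scaleR_zero_left)
  ultimately show ?thesis unfolding reg_def using r by (auto intro!: exI[of _ "ball y r"])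
qed

section \<open>The network over a time interval without singular points\<close>

locale flat_cover =
  fixes i :: "'n::finite" and X :: "(real ^ 'n) set" and m :: "real ^ 'n \<Rightarrow> real" and k :: nat and \<theta> :: real
  assumes isgn: "isgn X m" and cover: "k_cover i k X m" and flat: "theta_flat i \<theta> X"
    and finite_sing: "finite (sing X)" and \<theta>: "0 \<le> \<theta>" "\<theta> < pi / 2"
begin

definition gap :: "real \<Rightarrow> real \<Rightarrow> bool" where
  "gap c d \<longleftrightarrow> c < d \<and> (\<forall>z\<in>sing X. \<not> (c < z $ i \<and> z $ i < d))"

text \<open>A line is recorded by its point at first coordinate zero and its slope with first
  coordinate one. Equal lines are then equal pairs, and the parameter of \<open>line_point\<close>
  is the first coordinate.\<close>

definition lines :: "real \<Rightarrow> real \<Rightarrow> ((real ^ 'n) \<times> (real ^ 'n)) set" where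
  "lines c d = {l. fst l $ i = 0 \<and> snd l $ i = 1 \<and> (\<forall>t\<in>{c<..<d}. line_point l t \<in> X)}"

text \<open>The multiplicity is constant along the line, so the midpoint is only a sample; by
  integrality the rounding loses nothing.\<close>

definition line_mult :: "real \<Rightarrow> real \<Rightarrow> (real ^ 'n) \<times> (real ^ 'n) \<Rightarrow> nat" where
  "line_mult c d l = nat \<lfloor>m (line_point l ((c + d) / 2))\<rfloor>"

lemma closed_X: "closed X"
  using isgn unfolding isgn_def geodesic_network_def by blast

lemma reg_subset: "reg X \<subseteq> X" unfolding reg_def by blast

lemma reg_if_not_sing: "y \<in> X \<Longrightarrow> y \<notin> sing X \<Longrightarrow> y \<in> reg X"
  unfolding sing_def by blast

lemma reg_in_gap: "gap c d \<Longrightarrow> y \<in> X \<Longrightarrow> c < y $ i \<Longrightarrow> y $ i < d \<Longrightarrow> y \<in> reg X"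
  using reg_if_not_sing unfolding gap_def by blast

lemma finite_slice: "finite (slice i X t)"
  using cover unfolding k_cover_def by blast

text \<open>A vertical piece would put infinitely many points into one slice.\<close>

lemma not_vertical:
  assumes "\<forall>\<^sub>F t in at_right 0. y + t *\<^sub>R d \<in> X" "d \<noteq> 0"
  shows "d $ i \<noteq> 0"
proof
  assume d: "d $ i = 0"
  obtain r where r: "r > 0" "\<And>t. 0 < t \<Longrightarrow> t < r \<Longrightarrow> y + t *\<^sub>R d \<in> X"
    using assms(1) unfolding eventually_at_right_field by blast
  have "(\<lambda>t. y + t *\<^sub>R d) ` {0<..<r} \<subseteq> slice i X (y $ i)"
    using r d unfolding slice_def by auto
  moreover have "inj_on (\<lambda>t. y + t *\<^sub>R d) {0<..<r}"
    using assms(2) by (auto simp: inj_on_def)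
  ultimately have "finite {0<..<r}"
    using finite_slice finite_subset finite_imageD by blast
  then show False using r(1) infinite_Ioo by blast
qed

text \<open>The local direction is not vertical, so it can be scaled to first coordinate
  one.\<close>

lemma reg_local_line:
  assumes "y \<in> reg X"
  obtains v r where "v $ i = 1" "r > 0"
    "\<And>z. z \<in> ball y r \<Longrightarrow> z \<in> X \<longleftrightarrow> z = y + (z $ i - y $ i) *\<^sub>R v"
proof -
  obtain d r where d: "d \<noteq> 0" "r > 0" "\<And>z. z \<in> ball y r \<Longrightarrow> z \<in> X \<longleftrightarrow> (\<exists>\<tau>. z = y + \<tau> *\<^sub>R d)"
    using reg_local_direction[OF assms] by blast
  have "\<forall>\<^sub>F t in at_right 0. y + t *\<^sub>R d \<in> X"
    unfolding eventually_at_right_field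
  proof (intro exI[of _ "r / norm d"] conjI allI impI)
    fix t assume t: "0 < t" "t < r / norm d"
    then have "y + t *\<^sub>R d \<in> ball y r" using d by (simp add: dist_norm field_simps)
    then show "y + t *\<^sub>R d \<in> X" using d(3) by blast
  qed (use d in auto)
  then have di: "d $ i \<noteq> 0" using not_vertical d by blast
  show thesis
  proof (rule that[of "d /\<^sub>R (d $ i)" r])
    fix z assume z: "z \<in> ball y r"
    show "z \<in> X \<longleftrightarrow> z = y + (z $ i - y $ i) *\<^sub>R (d /\<^sub>R (d $ i))"
    proof
      assume "z \<in> X"
      then obtain \<tau> where \<tau>: "z = y + \<tau> *\<^sub>R d" using d z by blast
      then have "z $ i - y $ i = \<tau> * d $ i" by simp
      then show "z = y + (z $ i - y $ i) *\<^sub>R (d /\<^sub>R (d $ i))" using \<tau> di by simp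
    next
      assume "z = y + (z $ i - y $ i) *\<^sub>R (d /\<^sub>R (d $ i))"
      then have "z = y + ((z $ i - y $ i) / d $ i) *\<^sub>R d" by (simp add: divide_inverse)
      then show "z \<in> X" using d z by blast
    qed
  qed (use d di in auto)
qed

text \<open>One common point near \<open>y\<close> other than \<open>y\<close> determines the slope.
  The sign of \<open>\<sigma>\<close> decides whether the piece leaves \<open>y\<close> forwards or
  backwards in time.\<close>

lemma local_line_direction:
  assumes v: "v $ i = 1" "r > 0" "\<forall>z\<in>ball y r. z \<in> X \<longleftrightarrow> z = y + (z $ i - y $ i) *\<^sub>R v"
    and w: "w $ i = 1" "\<forall>\<^sub>F \<tau> in at_right 0. y + (\<sigma> * \<tau>) *\<^sub>R w \<in> X" "\<sigma> \<noteq> 0"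
  shows "w = v"
proof -
  have "((\<lambda>\<tau>. y + (\<sigma> * \<tau>) *\<^sub>R w) \<longlongrightarrow> y + (\<sigma> * 0) *\<^sub>R w) (at_right 0)"
    by (intro tendsto_intros)
  then have "\<forall>\<^sub>F \<tau> in at_right 0. y + (\<sigma> * \<tau>) *\<^sub>R w \<in> ball y r"
    using v(2) by (intro topological_tendstoD) auto
  then have "\<forall>\<^sub>F \<tau> in at_right 0. 0 < \<tau> \<and> y + (\<sigma> * \<tau>) *\<^sub>R w \<in> ball y r \<and> y + (\<sigma> * \<tau>) *\<^sub>R w \<in> X"
    using w(2) by (intro eventually_conj eventually_at_right_less)
  then obtain \<tau> where \<tau>: "0 < \<tau>" "y + (\<sigma> * \<tau>) *\<^sub>R w \<in> ball y r" "y + (\<sigma> * \<tau>) *\<^sub>R w \<in> X"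
    using eventually_happens'[of "at_right (0::real)"] by auto
  then have "y + (\<sigma> * \<tau>) *\<^sub>R w = y + (\<sigma> * \<tau>) *\<^sub>R v" using bspec[OF v(3) \<tau>(2)] \<tau>(3) v(1) w(1) by simp
  then show ?thesis using \<tau> w(3) by simp
qed

text \<open>Continuation by connectedness of the gap: along the line through \<open>y\<close>, lying
  in \<open>X\<close> around a time is an open and closed condition, because every point of
  \<open>X\<close> over the gap is regular.\<close>

lemma line_in_gap:
  assumes g: "gap c d" and y: "y \<in> X" "c < y $ i" "y $ i < d"
  obtains v where "v $ i = 1" "\<And>t. c < t \<Longrightarrow> t < d \<Longrightarrow> y + (t - y $ i) *\<^sub>R v \<in> X"
proof -
  obtain v r where v: "v $ i = 1" "r > 0" "\<And>z. z \<in> ball y r \<Longrightarrow> z \<in> X \<longleftrightarrow> z = y + (z $ i - y $ i) *\<^sub>R v"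
    using reg_local_line[OF reg_in_gap[OF g y]] by blast
  let ?q = "\<lambda>t. y + (t - y $ i) *\<^sub>R v"
  \<comment> \<open>A whole neighbourhood is required, since the line could also hit
    \<open>X\<close> at an isolated time by crossing another edge.\<close>
  define G where "G t \<longleftrightarrow> (\<forall>\<^sub>F \<tau> in nhds t. ?q \<tau> \<in> X)" for t
  have lim: "(?q \<longlongrightarrow> ?q t) (nhds t)" for t
    by (intro tendsto_intros filterlim_ident)
  have GX: "?q t \<in> X" if "G t" for t
    using that eventually_nhds_x_imp_x unfolding G_def by blast
  have step: "\<forall>\<^sub>F \<tau> in nhds t. G t \<longleftrightarrow> G \<tau>" if t: "t \<in> {c<..<d}" for t
  proof (cases "G t")
    case True
    then have "\<forall>\<^sub>F \<tau> in nhds t. G \<tau>" unfolding G_def eventually_eventually .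
    then show ?thesis by eventually_elim (use True in blast)
  next
    case False
    have "\<forall>\<^sub>F \<tau> in nhds t. \<not> G \<tau>"
    proof (cases "?q t \<in> X")
      case True
      then have "?q t \<in> reg X" using t v by (intro reg_in_gap[OF g]) auto
      then obtain w s where w: "w $ i = 1" "s > 0"
        "\<And>z. z \<in> ball (?q t) s \<Longrightarrow> z \<in> X \<longleftrightarrow> z = ?q t + (z $ i - ?q t $ i) *\<^sub>R w"
        using reg_local_line by blast
      have ball: "\<forall>\<^sub>F \<tau> in nhds t. ?q \<tau> \<in> ball (?q t) s"
        using lim[of t] w(2) by (intro topological_tendstoD) auto
      have eq: "?q \<tau> \<in> X \<longleftrightarrow> (\<tau> - t) *\<^sub>R v = (\<tau> - t) *\<^sub>R w" if "?q \<tau> \<in> ball (?q t) s" for \<tau>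
      proof -
        have "?q \<tau> \<in> X \<longleftrightarrow> ?q \<tau> = ?q t + (\<tau> - t) *\<^sub>R w" using w(3)[OF that] v(1) by simp
        also have "\<dots> \<longleftrightarrow> (\<tau> - t) *\<^sub>R v = (\<tau> - t) *\<^sub>R w" by (auto simp: algebra_simps)
        finally show ?thesis .
      qed
      \<comment> \<open>With equal slopes the line would stay in \<open>X\<close> near
        \<open>t\<close>; as they differ, it leaves \<open>X\<close> at once on both sides.\<close>
      have vw: "v \<noteq> w"
      proof
        assume "v = w"
        from ball have "G t" unfolding G_def by eventually_elim (use eq \<open>v = w\<close> in metis)
        then show False using False by blast
      qed
      show ?thesis using ball
      proof eventually_elim
        case (elim \<tau>)
        show ?case
        proof (cases "\<tau> = t")
          case True
          then show ?thesis using \<open>\<not> G t\<close> by blast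
        next
          case False
          then have "?q \<tau> \<notin> X" using eq[OF elim] vw by simp
          then show ?thesis using GX by blast
        qed
      qed
    next
      case False
      then have "\<forall>\<^sub>F \<tau> in nhds t. ?q \<tau> \<in> - X"
        using lim[of t] closed_X by (intro topological_tendstoD) auto
      then show ?thesis by eventually_elim (use GX in blast)
    qed
    then show ?thesis by eventually_elim (use False in blast)
  qed
  have G0: "G (y $ i)"
  proof -
    have "\<forall>\<^sub>F \<tau> in nhds (y $ i). ?q \<tau> \<in> ball y r"
      using lim[of "y $ i"] v(2) by (intro topological_tendstoD) auto
    then show ?thesis unfolding G_def by eventually_elim (use v(1,3) in simp)
  qed
  have *: "G s \<longleftrightarrow> G t" if "s \<in> {c<..<d}" "t \<in> {c<..<d}" "s \<le> t" for s t
  proof (rule interval_local_induct[where P = "\<lambda>s t. G s \<longleftrightarrow> G t", OF _ that])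
    fix t assume t: "t \<in> {c<..<d}"
    show "\<forall>\<^sub>F \<tau> in at_right t. \<tau> \<in> {c<..<d} \<longrightarrow> (G t \<longleftrightarrow> G \<tau>)"
      using step[OF t] unfolding eventually_at_filter by eventually_elim simp
    show "\<forall>\<^sub>F \<tau> in at_left t. \<tau> \<in> {c<..<d} \<longrightarrow> (G \<tau> \<longleftrightarrow> G t)"
      using step[OF t] unfolding eventually_at_filter by eventually_elim simp
  qed auto
  show thesis
  proof (rule that[OF v(1)])
    fix t assume "c < t" "t < d"
    then have "G t" using *[of t "y $ i"] *[of "y $ i" t] G0 y
      by (cases "t \<le> y $ i") auto
    then show "?q t \<in> X" by (rule GX)
  qed
qed

lemma line_point_coord: "l \<in> lines c d \<Longrightarrow> line_point l t $ i = t"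
  by (simp add: lines_def line_point_def)

lemma line_point_reg: "gap c d \<Longrightarrow> l \<in> lines c d \<Longrightarrow> c < t \<Longrightarrow> t < d \<Longrightarrow> line_point l t \<in> reg X"
  using line_point_coord[of l c d t] by (intro reg_in_gap) (auto simp: lines_def)

lemma line_point_shift: "line_point l s = line_point l t + (s - t) *\<^sub>R snd l"
  by (simp add: line_point_def algebra_simps)

lemma line_unique:
  assumes "l \<in> lines c d" "l' \<in> lines c' d'" "line_point l t = line_point l' t" "snd l = snd l'"
  shows "l = l'"
  using assms by (auto simp: line_point_def prod_eq_iff)

text \<open>The last conclusion records that \<open>X\<close> has only one slope at
  \<open>y\<close>; it gives uniqueness in \<open>lines_inj\<close> and identifies the line in
  \<open>extend_to_gap\<close>.\<close>

lemma line_through: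
  assumes g: "gap c d" and y: "y \<in> X" "c < y $ i" "y $ i < d"
  obtains l where "l \<in> lines c d" "line_point l (y $ i) = y"
    "\<forall>w \<sigma>. w $ i = 1 \<longrightarrow> \<sigma> \<noteq> 0 \<longrightarrow> (\<forall>\<^sub>F \<tau> in at_right 0. y + (\<sigma> * \<tau>) *\<^sub>R w \<in> X) \<longrightarrow> w = snd l"
proof -
  obtain v where v: "v $ i = 1" "\<And>t. c < t \<Longrightarrow> t < d \<Longrightarrow> y + (t - y $ i) *\<^sub>R v \<in> X"
    using line_in_gap[OF assms] by blast
  obtain v' r where v': "v' $ i = 1" "r > 0" "\<And>z. z \<in> ball y r \<Longrightarrow> z \<in> X \<longleftrightarrow> z = y + (z $ i - y $ i) *\<^sub>R v'"
    using reg_local_line[OF reg_in_gap[OF g y]] by blast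
  have "\<forall>\<^sub>F \<tau> in at_right 0. y + (1 * \<tau>) *\<^sub>R v \<in> X"
    unfolding eventually_at_right_field
  proof (intro exI[of _ "d - y $ i"] conjI allI impI)
    fix \<tau> assume "0 < \<tau>" "\<tau> < d - y $ i"
    then show "y + (1 * \<tau>) *\<^sub>R v \<in> X" using v(2)[of "y $ i + \<tau>"] y by simp
  qed (use y in simp)
  moreover have v'': "\<forall>z\<in>ball y r. z \<in> X \<longleftrightarrow> z = y + (z $ i - y $ i) *\<^sub>R v'" using v'(3) by blast
  ultimately have eq: "v = v'" using local_line_direction[OF v'(1,2) v'' v(1), of 1] by simp
  show thesis
  proof (rule that[of "(y - (y $ i) *\<^sub>R v, v)"])
    have "line_point (y - (y $ i) *\<^sub>R v, v) t = y + (t - y $ i) *\<^sub>R v" for t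
      by (simp add: line_point_def algebra_simps)
    then show "(y - (y $ i) *\<^sub>R v, v) \<in> lines c d" using v by (simp add: lines_def)
    show "\<forall>w \<sigma>. w $ i = 1 \<longrightarrow> \<sigma> \<noteq> 0 \<longrightarrow> (\<forall>\<^sub>F \<tau> in at_right 0. y + (\<sigma> * \<tau>) *\<^sub>R w \<in> X) \<longrightarrow>
        w = snd (y - (y $ i) *\<^sub>R v, v)"
      using local_line_direction[OF v'(1,2) v''] eq by simp
  qed (simp add: line_point_def)
qed

lemma lines_inj:
  assumes g: "gap c d" and l: "l \<in> lines c d" and l': "l' \<in> lines c d" and t: "c < t" "t < d"
    and eq: "line_point l t = line_point l' t"
  shows "l = l'"
proof -
  let ?y = "line_point l t"
  have y: "?y \<in> X" "c < ?y $ i" "?y $ i < d"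
    using t line_point_coord[OF l] l by (simp_all add: lines_def)
  obtain l0 where "l0 \<in> lines c d" and l0: "\<forall>w \<sigma>. w $ i = 1 \<longrightarrow> \<sigma> \<noteq> 0 \<longrightarrow>
      (\<forall>\<^sub>F \<tau> in at_right 0. ?y + (\<sigma> * \<tau>) *\<^sub>R w \<in> X) \<longrightarrow> w = snd l0"
    by (rule line_through[OF g y]) (rule that)
  have *: "snd l1 = snd l0" if "l1 \<in> lines c d" "line_point l1 t = ?y" for l1
  proof (rule l0[rule_format, of _ 1])
    show "\<forall>\<^sub>F \<tau> in at_right 0. ?y + (1 * \<tau>) *\<^sub>R snd l1 \<in> X"
      unfolding eventually_at_right_field
    proof (intro exI[of _ "d - t"] conjI allI impI)
      fix \<tau> assume "0 < \<tau>" "\<tau> < d - t"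
      then have "line_point l1 (t + \<tau>) \<in> X" using that(1) t by (simp add: lines_def)
      then show "?y + (1 * \<tau>) *\<^sub>R snd l1 \<in> X"
        using line_point_shift[of l1 "t + \<tau>" t] that(2) by simp
    qed (use t in simp)
  qed (use that in \<open>auto simp: lines_def\<close>)
  show ?thesis using *[OF l] *[OF l'] eq l l' by (intro line_unique[of l c d l' c d t]) auto
qed

lemma lines_bij_slice:
  assumes g: "gap c d" and t: "c < t" "t < d"
  shows "bij_betw (\<lambda>l. line_point l t) (lines c d) (slice i X t)"
  unfolding bij_betw_def
proof
  show "inj_on (\<lambda>l. line_point l t) (lines c d)"
    by (rule inj_onI) (rule lines_inj[OF g _ _ t])
  show "(\<lambda>l. line_point l t) ` lines c d = slice i X t"
  proof (intro set_eqI iffI)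
    fix y assume "y \<in> (\<lambda>l. line_point l t) ` lines c d"
    then obtain l where l: "l \<in> lines c d" "y = line_point l t" by blast
    have "y \<in> X" using l t by (simp add: lines_def)
    then show "y \<in> slice i X t" using line_point_coord[OF l(1), of t] l(2) by (simp add: slice_def)
  next
    fix y assume "y \<in> slice i X t"
    then have y: "y \<in> X" "y $ i = t" by (auto simp: slice_def)
    then have "c < y $ i" "y $ i < d" using t by simp_all
    then obtain l where "l \<in> lines c d" "line_point l (y $ i) = y"
      by (rule line_through[OF g y(1)]) (rule that)
    then show "y \<in> (\<lambda>l. line_point l t) ` lines c d" using y by auto
  qed
qed

lemma finite_lines: "gap c d \<Longrightarrow> finite (lines c d)"
  using lines_bij_slice[of c d "(c + d) / 2"] finite_slice bij_betw_finite
  by (auto simp: gap_def)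

lemma m_integral:
  assumes "y \<in> reg X" obtains j :: nat where "j > 0" "m y = real j"
  using isgn assms unfolding isgn_def integral_multiplicity_def by blast

lemma m_locally_constant:
  assumes "y \<in> reg X" shows "\<forall>\<^sub>F z in nhds y. z \<in> reg X \<longrightarrow> m z = m y"
  using isgn assms unfolding isgn_def multiplicity_on_def eventually_nhds by blast

lemma tendsto_line_point: "(line_point l \<longlongrightarrow> line_point l t) (nhds t)"
  unfolding line_point_def by (intro tendsto_intros filterlim_ident)

lemma m_const_on_line:
  assumes g: "gap c d" and l: "l \<in> lines c d" and st: "s \<in> {c<..<d}" "t \<in> {c<..<d}"
  shows "m (line_point l s) = m (line_point l t)"
proof -
  have step: "\<forall>\<^sub>F \<tau> in nhds t. \<tau> \<in> {c<..<d} \<longrightarrow> m (line_point l \<tau>) = m (line_point l t)" if t: "t \<in> {c<..<d}" for t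
  proof -
    have "\<forall>\<^sub>F z in nhds (line_point l t). z \<in> reg X \<longrightarrow> m z = m (line_point l t)"
      using line_point_reg[OF g l] t by (intro m_locally_constant) auto
    then have "\<forall>\<^sub>F \<tau> in nhds t. line_point l \<tau> \<in> reg X \<longrightarrow> m (line_point l \<tau>) = m (line_point l t)"
      using tendsto_line_point by (rule eventually_compose_filterlim)
    then show ?thesis by eventually_elim (use line_point_reg[OF g l] in auto)
  qed
  have *: "m (line_point l s) = m (line_point l t)" if "s \<in> {c<..<d}" "t \<in> {c<..<d}" "s \<le> t" for s t
  proof (rule interval_local_induct[where P = "\<lambda>s t. m (line_point l s) = m (line_point l t)", OF _ that])
    fix t assume t: "t \<in> {c<..<d}"
    show "\<forall>\<^sub>F \<tau> in at_right t. \<tau> \<in> {c<..<d} \<longrightarrow> m (line_point l t) = m (line_point l \<tau>)"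
      using step[OF t] unfolding eventually_at_filter by eventually_elim simp
    show "\<forall>\<^sub>F \<tau> in at_left t. \<tau> \<in> {c<..<d} \<longrightarrow> m (line_point l \<tau>) = m (line_point l t)"
      using step[OF t] unfolding eventually_at_filter by eventually_elim simp
  qed auto
  show ?thesis
  proof (cases "s \<le> t")
    case True
    then show ?thesis using st by (intro *)
  next
    case False
    then show ?thesis using st by (intro *[symmetric]) auto
  qed
qed

lemma line_mult:
  assumes g: "gap c d" and l: "l \<in> lines c d"
  shows "line_mult c d l > 0" "\<And>t. c < t \<Longrightarrow> t < d \<Longrightarrow> m (line_point l t) = line_mult c d l"
proof -
  have mid: "(c + d) / 2 \<in> {c<..<d}" using g by (auto simp: gap_def)
  then have "line_point l ((c + d) / 2) \<in> reg X" using line_point_reg[OF g l, of "(c + d) / 2"] by simp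
  then obtain j :: nat where j: "j > 0" "m (line_point l ((c + d) / 2)) = real j"
    by (rule m_integral) (rule that)
  then show "line_mult c d l > 0" by (simp add: line_mult_def)
  show "m (line_point l t) = line_mult c d l" if "c < t" "t < d" for t
    using m_const_on_line[OF g l, of t "(c + d) / 2"] mid that j by (simp add: line_mult_def)
qed

text \<open>The slice at the midpoint has one regular point on each line, where the extended
  multiplicity is just \<open>m\<close>.\<close>

lemma sum_line_mult:
  assumes g: "gap c d"
  shows "(\<Sum>l\<in>lines c d. line_mult c d l) = k"
proof -
  define t where "t = (c + d) / 2"
  have t: "c < t" "t < d" using g by (auto simp: gap_def t_def)
  have "real k = (\<Sum>y\<in>slice i X t. extended_mult X m y)"
    using cover unfolding k_cover_def by simp
  also have "\<dots> = (\<Sum>l\<in>lines c d. extended_mult X m (line_point l t))"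
    by (rule sum.reindex_bij_betw[OF lines_bij_slice[OF g t], symmetric])
  also have "\<dots> = (\<Sum>l\<in>lines c d. real (line_mult c d l))"
    using line_point_reg[OF g _ t] line_mult(2)[OF g _ t] by (intro sum.cong) (auto simp: extended_mult_def)
  finally show ?thesis by (simp flip: of_nat_sum)
qed

text \<open>The line over the gap is connected and so lies in one edge, to which flatness applies.
  The cosine of its angle is \<open>1 / norm (snd l)\<close> because the slope has first coordinate
  one.\<close>

lemma norm_slope_le:
  assumes g: "gap c d" and l: "l \<in> lines c d"
  shows "norm (snd l) \<le> 1 / cos \<theta>"
proof -
  define s t where "s = (2 * c + d) / 3" and "t = (c + 2 * d) / 3"
  have st: "c < s" "s < t" "t < d" using g by (auto simp: gap_def s_def t_def field_simps)
  have v: "snd l $ i = 1" using l by (simp add: lines_def)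
  have "connected (line_point l ` {c<..<d})"
    unfolding line_point_def by (intro connected_continuous_image continuous_intros) auto
  moreover have "line_point l ` {c<..<d} \<subseteq> reg X" using line_point_reg[OF g l] by auto
  moreover have "line_point l s \<in> line_point l ` {c<..<d}" using st by auto
  ultimately have "line_point l ` {c<..<d} \<subseteq> connected_component_set (reg X) (line_point l s)"
    by (intro connected_component_maximal)
  moreover have "connected_component_set (reg X) (line_point l s) \<in> edges X"
    unfolding edges_def components_def using line_point_reg[OF g l, of s] st by auto
  ultimately obtain E where E: "E \<in> edges X" "line_point l ` {c<..<d} \<subseteq> E" by metis
  have d: "line_point l t - line_point l s = (t - s) *\<^sub>R snd l"
    by (simp add: line_point_def algebra_simps)
  have "snd l \<noteq> 0" using v by auto
  then have ne: "line_point l s \<noteq> line_point l t" using d st by auto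
  have "line_point l s \<in> E" "line_point l t \<in> E" using E(2) st by auto
  then have "angle_with_axis i (line_point l t - line_point l s) \<le> \<theta>"
    using flat[unfolded theta_flat_def, THEN bspec, OF E(1), THEN bspec, THEN bspec] ne by simp
  then have "angle_with_axis i ((t - s) *\<^sub>R snd l) \<le> \<theta>" using d by simp
  then have arc: "arccos (1 / norm (snd l)) \<le> \<theta>"
    using v st by (simp add: angle_with_axis_def inner_axis)
  have "1 \<le> norm (snd l)" using component_le_norm_cart[of "snd l" i] v by simp
  then have inv: "1 / norm (snd l) \<le> 1" "-1 \<le> 1 / norm (snd l)"
    by (auto simp: divide_le_eq le_divide_eq)
  have "cos \<theta> \<le> cos (arccos (1 / norm (snd l)))"
    using arc \<theta> arccos_lbound[OF inv(2,1)] by (intro cos_monotone_0_pi_le) auto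
  also have "\<dots> = 1 / norm (snd l)" using inv(2,1) by (rule cos_arccos)
  finally have "cos \<theta> * norm (snd l) \<le> 1"
    using \<open>1 \<le> norm (snd l)\<close> by (subst (asm) pos_le_divide_eq) linarith+
  moreover have "cos \<theta> > 0" using \<theta> by (intro cos_gt_zero_pi) auto
  ultimately show ?thesis by (simp add: field_simps)
qed

end

section \<open>Vertices at the ends of a gap\<close>

context flat_cover
begin

text \<open>Meant for \<open>z\<close> at an end of the gap: the affine parametrisation continues
  past the open gap, so these are the lines that reach \<open>z\<close>.\<close>

definition lines_at :: "real \<Rightarrow> real \<Rightarrow> real ^ 'n \<Rightarrow> ((real ^ 'n) \<times> (real ^ 'n)) set" where
  "lines_at c d z = {l \<in> lines c d. line_point l (z $ i) = z}"

lemma finite_lines_at: "gap c d \<Longrightarrow> finite (lines_at c d z)"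
  unfolding lines_at_def using finite_lines[of c d] by simp

lemma lines_at_subset: "l \<in> lines_at c d z \<Longrightarrow> l \<in> lines c d"
  by (simp add: lines_at_def)

lemma lines_at_point: "l \<in> lines_at c d z \<Longrightarrow> line_point l t = z + (t - z $ i) *\<^sub>R snd l"
  using line_point_shift[of l t "z $ i"] by (simp add: lines_at_def)

lemma snd_lines_at: "l \<in> lines_at c d z \<Longrightarrow> snd l $ i = 1"
  by (simp add: lines_at_def lines_def)

lemma norm_ge_1: "v $ i = 1 \<Longrightarrow> norm v \<ge> 1" for v :: "real ^ 'n"
  using component_le_norm_cart[of v i] by simp

lemma closed_line_point:
  assumes g: "gap c d" and l: "l \<in> lines c d" and t: "c \<le> t" "t \<le> d"
  shows "line_point l t \<in> X"
proof -
  have "continuous_on (closure {c<..<d}) (line_point l)"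
    unfolding line_point_def by (intro continuous_intros)
  moreover have "line_point l ` {c<..<d} \<subseteq> X" using l by (auto simp: lines_def)
  ultimately have "line_point l ` closure {c<..<d} \<subseteq> X"
    using closed_X by (intro image_closure_subset)
  moreover have "closure {c<..<d} = {c..d}" using g by (simp add: gap_def)
  ultimately show ?thesis using t by auto
qed

text \<open>From here on the sign \<open>\<sigma>\<close> selects the side of \<open>z\<close> on which the gap lies.\<close>

lemma extend_to_gap:
  assumes g: "gap c d" and \<sigma>: "\<sigma> = 1 \<and> c = z $ i \<or> \<sigma> = -1 \<and> d = z $ i"
    and w: "w $ i = 1" and ev: "\<forall>\<^sub>F \<tau> in at_right 0. z + (\<sigma> * \<tau>) *\<^sub>R w \<in> X"
  obtains l where "l \<in> lines_at c d z" "snd l = w"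
proof -
  obtain \<epsilon> where \<epsilon>: "\<epsilon> > 0" "\<And>\<tau>. 0 < \<tau> \<Longrightarrow> \<tau> < \<epsilon> \<Longrightarrow> z + (\<sigma> * \<tau>) *\<^sub>R w \<in> X"
    using ev unfolding eventually_at_right_field by blast
  define s where "s = min \<epsilon> (d - c) / 2"
  have s: "0 < s" "s < \<epsilon>" "s < d - c" using \<epsilon> g by (auto simp: s_def gap_def)
  \<comment> \<open>A point of the given piece inside the gap; the line of the gap through it must
    have slope \<open>w\<close> and so leads back to \<open>z\<close>.\<close>
  define y where "y = z + (\<sigma> * s) *\<^sub>R w"
  have yX: "y \<in> X" using \<epsilon>(2) s by (simp add: y_def)
  have yi: "y $ i = z $ i + \<sigma> * s" using w by (simp add: y_def)
  then have y: "c < y $ i" "y $ i < d" using \<sigma> s by auto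
  obtain l where l: "l \<in> lines c d" "line_point l (y $ i) = y"
    and u: "\<forall>w \<sigma>. w $ i = 1 \<longrightarrow> \<sigma> \<noteq> 0 \<longrightarrow> (\<forall>\<^sub>F \<tau> in at_right 0. y + (\<sigma> * \<tau>) *\<^sub>R w \<in> X) \<longrightarrow> w = snd l"
    by (rule line_through[OF g yX y]) (rule that)
  have "\<forall>\<^sub>F \<tau> in at_right 0. y + (\<sigma> * \<tau>) *\<^sub>R w \<in> X"
    unfolding eventually_at_right_field
  proof (intro exI[of _ "\<epsilon> - s"] conjI allI impI)
    fix \<tau> assume \<tau>: "0 < \<tau>" "\<tau> < \<epsilon> - s"
    have "y + (\<sigma> * \<tau>) *\<^sub>R w = z + (\<sigma> * (s + \<tau>)) *\<^sub>R w" by (simp add: y_def algebra_simps)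
    then show "y + (\<sigma> * \<tau>) *\<^sub>R w \<in> X" using \<epsilon>(2)[of "s + \<tau>"] s \<tau> by simp
  qed (use s in simp)
  moreover have "\<sigma> \<noteq> 0" using \<sigma> by auto
  ultimately have wl: "w = snd l" using u w by blast
  have "line_point l (z $ i) = y + (z $ i - y $ i) *\<^sub>R w"
    using line_point_shift[of l "z $ i" "y $ i"] l wl by simp
  also have "z $ i - y $ i = - (\<sigma> * s)" using yi by simp
  also have "y + - (\<sigma> * s) *\<^sub>R w = z" by (simp add: y_def)
  finally have "l \<in> lines_at c d z" using l by (simp add: lines_at_def)
  then show thesis using wl that by blast
qed

text \<open>Elements of \<open>directions\<close> point away from \<open>z\<close>, so for a gap on
  the left the tangent is negated. As \<open>norm (snd l)\<close> is at least one, lengths below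
  \<open>d - c\<close> stay over the gap.\<close>

lemma direction_of_line:
  assumes g: "gap c d" and \<sigma>: "\<sigma> = 1 \<and> c = z $ i \<or> \<sigma> = -1 \<and> d = z $ i" and l: "l \<in> lines_at c d z"
  shows "\<sigma> *\<^sub>R sgn (snd l) \<in> directions X z" "\<sigma> * (\<sigma> *\<^sub>R sgn (snd l)) $ i > 0"
    "dir_mult m z (\<sigma> *\<^sub>R sgn (snd l)) = line_mult c d l"
proof -
  have v: "snd l $ i = 1" using l by (rule snd_lines_at)
  then have n: "norm (snd l) \<ge> 1" by (rule norm_ge_1)
  have ev: "\<forall>\<^sub>F t in at_right 0. z + t *\<^sub>R (\<sigma> *\<^sub>R sgn (snd l)) \<in> reg X \<and>
      m (z + t *\<^sub>R (\<sigma> *\<^sub>R sgn (snd l))) = line_mult c d l"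
    unfolding eventually_at_right_field
  proof (intro exI[of _ "d - c"] conjI allI impI)
    show "0 < d - c" using g by (simp add: gap_def)
    fix t assume t: "0 < t" "t < d - c"
    define \<tau> where "\<tau> = z $ i + \<sigma> * (t / norm (snd l))"
    have np: "norm (snd l) > 0" using n by linarith
    then have "0 < t / norm (snd l)" "t / norm (snd l) \<le> t"
      using t n by (simp_all add: pos_divide_le_eq mult_le_cancel_left1)
    then have "c < \<tau>" "\<tau> < d" using \<sigma> t by (auto simp: \<tau>_def)
    moreover have "line_point l \<tau> = z + t *\<^sub>R (\<sigma> *\<^sub>R sgn (snd l))"
      unfolding lines_at_point[OF l] by (simp add: \<tau>_def sgn_div_norm divide_inverse)
    ultimately show "z + t *\<^sub>R (\<sigma> *\<^sub>R sgn (snd l)) \<in> reg X"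
      "m (z + t *\<^sub>R (\<sigma> *\<^sub>R sgn (snd l))) = line_mult c d l"
      using line_point_reg[OF g lines_at_subset[OF l]] line_mult(2)[OF g lines_at_subset[OF l]] by metis+
  qed
  have "\<bar>\<sigma>\<bar> = 1" using \<sigma> by auto
  moreover have nz: "snd l \<noteq> 0" using n by auto
  ultimately show "\<sigma> *\<^sub>R sgn (snd l) \<in> directions X z"
    unfolding directions_def using ev by (auto simp: norm_sgn elim: eventually_mono)
  have "\<sigma> * \<sigma> = 1" using \<sigma> by auto
  then show "\<sigma> * (\<sigma> *\<^sub>R sgn (snd l)) $ i > 0"
    using v nz by (simp add: sgn_div_norm mult.assoc[symmetric])
  have "((\<lambda>t. m (z + t *\<^sub>R (\<sigma> *\<^sub>R sgn (snd l)))) \<longlongrightarrow> line_mult c d l) (at_right 0)"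
    using ev by (intro tendsto_eventually) (auto elim: eventually_mono)
  then show "dir_mult m z (\<sigma> *\<^sub>R sgn (snd l)) = line_mult c d l"
    unfolding dir_mult_def by (intro tendsto_Lim) auto
qed

text \<open>Dividing by the size \<open>q\<close> of the first coordinate turns \<open>s\<close>
  into a slope, up to the sign \<open>\<sigma>\<close>, and \<open>extend_to_gap\<close> continues
  the piece over the gap.\<close>

lemma line_of_direction:
  assumes g: "gap c d" and \<sigma>: "\<sigma> = 1 \<and> c = z $ i \<or> \<sigma> = -1 \<and> d = z $ i"
    and s: "s \<in> directions X z" "\<sigma> * s $ i > 0"
  obtains l where "l \<in> lines_at c d z" "s = \<sigma> *\<^sub>R sgn (snd l)"
proof -
  define q where "q = \<sigma> * s $ i"
  have q: "q > 0" "\<sigma> * \<sigma> = 1" using s \<sigma> by (auto simp: q_def)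
  have siq: "s $ i = \<sigma> * q" using q by (simp add: q_def mult.assoc[symmetric])
  have ns: "norm s = 1" and evs: "\<forall>\<^sub>F t in at_right 0. z + t *\<^sub>R s \<in> reg X"
    using s(1) unfolding directions_def by auto
  define w where "w = (\<sigma> / q) *\<^sub>R s"
  have w: "w $ i = 1" using siq q by (simp add: w_def)
  obtain \<epsilon> where \<epsilon>: "\<epsilon> > 0" "\<And>t. 0 < t \<Longrightarrow> t < \<epsilon> \<Longrightarrow> z + t *\<^sub>R s \<in> reg X"
    using evs unfolding eventually_at_right_field by blast
  have "\<forall>\<^sub>F \<tau> in at_right 0. z + (\<sigma> * \<tau>) *\<^sub>R w \<in> X"
    unfolding eventually_at_right_field
  proof (intro exI[of _ "\<epsilon> * q"] conjI allI impI)
    fix \<tau> assume \<tau>: "0 < \<tau>" "\<tau> < \<epsilon> * q"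
    have "(\<sigma> * \<tau>) * (\<sigma> / q) = \<tau> / q" using q by (simp add: field_simps)
    then have "z + (\<sigma> * \<tau>) *\<^sub>R w = z + (\<tau> / q) *\<^sub>R s" by (simp add: w_def)
    moreover have "0 < \<tau> / q" "\<tau> / q < \<epsilon>" using \<tau> q by (auto simp: pos_divide_less_eq)
    ultimately show "z + (\<sigma> * \<tau>) *\<^sub>R w \<in> X" using \<epsilon>(2) reg_subset by auto
  qed (use \<epsilon> q in simp)
  then obtain l where l: "l \<in> lines_at c d z" "snd l = w"
    using extend_to_gap[OF g \<sigma> w] by blast
  have "\<bar>\<sigma>\<bar> = 1" using \<sigma> by auto
  then have "norm w = 1 / q" using ns q by (simp add: w_def)
  then have "sgn w = \<sigma> *\<^sub>R s" using q by (simp add: sgn_div_norm w_def)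
  then have "s = \<sigma> *\<^sub>R sgn (snd l)" using l q by simp
  then show thesis using l that by blast
qed

text \<open>\<open>direction_of_line\<close> and \<open>line_of_direction\<close> give a bijection
  between lines and directions on one side. A general \<open>f\<close> covers both multiplicities
  and weighted tangents.\<close>

lemma sum_directions:
  fixes f :: "real \<Rightarrow> real ^ 'n \<Rightarrow> 'b::comm_monoid_add"
  assumes g: "gap c d" and \<sigma>: "\<sigma> = 1 \<and> c = z $ i \<or> \<sigma> = -1 \<and> d = z $ i"
  shows "(\<Sum>s\<in>{s \<in> directions X z. \<sigma> * s $ i > 0}. f (dir_mult m z s) s)
    = (\<Sum>l\<in>lines_at c d z. f (line_mult c d l) (\<sigma> *\<^sub>R sgn (snd l)))"
proof -
  have eq: "{s \<in> directions X z. \<sigma> * s $ i > 0} = (\<lambda>l. \<sigma> *\<^sub>R sgn (snd l)) ` lines_at c d z"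
  proof (intro set_eqI iffI)
    fix s assume s: "s \<in> {s \<in> directions X z. \<sigma> * s $ i > 0}"
    show "s \<in> (\<lambda>l. \<sigma> *\<^sub>R sgn (snd l)) ` lines_at c d z"
      by (rule line_of_direction[OF g \<sigma>, of s]) (use s in auto)
  next
    fix s assume "s \<in> (\<lambda>l. \<sigma> *\<^sub>R sgn (snd l)) ` lines_at c d z"
    then obtain l where "l \<in> lines_at c d z" "s = \<sigma> *\<^sub>R sgn (snd l)" by blast
    then show "s \<in> {s \<in> directions X z. \<sigma> * s $ i > 0}"
      using direction_of_line(1,2)[OF g \<sigma>] by simp
  qed
  have inj: "inj_on (\<lambda>l. \<sigma> *\<^sub>R sgn (snd l)) (lines_at c d z)"
  proof (rule inj_onI)
    fix l l' assume l: "l \<in> lines_at c d z" "l' \<in> lines_at c d z" "\<sigma> *\<^sub>R sgn (snd l) = \<sigma> *\<^sub>R sgn (snd l')"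
    have v: "snd l $ i = 1" "snd l' $ i = 1" using l snd_lines_at by blast+
    have n: "snd l \<noteq> 0" "snd l' \<noteq> 0" using v by auto
    have "\<sigma> \<noteq> 0" using \<sigma> by auto
    then have sgn: "sgn (snd l) = sgn (snd l')" using l by simp
    then have "sgn (snd l) $ i = sgn (snd l') $ i" by simp
    then have "norm (snd l) = norm (snd l')" using v n by (simp add: sgn_div_norm)
    then have "snd l = snd l'" using sgn n by (simp add: sgn_div_norm)
    then show "l = l'"
      using l by (intro line_unique[of l c d l' c d "z $ i"]) (auto simp: lines_at_def)
  qed
  show ?thesis unfolding eq
    by (subst sum.reindex[OF inj]) (simp add: direction_of_line(3)[OF g \<sigma>])
qed

lemma directions_not_vertical: "s \<in> directions X z \<Longrightarrow> s $ i \<noteq> 0"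
  by (rule not_vertical[of z]) (auto simp: directions_def elim!: eventually_mono intro: reg_subset[THEN subsetD])

text \<open>The slice at a singular time can also contain regular points; there a single line passes
  straight through.\<close>

lemma lines_at_reg:
  fixes \<sigma> r :: real
  assumes g: "gap c d" and \<sigma>: "\<sigma> = 1 \<and> c = z $ i \<or> \<sigma> = -1 \<and> d = z $ i" and z: "z \<in> reg X"
    and v: "v $ i = 1" "r > 0" "\<forall>y\<in>ball z r. y \<in> X \<longleftrightarrow> y = z + (y $ i - z $ i) *\<^sub>R v"
  obtains l where "lines_at c d z = {l}" "snd l = v" "line_mult c d l = m z"
proof -
  have lim: "((\<lambda>\<tau>. z + (\<sigma> * \<tau>) *\<^sub>R v) \<longlongrightarrow> z + (\<sigma> * 0) *\<^sub>R v) (at_right 0)"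
    by (intro tendsto_intros)
  then have "\<forall>\<^sub>F \<tau> in at_right 0. z + (\<sigma> * \<tau>) *\<^sub>R v \<in> ball z r"
    using v(2) by (intro topological_tendstoD) auto
  then have "\<forall>\<^sub>F \<tau> in at_right 0. z + (\<sigma> * \<tau>) *\<^sub>R v \<in> X"
  proof eventually_elim
    case (elim \<tau>)
    then show ?case using bspec[OF v(3) elim] v(1) by simp
  qed
  then obtain l where l: "l \<in> lines_at c d z" "snd l = v"
    using extend_to_gap[OF g \<sigma> v(1)] by blast
  have cd: "c < d" using g by (simp add: gap_def)
  have in_gap: "\<forall>\<^sub>F \<tau> in at_right 0. c < z $ i + \<sigma> * \<tau> \<and> z $ i + \<sigma> * \<tau> < d"
    unfolding eventually_at_right_field
    using \<sigma> cd by (intro exI[of _ "d - c"]) auto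
  have pt: "line_point l' (z $ i + \<sigma> * \<tau>) = z + (\<sigma> * \<tau>) *\<^sub>R snd l'" if "l' \<in> lines_at c d z" for l' \<tau>
    using lines_at_point[OF that] by simp
  have uniq: "l' = l" if l': "l' \<in> lines_at c d z" for l'
  proof -
    have "\<forall>\<^sub>F \<tau> in at_right 0. z + (\<sigma> * \<tau>) *\<^sub>R snd l' \<in> X"
      using in_gap
    proof eventually_elim
      case (elim \<tau>)
      then have "line_point l' (z $ i + \<sigma> * \<tau>) \<in> X" using lines_at_subset[OF l'] by (simp add: lines_def)
      then show ?case by (simp add: pt[OF l'])
    qed
    moreover have "\<sigma> \<noteq> 0" using \<sigma> by auto
    ultimately have "snd l' = snd l"
      using local_line_direction[OF v snd_lines_at[OF l']] l(2) by simp
    then show ?thesis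
      using l' l by (intro line_unique[of l' c d l c d "z $ i"]) (auto simp: lines_at_def)
  qed
  have "\<forall>\<^sub>F \<tau> in at_right 0. z + (\<sigma> * \<tau>) *\<^sub>R v \<in> reg X \<longrightarrow> m (z + (\<sigma> * \<tau>) *\<^sub>R v) = m z"
    using m_locally_constant[OF z] lim by (intro eventually_compose_filterlim[where f = "\<lambda>\<tau>. z + (\<sigma> * \<tau>) *\<^sub>R v"]) auto
  then obtain \<tau> where \<tau>: "z + (\<sigma> * \<tau>) *\<^sub>R v \<in> reg X \<longrightarrow> m (z + (\<sigma> * \<tau>) *\<^sub>R v) = m z"
      "c < z $ i + \<sigma> * \<tau> \<and> z $ i + \<sigma> * \<tau> < d"
    using eventually_happens'[OF _ eventually_conj[OF _ in_gap]] by force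
  have "line_mult c d l = m z"
    using line_point_reg[OF g lines_at_subset[OF l(1)], of "z $ i + \<sigma> * \<tau>"]
      line_mult(2)[OF g lines_at_subset[OF l(1)], of "z $ i + \<sigma> * \<tau>"] pt[OF l(1)] l(2) \<tau> by simp
  then show thesis using that[of l] l uniq by blast
qed

text \<open>Off \<open>X\<close> both sides are empty, at a regular point one line continues, and at
  a singular point the cover condition gives the first equation and stationarity the second.\<close>

lemma vertex_balance:
  assumes g: "gap c q" "gap q d" and q: "z $ i = q"
  shows "(\<Sum>l\<in>lines_at c q z. line_mult c q l) = (\<Sum>l\<in>lines_at q d z. line_mult q d l)"
    and "(\<Sum>l\<in>lines_at c q z. line_mult c q l *\<^sub>R sgn (snd l)) = (\<Sum>l\<in>lines_at q d z. line_mult q d l *\<^sub>R sgn (snd l))"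
proof -
  have left: "- 1 = (1::real) \<and> c = z $ i \<or> - 1 = (- 1::real) \<and> q = z $ i" using q by simp
  have right: "1 = (1::real) \<and> q = z $ i \<or> 1 = (- 1::real) \<and> d = z $ i" using q by simp
  have "(\<Sum>l\<in>lines_at c q z. line_mult c q l) = (\<Sum>l\<in>lines_at q d z. line_mult q d l) \<and>
    (\<Sum>l\<in>lines_at c q z. line_mult c q l *\<^sub>R sgn (snd l)) = (\<Sum>l\<in>lines_at q d z. line_mult q d l *\<^sub>R sgn (snd l))"
  proof (cases "z \<in> X")
    case False
    have cqd: "c < q" "q < d" using g by (auto simp: gap_def)
    have "lines_at c q z = {}" "lines_at q d z = {}"
      using closed_line_point[OF g(1), of _ q] closed_line_point[OF g(2), of _ q] cqd q False
      unfolding lines_at_def by force+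
    then show ?thesis by simp
  next
    case z: True
    show ?thesis
    proof (cases "z \<in> reg X")
      case reg: True
      obtain v r where v: "v $ i = 1" "r > 0"
        "\<And>y. y \<in> ball z r \<Longrightarrow> y \<in> X \<longleftrightarrow> y = z + (y $ i - z $ i) *\<^sub>R v"
        using reg_local_line[OF reg] by blast
      then have v': "\<forall>y\<in>ball z r. y \<in> X \<longleftrightarrow> y = z + (y $ i - z $ i) *\<^sub>R v" by blast
      obtain l1 where l1: "lines_at c q z = {l1}" "snd l1 = v" "line_mult c q l1 = m z"
        using lines_at_reg[OF g(1) left reg v(1,2) v'] by blast
      obtain l2 where l2: "lines_at q d z = {l2}" "snd l2 = v" "line_mult q d l2 = m z"
        using lines_at_reg[OF g(2) right reg v(1,2) v'] by blast
      show ?thesis using l1 l2 by simp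
    next
      case False
      then have sing: "z \<in> sing X" using z by (simp add: sing_def)
      have "real (\<Sum>l\<in>lines_at c q z. line_mult c q l) = (\<Sum>s\<in>{s \<in> directions X z. s $ i < 0}. dir_mult m z s)"
        using sum_directions[OF g(1) left, of "\<lambda>a s. a"] by simp
      also have "\<dots> = (\<Sum>s\<in>{s \<in> directions X z. s $ i > 0}. dir_mult m z s)"
        using cover sing unfolding k_cover_def by blast
      also have "\<dots> = real (\<Sum>l\<in>lines_at q d z. line_mult q d l)"
        using sum_directions[OF g(2) right, of "\<lambda>a s. a"] by simp
      finally have 1: "(\<Sum>l\<in>lines_at c q z. line_mult c q l) = (\<Sum>l\<in>lines_at q d z. line_mult q d l)"
        by (simp only: of_nat_eq_iff)
      have split: "directions X z = {s \<in> directions X z. - 1 * s $ i > 0} \<union> {s \<in> directions X z. 1 * s $ i > 0}"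
        using directions_not_vertical[of _ z] by (auto simp: linorder_neq_iff)
      \<comment> \<open>Finiteness of the directions comes from that of the lines; it allows the sum
        in stationarity to be split into its two sides.\<close>
      have fin: "finite {s \<in> directions X z. - 1 * s $ i > 0}" "finite {s \<in> directions X z. 1 * s $ i > 0}"
      proof -
        have "{s \<in> directions X z. - 1 * s $ i > 0} \<subseteq> (\<lambda>l. (- 1) *\<^sub>R sgn (snd l)) ` lines_at c q z"
          using line_of_direction[OF g(1) left] by blast
        then show "finite {s \<in> directions X z. - 1 * s $ i > 0}"
          using finite_lines_at[OF g(1)] finite_surj by blast
        have "{s \<in> directions X z. 1 * s $ i > 0} \<subseteq> (\<lambda>l. 1 *\<^sub>R sgn (snd l)) ` lines_at q d z"
          using line_of_direction[OF g(2) right] by blast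
        then show "finite {s \<in> directions X z. 1 * s $ i > 0}"
          using finite_lines_at[OF g(2)] finite_surj by blast
      qed
      have "0 = (\<Sum>s\<in>directions X z. dir_mult m z s *\<^sub>R s)"
        using isgn sing unfolding isgn_def stationary_def by simp
      also have "\<dots> = (\<Sum>s\<in>{s \<in> directions X z. - 1 * s $ i > 0}. dir_mult m z s *\<^sub>R s)
          + (\<Sum>s\<in>{s \<in> directions X z. 1 * s $ i > 0}. dir_mult m z s *\<^sub>R s)"
        by (subst split, rule sum.union_disjoint[OF fin]) auto
      \<comment> \<open>Left directions are negated tangents, so a vanishing total becomes an
        equality between the two sides.\<close>
      also have "\<dots> = (\<Sum>l\<in>lines_at c q z. line_mult c q l *\<^sub>R ((- 1) *\<^sub>R sgn (snd l)))
          + (\<Sum>l\<in>lines_at q d z. line_mult q d l *\<^sub>R (1 *\<^sub>R sgn (snd l)))"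
        by (simp only: sum_directions[OF g(1) left, of "\<lambda>a s. a *\<^sub>R s"] sum_directions[OF g(2) right, of "\<lambda>a s. a *\<^sub>R s"])
      finally have "(\<Sum>l\<in>lines_at c q z. line_mult c q l *\<^sub>R sgn (snd l)) = (\<Sum>l\<in>lines_at q d z. line_mult q d l *\<^sub>R sgn (snd l))"
        by (simp add: sum_negf)
      then show ?thesis using 1 by blast
    qed
  qed
  then show "(\<Sum>l\<in>lines_at c q z. line_mult c q l) = (\<Sum>l\<in>lines_at q d z. line_mult q d l)"
    "(\<Sum>l\<in>lines_at c q z. line_mult c q l *\<^sub>R sgn (snd l)) = (\<Sum>l\<in>lines_at q d z. line_mult q d l *\<^sub>R sgn (snd l))"
    by blast+
qed

text \<open>Follow a graph edge through \<open>z\<close> a short way; as the singular points are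
  finitely many, the piece just after \<open>z\<close> avoids them.\<close>

lemma directions_nonempty:
  assumes z: "z \<in> X"
  shows "directions X z \<noteq> {}"
proof -
  obtain U S where U: "open U" "z \<in> U" "segment_graph S" "X \<inter> U = graph_support S \<inter> U"
    using isgn z unfolding isgn_def geodesic_network_def by blast
  then obtain a b where ab: "(a, b) \<in> S" "z \<in> closed_segment a b"
    using z unfolding graph_support_def by blast
  have "a \<noteq> b" using U(3) ab(1) unfolding segment_graph_def by blast
  then obtain w where w: "w \<noteq> z" "w \<in> closed_segment a b" by (metis ends_in_segment)
  define s where "s = sgn (w - z)"
  have s: "norm s = 1" "w - z = norm (w - z) *\<^sub>R s" using w by (auto simp: s_def norm_sgn sgn_div_norm)
  have lim: "((\<lambda>t. z + t *\<^sub>R s) \<longlongrightarrow> z + 0 *\<^sub>R s) (at_right 0)" by (intro tendsto_intros)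
  have "\<forall>\<^sub>F t in at_right 0. z + t *\<^sub>R s \<in> U"
    using lim U by (intro topological_tendstoD[where l = "z + 0 *\<^sub>R s"]) auto
  moreover have "\<forall>\<^sub>F t in at_right 0. z + t *\<^sub>R s \<in> - (sing X - {z})"
  proof (rule topological_tendstoD[OF lim])
    show "open (- (sing X - {z}))" using finite_sing by (intro open_Compl finite_imp_closed) simp
  qed simp
  moreover have "\<forall>\<^sub>F t in at_right 0. 0 < t \<and> t < norm (w - z)"
    unfolding eventually_at_right_field using w by (intro exI[of _ "norm (w - z)"]) auto
  ultimately have "\<forall>\<^sub>F t in at_right 0. z + t *\<^sub>R s \<in> reg X"
  proof eventually_elim
    case (elim t)
    have "z + t *\<^sub>R s = (1 - t / norm (w - z)) *\<^sub>R z + (t / norm (w - z)) *\<^sub>R w"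
    proof -
      have "(t / norm (w - z)) *\<^sub>R (w - z) = t *\<^sub>R s" by (simp add: s_def sgn_div_norm divide_inverse)
      then show ?thesis by (simp add: algebra_simps)
    qed
    then have "z + t *\<^sub>R s \<in> closed_segment z w"
      unfolding in_segment using elim(3) by (intro exI[of _ "t / norm (w - z)"]) (auto simp: divide_le_eq)
    then have "z + t *\<^sub>R s \<in> closed_segment a b"
      using ab(2) w(2) subset_closed_segment by blast
    then have "z + t *\<^sub>R s \<in> X" using U(4) elim(1) ab(1) unfolding graph_support_def by blast
    moreover have "z + t *\<^sub>R s \<noteq> z" using elim(3) s(1) by auto
    ultimately show ?case using elim(2) reg_if_not_sing by blast
  qed
  then show ?thesis using s(1) unfolding directions_def by blast
qed

text \<open>If all incoming and outgoing lines had one slope, they would form a single line through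
  \<open>z\<close> that coincides with \<open>X\<close> near \<open>z\<close>, and \<open>z\<close>
  would be regular.\<close>

lemma sing_vertex:
  assumes g: "gap c (z $ i)" "gap (z $ i) d" and sing: "z \<in> sing X"
  obtains l l' where "l \<in> lines_at c (z $ i) z" "l' \<in> lines_at (z $ i) d z" "snd l \<noteq> snd l'"
proof (rule ccontr)
  note witness = that
  assume "\<not> thesis"
  then have same: "snd l = snd l'" if "l \<in> lines_at c (z $ i) z" "l' \<in> lines_at (z $ i) d z" for l l'
    using witness that by blast
  let ?q = "z $ i"
  have z: "z \<in> X" "z \<notin> reg X" using sing by (auto simp: sing_def)
  \<comment> \<open>Multiplicities are positive, so balance forbids lines on one side only.\<close>
  have empty: "lines_at c ?q z = {} \<longleftrightarrow> lines_at ?q d z = {}"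
  proof -
    have "(\<Sum>l\<in>lines_at c ?q z. line_mult c ?q l) = 0 \<longleftrightarrow> lines_at c ?q z = {}"
      using finite_lines_at[OF g(1)] line_mult(1)[OF g(1)] lines_at_subset by fastforce
    moreover have "(\<Sum>l\<in>lines_at ?q d z. line_mult ?q d l) = 0 \<longleftrightarrow> lines_at ?q d z = {}"
      using finite_lines_at[OF g(2)] line_mult(1)[OF g(2)] lines_at_subset by fastforce
    ultimately show ?thesis using vertex_balance(1)[OF g] by simp
  qed
  obtain s where s: "s \<in> directions X z" using directions_nonempty[OF z(1)] by blast
  have "lines_at c ?q z \<noteq> {} \<or> lines_at ?q d z \<noteq> {}"
  proof (cases "s $ i > 0")
    case True
    then show ?thesis using line_of_direction[OF g(2) _ s, of 1] by force
  next
    case False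
    then have "s $ i < 0" using directions_not_vertical[OF s] by linarith
    then show ?thesis using line_of_direction[OF g(1) _ s, of "- 1"] by force
  qed
  then obtain l l' where l: "l \<in> lines_at c ?q z" "l' \<in> lines_at ?q d z" using empty by blast
  define v where "v = snd l"
  have v: "v $ i = 1" using snd_lines_at[OF l(1)] by (simp add: v_def)
  have left: "snd l1 = v" if "l1 \<in> lines_at c ?q z" for l1
    using same[OF that l(2)] same[OF l] by (simp add: v_def)
  have right: "snd l1 = v" if "l1 \<in> lines_at ?q d z" for l1
    using same[OF l(1) that] by (simp add: v_def)
  have coord: "((\<lambda>y. y $ i) \<longlongrightarrow> ?q) (nhds z)" by (intro tendsto_intros filterlim_ident)
  have near: "\<forall>\<^sub>F y in nhds z. c < y $ i \<and> y $ i < d"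
    using g order_tendstoD[OF coord] by (intro eventually_conj) (auto simp: gap_def)
  \<comment> \<open>The finitely many lines that miss \<open>z\<close> avoid a neighbourhood of
    it.\<close>
  have avoid: "\<forall>\<^sub>F y in nhds z. \<forall>l\<in>lines a b - lines_at a b z. line_point l (y $ i) \<noteq> y" if "gap a b" for a b
  proof (rule eventually_ball_finite)
    show "finite (lines a b - lines_at a b z)" using finite_lines[OF that] by simp
    show "\<forall>l\<in>lines a b - lines_at a b z. \<forall>\<^sub>F y in nhds z. line_point l (y $ i) \<noteq> y"
    proof
      fix l assume "l \<in> lines a b - lines_at a b z"
      then have ne: "line_point l ?q - z \<noteq> 0" by (simp add: lines_at_def)
      have "((\<lambda>y. line_point l (y $ i) - y) \<longlongrightarrow> line_point l ?q - z) (nhds z)"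
        unfolding line_point_def by (intro tendsto_intros filterlim_ident)
      then have "\<forall>\<^sub>F y in nhds z. line_point l (y $ i) - y \<noteq> 0"
        using ne by (rule tendsto_imp_eventually_ne)
      then show "\<forall>\<^sub>F y in nhds z. line_point l (y $ i) \<noteq> y" by eventually_elim simp
    qed
  qed
  \<comment> \<open>On the slice through \<open>z\<close> neither gap applies; its finiteness
    isolates \<open>z\<close>.\<close>
  have "open (- (slice i X ?q - {z}))" using finite_slice by (intro open_Compl finite_imp_closed) simp
  then have slice: "\<forall>\<^sub>F y in nhds z. y \<in> - (slice i X ?q - {z})" by (intro eventually_nhds_in_open) auto
  have "\<forall>\<^sub>F y in nhds z. y \<in> X \<longleftrightarrow> (\<exists>\<tau>. y = z + \<tau> *\<^sub>R v)"
    using near avoid[OF g(1)] avoid[OF g(2)] slice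
  proof eventually_elim
    case (elim y)
    have on: "y = z + (y $ i - ?q) *\<^sub>R v" if yX: "y \<in> X"
    proof -
      consider "y $ i < ?q" | "y $ i = ?q" | "y $ i > ?q" by linarith
      then show ?thesis
      proof cases
        case 1
        obtain l1 where l1: "l1 \<in> lines c ?q" "line_point l1 (y $ i) = y"
          by (rule line_through[OF g(1) yX _ 1]) (use elim(1) in auto)
        then have "l1 \<in> lines_at c ?q z" using elim(2) by blast
        then show ?thesis using lines_at_point[of l1 c ?q z "y $ i"] left l1(2) by simp
      next
        case 2
        then have "y \<in> slice i X ?q" using yX by (simp add: slice_def)
        then have "y = z" using elim(4) by blast
        then show ?thesis by simp
      next
        case 3
        obtain l1 where l1: "l1 \<in> lines ?q d" "line_point l1 (y $ i) = y"
          by (rule line_through[OF g(2) yX 3]) (use elim(1) in auto)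
        then have "l1 \<in> lines_at ?q d z" using elim(3) by blast
        then show ?thesis using lines_at_point[of l1 ?q d z "y $ i"] right l1(2) by simp
      qed
    qed
    have conv: "y \<in> X" if "y = z + \<tau> *\<^sub>R v" for \<tau>
    proof -
      have yi: "y $ i = ?q + \<tau>" using that v by simp
      show ?thesis
      proof (cases "\<tau> \<le> 0")
        case True
        have "line_point l (y $ i) \<in> X"
          using closed_line_point[OF g(1) lines_at_subset[OF l(1)]] elim(1) yi True by simp
        moreover have "line_point l (y $ i) = z + \<tau> *\<^sub>R v"
          unfolding lines_at_point[OF l(1)] yi by (simp add: v_def)
        ultimately show ?thesis using that by metis
      next
        case False
        have "line_point l' (y $ i) \<in> X"
          using closed_line_point[OF g(2) lines_at_subset[OF l(2)]] elim(1) yi False by simp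
        moreover have "line_point l' (y $ i) = z + \<tau> *\<^sub>R v"
          unfolding lines_at_point[OF l(2)] yi by (simp add: right[OF l(2)])
        ultimately show ?thesis using that by metis
      qed
    qed
    show ?case using on conv by blast
  qed
  moreover have "v \<noteq> 0" using v by auto
  ultimately have "z \<in> reg X" by (intro reg_if_locally_line)
  then show False using z by blast
qed

end

section \<open>From networks to particles\<close>

lemma ex_labelling:
  assumes "finite G" "finite A" "card A = (\<Sum>l\<in>G. w l)"
  shows "\<exists>g. (\<forall>a\<in>A. g a \<in> G) \<and> (\<forall>l\<in>G. card {a \<in> A. g a = l} = w l)"
  using assms
proof (induction G arbitrary: A rule: finite_induct)
  case empty
  then show ?case by simp
next
  case (insert l0 G)
  then have "w l0 \<le> card A" by simp
  then obtain B where B: "B \<subseteq> A" "card B = w l0" using obtain_subset_with_card_n by metis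
  have "card (A - B) = (\<Sum>l\<in>G. w l)"
    using insert B by (simp add: card_Diff_subset finite_subset)
  then obtain g where g: "\<forall>a\<in>A - B. g a \<in> G" "\<forall>l\<in>G. card {a \<in> A - B. g a = l} = w l"
    using insert.IH[of "A - B"] insert.prems by auto
  let ?g = "\<lambda>a. if a \<in> B then l0 else g a"
  have "{a \<in> A. ?g a = l0} = B" using B g insert by auto
  moreover have "{a \<in> A. ?g a = l} = {a \<in> A - B. g a = l}" if "l \<in> G" for l
    using B that insert by auto
  ultimately show ?case
    using B g by (intro exI[of _ ?g]) (simp add: Ball_def)
qed

text \<open>\<open>ex_labelling\<close> is applied inside each fibre of \<open>f\<close>. In the
  application \<open>f\<close> gives the arrival points of particles at a breakpoint and
  \<open>p\<close> the starting points of the lines after it.\<close>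

lemma ex_matching:
  assumes "finite G" "finite A"
    and fibres: "\<And>z. card {a \<in> A. f a = z} = (\<Sum>l\<in>{l \<in> G. p l = z}. w l)"
  shows "\<exists>g. (\<forall>a\<in>A. g a \<in> G \<and> p (g a) = f a) \<and> (\<forall>l\<in>G. card {a \<in> A. g a = l} = w l)"
proof -
  have "\<forall>z. \<exists>h. (\<forall>a\<in>{a \<in> A. f a = z}. h a \<in> {l \<in> G. p l = z}) \<and>
      (\<forall>l\<in>{l \<in> G. p l = z}. card {a \<in> {a \<in> A. f a = z}. h a = l} = w l)"
    using assms by (intro allI ex_labelling) auto
  then obtain h where h: "\<forall>z. (\<forall>a\<in>{a \<in> A. f a = z}. h z a \<in> {l \<in> G. p l = z}) \<and>
      (\<forall>l\<in>{l \<in> G. p l = z}. card {a \<in> {a \<in> A. f a = z}. h z a = l} = w l)"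
    by (rule choice[THEN exE])
  have hG: "h (f a) a \<in> G" "p (h (f a) a) = f a" if "a \<in> A" for a
    using h[rule_format, THEN conjunct1, THEN bspec, of a "f a"] that by simp_all
  have "card {a \<in> A. h (f a) a = l} = w l" if "l \<in> G" for l
  proof -
    have "{a \<in> A. h (f a) a = l} = {a \<in> {a \<in> A. f a = p l}. h (p l) a = l}"
      using hG(2) by auto
    then show ?thesis
      using h[rule_format, THEN conjunct2, THEN bspec, of l "p l"] that by simp
  qed
  then show ?thesis using hG by (intro exI[of _ "\<lambda>a. h (f a) a"]) simp
qed

text \<open>Translates the sums over particles in \<open>strands\<close> into the weighted sums over
  lines in \<open>vertex_balance\<close>.\<close>

lemma sum_labelling:
  fixes F :: "'l \<Rightarrow> 'b::real_vector" and w :: "'l \<Rightarrow> nat"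
  assumes "finite G" "finite A" "\<forall>a\<in>A. g a \<in> G" "\<forall>l\<in>G. card {a \<in> A. g a = l} = w l"
  shows "(\<Sum>a\<in>{a \<in> A. P (g a)}. F (g a)) = (\<Sum>l\<in>{l \<in> G. P l}. w l *\<^sub>R F l)"
proof -
  have "(\<Sum>a\<in>{a \<in> A. P (g a)}. F (g a))
      = (\<Sum>l\<in>{l \<in> G. P l}. \<Sum>a\<in>{a \<in> {a \<in> A. P (g a)}. g a = l}. F (g a))"
    using assms by (intro sum.group[symmetric]) auto
  also have "\<dots> = (\<Sum>l\<in>{l \<in> G. P l}. w l *\<^sub>R F l)"
  proof (rule sum.cong[OF refl])
    fix l assume l: "l \<in> {l \<in> G. P l}"
    have "(\<Sum>a\<in>{a \<in> {a \<in> A. P (g a)}. g a = l}. F (g a)) = (\<Sum>a\<in>{a \<in> A. g a = l}. F l)"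
      using l by (intro sum.cong) auto
    also have "\<dots> = w l *\<^sub>R F l" using assms l by (simp add: sum_constant_scaleR)
    finally show "(\<Sum>a\<in>{a \<in> {a \<in> A. P (g a)}. g a = l}. F (g a)) = w l *\<^sub>R F l" .
  qed
  finally show ?thesis .
qed

lemma card_labelling:
  assumes "finite G" "finite A" "\<forall>a\<in>A. g a \<in> G" "\<forall>l\<in>G. card {a \<in> A. g a = l} = w l"
  shows "card {a \<in> A. P (g a)} = (\<Sum>l\<in>{l \<in> G. P l}. w l)"
proof -
  have "real (card {a \<in> A. P (g a)}) = real (\<Sum>l\<in>{l \<in> G. P l}. w l)"
    using sum_labelling[OF assms, where F = "\<lambda>_. 1 :: real" and P = P] by simp
  then show ?thesis by (simp only: of_nat_eq_iff)
qed

text \<open>Indices outside \<open>1..n\<close> are padding; they give the first and the last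
  singular time a gap on either side.\<close>

lemma ex_breakpoints:
  fixes T :: "real set"
  assumes "finite T" "T \<noteq> {}"
  obtains b :: "nat \<Rightarrow> real" and n where "strict_mono b" "T = b ` {1..n}"
proof -
  define xs where "xs = sorted_list_of_set T"
  define n where "n = length xs"
  have xs: "set xs = T" "sorted_wrt (<) xs" using assms by (auto simp: xs_def)
  have n: "n > 0" using xs assms by (auto simp: n_def)
  define b where "b j = (if j = 0 then xs ! 0 - 1 else if j \<le> n then xs ! (j - 1) else xs ! (n - 1) + real (j - n))" for j
  have "b j < b (Suc j)" for j
  proof -
    consider "j = 0" | "0 < j" "j < n" | "j = n" | "n < j" by linarith
    then show ?thesis
    proof cases
      case 2
      then have "xs ! (j - 1) < xs ! j" using sorted_wrt_nth_less[OF xs(2), of "j - 1" j] by (simp add: n_def)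
      then show ?thesis using 2 by (simp add: b_def)
    qed (use n in \<open>auto simp: b_def\<close>)
  qed
  then have "strict_mono b" by (simp add: strict_mono_Suc_iff)
  moreover have "T = b ` {1..n}"
  proof -
    have "b ` {1..n} = b ` Suc ` {0..<n}" by (simp add: image_Suc_atLeastLessThan atLeastLessThanSuc_atLeastAtMost)
    also have "\<dots> = (\<lambda>j. xs ! j) ` {0..<n}" unfolding image_image by (intro image_cong) (auto simp: b_def)
    also have "\<dots> = T" using xs(1) by (auto simp: n_def set_conv_nth)
    finally show ?thesis by simp
  qed
  ultimately show thesis by (rule that)
qed

section \<open>Particles that follow the network\<close>

context flat_cover
begin

text \<open>Labels are passed on from gap to gap. By multiplicity balance each point of a breakpoint
  slice can hand its particles to the lines that leave it, in an arbitrary pairing.\<close>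

lemma ex_labelled_lines:
  fixes b :: "nat \<Rightarrow> real"
  assumes gap: "\<And>j. gap (b j) (b (Suc j))"
  obtains lab where
    "\<And>j. \<forall>a\<in>{..<k}. lab j a \<in> lines (b j) (b (Suc j))"
    "\<And>j. \<forall>l\<in>lines (b j) (b (Suc j)). card {a \<in> {..<k}. lab j a = l} = line_mult (b j) (b (Suc j)) l"
    "\<And>j. \<forall>a\<in>{..<k}. line_point (lab (Suc j) a) (b (Suc j)) = line_point (lab j a) (b (Suc j))"
proof -
  define P where "P j f \<longleftrightarrow> (\<forall>a\<in>{..<k}. f a \<in> lines (b j) (b (Suc j))) \<and>
      (\<forall>l\<in>lines (b j) (b (Suc j)). card {a \<in> {..<k}. f a = l} = line_mult (b j) (b (Suc j)) l)"
    for j and f :: "nat \<Rightarrow> (real ^ 'n) \<times> (real ^ 'n)"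
  have "\<exists>f. P 0 f"
    unfolding P_def using finite_lines[OF gap] sum_line_mult[OF gap] by (intro ex_labelling) auto
  moreover have "\<exists>g. P (Suc j) g \<and> (\<forall>a\<in>{..<k}. line_point (g a) (b (Suc j)) = line_point (f a) (b (Suc j)))"
    if f: "P j f" for j f
  proof -
    let ?q = "b (Suc j)"
    have "card {a \<in> {..<k}. line_point (f a) ?q = z}
      = (\<Sum>l\<in>{l \<in> lines ?q (b (Suc (Suc j))). line_point l ?q = z}. line_mult ?q (b (Suc (Suc j))) l)" for z
    proof -
      have "card {a \<in> {..<k}. line_point (f a) ?q = z}
        = (\<Sum>l\<in>{l \<in> lines (b j) ?q. line_point l ?q = z}. line_mult (b j) ?q l)"
        using f finite_lines[OF gap] unfolding P_def by (intro card_labelling) auto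
      also have "\<dots> = (\<Sum>l\<in>{l \<in> lines ?q (b (Suc (Suc j))). line_point l ?q = z}. line_mult ?q (b (Suc (Suc j))) l)"
      proof (cases "z $ i = ?q")
        case True
        then show ?thesis using vertex_balance(1)[OF gap gap, of z j] by (simp add: lines_at_def)
      next
        case False
        then have "{l \<in> lines (b j) ?q. line_point l ?q = z} = {}"
          "{l \<in> lines ?q (b (Suc (Suc j))). line_point l ?q = z} = {}"
          using line_point_coord by blast+
        then show ?thesis by (simp only: sum.empty)
      qed
      finally show ?thesis .
    qed
    then have "\<exists>g. (\<forall>a\<in>{..<k}. g a \<in> lines ?q (b (Suc (Suc j))) \<and> line_point (g a) ?q = line_point (f a) ?q) \<and>
       (\<forall>l\<in>lines ?q (b (Suc (Suc j))). card {a \<in> {..<k}. g a = l} = line_mult ?q (b (Suc (Suc j))) l)"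
      using finite_lines[OF gap] by (intro ex_matching) auto
    then show ?thesis unfolding P_def by blast
  qed
  ultimately obtain lab where "\<forall>j. P j (lab j) \<and>
      (\<forall>a\<in>{..<k}. line_point (lab (Suc j) a) (b (Suc j)) = line_point (lab j a) (b (Suc j)))"
    using dependent_nat_choice[of P "\<lambda>j f g. \<forall>a\<in>{..<k}. line_point (g a) (b (Suc j)) = line_point (f a) (b (Suc j))"]
    by blast
  then show thesis using that unfolding P_def by blast
qed

text \<open>Times stay between the paddings, so each has a gap immediately before and after it.
  Balance of the particles is the second equation of \<open>vertex_balance\<close>, and events at
  singular points come from \<open>sing_vertex\<close>.\<close>

lemma ex_strands:
  fixes b :: "nat \<Rightarrow> real" and n :: nat
  assumes b: "strict_mono b" and sing: "\<And>z. z \<in> sing X \<Longrightarrow> z $ i \<in> b ` {1..n}"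
  obtains x vl vr where "strands (axis i (1 :: real)) (1 / cos \<theta>) {..<k} x vl vr {b 1..b n}"
    "\<And>z. z \<in> sing X \<Longrightarrow> strands.event {..<k} x vl vr (z $ i)"
proof -
  have lt: "b j < b j'" if "j < j'" for j j' using b that by (simp add: strict_mono_less)
  have gap: "gap (b j) (b (Suc j))" for j
    unfolding gap_def
  proof (intro conjI ballI notI)
    fix z assume "z \<in> sing X" and z: "b j < z $ i \<and> z $ i < b (Suc j)"
    then obtain j' where "z $ i = b j'" using sing by blast
    then have "j < j'" "j' < Suc j" using z b by (auto simp: strict_mono_less)
    then show False by simp
  qed (simp add: lt)
  obtain lab where lab: "\<And>j. \<forall>a\<in>{..<k}. lab j a \<in> lines (b j) (b (Suc j))"
    "\<And>j. \<forall>l\<in>lines (b j) (b (Suc j)). card {a \<in> {..<k}. lab j a = l} = line_mult (b j) (b (Suc j)) l"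
    "\<And>j. \<forall>a\<in>{..<k}. line_point (lab (Suc j) a) (b (Suc j)) = line_point (lab j a) (b (Suc j))"
    using ex_labelled_lines[of b, OF gap] by blast
  \<comment> \<open>\<open>ir t\<close> indexes the gap just after \<open>t\<close> and
    \<open>il t\<close> the gap just before; they differ exactly when \<open>t\<close> is a
    breakpoint.\<close>
  define ir where "ir t = (LEAST j. t < b (Suc j))" for t
  define il where "il t = (LEAST j. t \<le> b (Suc j))" for t
  have mono: "b j \<le> b j'" if "j \<le> j'" for j j' using b that by (simp add: strict_mono_less_eq)
  have ir: "ir t = j" if "b j \<le> t" "t < b (Suc j)" for t j
    unfolding ir_def
  proof (rule Least_equality)
    fix j' assume "t < b (Suc j')"
    then have "b j < b (Suc j')" using that by simp
    then show "j \<le> j'" using b by (simp add: strict_mono_less)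
  qed (use that in simp)
  have il: "il t = j" if "b j < t" "t \<le> b (Suc j)" for t j
    unfolding il_def
  proof (rule Least_equality)
    fix j' assume "t \<le> b (Suc j')"
    then have "b j < b (Suc j')" using that by simp
    then show "j \<le> j'" using b by (simp add: strict_mono_less)
  qed (use that in simp)
  have ir_bounds: "b (ir t) \<le> t" "t < b (Suc (ir t))" if "t \<in> {b 1..b n}" for t
  proof -
    have "t < b (Suc n)" using that lt[of n "Suc n"] by simp
    then show "t < b (Suc (ir t))" unfolding ir_def by (rule LeastI)
    show "b (ir t) \<le> t"
    proof (cases "ir t")
      case 0
      then show ?thesis using that lt[of 0 1] by simp
    next
      case (Suc j)
      then have "\<not> t < b (Suc j)" unfolding ir_def by (metis lessI not_less_Least)
      then show ?thesis using Suc by simp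
    qed
  qed
  have il_bounds: "b (il t) < t" "t \<le> b (Suc (il t))" if "t \<in> {b 1..b n}" for t
  proof -
    have "t \<le> b (Suc n)" using that lt[of n "Suc n"] by simp
    then show "t \<le> b (Suc (il t))" unfolding il_def by (rule LeastI)
    show "b (il t) < t"
    proof (cases "il t")
      case 0
      then show ?thesis using that lt[of 0 1] by simp
    next
      case (Suc j)
      then have "\<not> t \<le> b (Suc j)" unfolding il_def by (metis lessI not_less_Least)
      then show ?thesis using Suc by simp
    qed
  qed
  define x where "x a t = line_point (lab (ir t) a) t" for a t
  define vr where "vr a t = snd (lab (ir t) a)" for a t
  define vl where "vl a t = snd (lab (il t) a)" for a t
  \<comment> \<open>Positions are defined through the later gap; the matching at breakpoints makes
    them continuous.\<close>
  have xl: "x a t = line_point (lab (il t) a) t" if a: "a \<in> {..<k}" and t: "t \<in> {b 1..b n}" for a t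
  proof (cases "t = b (Suc (il t))")
    case True
    have "ir t = Suc (il t)" using True lt[of "Suc (il t)" "Suc (Suc (il t))"] by (intro ir) auto
    then show ?thesis using lab(3)[of "il t"] a True by (simp add: x_def)
  next
    case False
    then have "ir t = il t" using il_bounds[OF t] by (intro ir) auto
    then show ?thesis by (simp add: x_def)
  qed
  have line: "lab j a \<in> lines (b j) (b (Suc j))" if "a \<in> {..<k}" for j a using lab(1) that by blast
  have slope: "snd (lab j a) \<bullet> axis i 1 = 1" "norm (snd (lab j a)) \<le> 1 / cos \<theta>" if "a \<in> {..<k}" for j a
    using line[OF that, of j] norm_slope_le[OF gap line[OF that]] by (auto simp: lines_def inner_axis)
  have unit_sum: "(\<Sum>a\<in>{a \<in> {..<k}. line_point (lab j a) t = z}. sgn (snd (lab j a)))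
     = (\<Sum>l\<in>{l \<in> lines (b j) (b (Suc j)). line_point l t = z}. line_mult (b j) (b (Suc j)) l *\<^sub>R sgn (snd l))" for j t z
    using lab(1,2)[of j] finite_lines[OF gap] by (intro sum_labelling) auto
  have strands: "strands (axis i 1) (1 / cos \<theta>) {..<k} x vl vr {b 1..b n}"
  proof
    show "norm (axis i (1::real)) = 1" by simp
    show "finite {..<k}" by simp
    show "is_interval {b 1..b n}" by simp
  next
    fix a t assume a: "a \<in> {..<k}" and t: "t \<in> {b 1..b n}"
    show "x a t \<bullet> axis i 1 = t" using line_point_coord[OF line[OF a]] by (simp add: x_def inner_axis)
    show "vr a t \<bullet> axis i 1 = 1" "norm (vr a t) \<le> 1 / cos \<theta>" using slope[OF a] by (simp_all add: vr_def)
    show "vl a t \<bullet> axis i 1 = 1" "norm (vl a t) \<le> 1 / cos \<theta>" using slope[OF a] by (simp_all add: vl_def)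
    show "\<forall>\<^sub>F \<tau> in at_right t. x a \<tau> = x a t + (\<tau> - t) *\<^sub>R vr a t \<and> vr a \<tau> = vr a t \<and> vl a \<tau> = vr a t"
      unfolding eventually_at_right_field
    proof (intro exI[of _ "b (Suc (ir t))"] conjI[OF ir_bounds(2)[OF t]] allI impI)
      fix \<tau> assume \<tau>: "t < \<tau>" "\<tau> < b (Suc (ir t))"
      then have "ir \<tau> = ir t" "il \<tau> = ir t" using ir_bounds[OF t] by (auto intro!: ir il)
      then show "x a \<tau> = x a t + (\<tau> - t) *\<^sub>R vr a t \<and> vr a \<tau> = vr a t \<and> vl a \<tau> = vr a t"
        using line_point_shift by (simp add: x_def vr_def vl_def)
    qed
    show "\<forall>\<^sub>F \<tau> in at_left t. x a \<tau> = x a t + (\<tau> - t) *\<^sub>R vl a t \<and> vr a \<tau> = vl a t \<and> vl a \<tau> = vl a t"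
      unfolding eventually_at_left_field
    proof (intro exI[of _ "b (il t)"] conjI[OF il_bounds(1)[OF t]] allI impI)
      fix \<tau> assume \<tau>: "b (il t) < \<tau>" "\<tau> < t"
      then have eq: "ir \<tau> = il t" "il \<tau> = il t" using il_bounds[OF t] by (auto intro!: ir il)
      have "x a \<tau> = line_point (lab (il t) a) \<tau>" using eq by (simp add: x_def)
      also have "\<dots> = x a t + (\<tau> - t) *\<^sub>R vl a t"
        unfolding xl[OF a t] vl_def by (rule line_point_shift)
      finally show "x a \<tau> = x a t + (\<tau> - t) *\<^sub>R vl a t \<and> vr a \<tau> = vl a t \<and> vl a \<tau> = vl a t"
        using eq by (simp add: vr_def vl_def)
    qed
  next
    fix t z assume t: "t \<in> {b 1..b n}"
    show "(\<Sum>a\<in>{a \<in> {..<k}. x a t = z}. sgn (vl a t)) = (\<Sum>a\<in>{a \<in> {..<k}. x a t = z}. sgn (vr a t))"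
    proof (cases "t = b (Suc (il t))")
      case False
      then have "ir t = il t" using il_bounds[OF t] by (intro ir) auto
      then show ?thesis by (simp add: vl_def vr_def)
    next
      case True
      define j where "j = il t"
      have t_eq: "t = b (Suc j)" using True by (simp add: j_def)
      have irt: "ir t = Suc j" unfolding t_eq using lt[of "Suc j" "Suc (Suc j)"] by (intro ir) auto
      have "{a \<in> {..<k}. x a t = z} = {a \<in> {..<k}. line_point (lab j a) t = z}"
        using xl[OF _ t] by (auto simp: j_def)
      then have l: "(\<Sum>a\<in>{a \<in> {..<k}. x a t = z}. sgn (vl a t))
        = (\<Sum>l\<in>{l \<in> lines (b j) t. line_point l t = z}. line_mult (b j) t l *\<^sub>R sgn (snd l))"
        using unit_sum[of j t z] by (simp add: vl_def j_def[symmetric] t_eq[symmetric])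
      have r: "(\<Sum>a\<in>{a \<in> {..<k}. x a t = z}. sgn (vr a t))
        = (\<Sum>l\<in>{l \<in> lines t (b (Suc (Suc j))). line_point l t = z}. line_mult t (b (Suc (Suc j))) l *\<^sub>R sgn (snd l))"
        using unit_sum[of "Suc j" t z] by (simp add: vr_def x_def irt t_eq[symmetric])
      show ?thesis
      proof (cases "z $ i = t")
        case True
        then show ?thesis
          using vertex_balance(2)[OF gap gap, of z j] l r by (simp add: lines_at_def t_eq)
      next
        case False
        then have "{l \<in> lines (b j) t. line_point l t = z} = {}"
          "{l \<in> lines t (b (Suc (Suc j))). line_point l t = z} = {}"
          using line_point_coord by blast+
        then show ?thesis unfolding l r by (simp only: sum.empty)
      qed
    qed
  qed
  interpret S: strands "axis i 1" "1 / cos \<theta>" "{..<k}" x vl vr "{b 1..b n}" by (rule strands)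
  have "S.event (z $ i)" if z: "z \<in> sing X" for z
  proof -
    let ?t = "z $ i"
    obtain j' where j': "j' \<in> {1..n}" "?t = b j'" using sing[OF z] by blast
    then obtain j where j: "j' = Suc j" by (cases j') auto
    have t: "?t = b (Suc j)" using j' j by simp
    have tQ: "?t \<in> {b 1..b n}" using j' mono by auto
    have idx: "il ?t = j" "ir ?t = Suc j"
      unfolding t using lt[of j "Suc j"] lt[of "Suc j" "Suc (Suc j)"] by (auto intro!: il ir)
    have g: "gap (b j) ?t" "gap ?t (b (Suc (Suc j)))" using gap[of j] gap[of "Suc j"] t by simp_all
    obtain l l' where l: "l \<in> lines_at (b j) ?t z" "l' \<in> lines_at ?t (b (Suc (Suc j))) z" "snd l \<noteq> snd l'"
      by (rule sing_vertex[OF g z])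
    \<comment> \<open>Each line has positive multiplicity and hence carries a particle.\<close>
    have ex: "\<exists>a\<in>{..<k}. lab j a = l" if "l \<in> lines (b j) (b (Suc j))" for j l
    proof -
      have "card {a \<in> {..<k}. lab j a = l} > 0" using lab(2)[of j] line_mult(1)[OF gap that] that by simp
      then show ?thesis by (auto simp: card_gt_0_iff)
    qed
    obtain a where a: "a \<in> {..<k}" "lab j a = l" using ex[of l j] lines_at_subset[OF l(1)] t by auto
    obtain a' where a': "a' \<in> {..<k}" "lab (Suc j) a' = l'" using ex[of l' "Suc j"] lines_at_subset[OF l(2)] t by auto
    have "x a ?t = z" using xl[OF a(1) tQ] idx a l(1) by (simp add: lines_at_def)
    moreover have "x a' ?t = z" using idx a' l(2) by (simp add: x_def lines_at_def)
    ultimately show ?thesis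
      unfolding S.event_def using a a' l(3) idx by (intro bexI[of _ a] bexI[of _ a']) (auto simp: vl_def vr_def)
  qed
  then show thesis by (rule that[OF strands])
qed

text \<open>Events are counted by time: there are at most \<open>N\<close> singular times, and each
  slice has at most \<open>k\<close> points.\<close>

lemma card_sing_le:
  assumes N: "event_bound TYPE(nat) TYPE(real ^ 'n) (1 / cos \<theta>) k N"
  shows "card (sing X) \<le> N * k"
proof (cases "sing X = {}")
  case False
  define T where "T = (\<lambda>z. z $ i) ` sing X"
  have T: "finite T" "T \<noteq> {}" using finite_sing False by (auto simp: T_def)
  obtain b :: "nat \<Rightarrow> real" and n where b: "strict_mono b" "T = b ` {1..n}" by (rule ex_breakpoints[OF T])
  have sub: "z $ i \<in> b ` {1..n}" if "z \<in> sing X" for z using that b(2) by (auto simp: T_def)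
  obtain x vl vr where s: "strands (axis i (1 :: real)) (1 / cos \<theta>) {..<k} x vl vr {b 1..b n}"
    "\<forall>z\<in>sing X. strands.event {..<k} x vl vr (z $ i)"
    by (rule ex_strands[OF b(1) sub]) blast+
  have "T \<subseteq> {b 1..b n}" unfolding b(2) using b(1) by (auto simp: strict_mono_less_eq)
  moreover have "\<forall>t\<in>T. strands.event {..<k} x vl vr t" using s(2) by (auto simp: T_def)
  ultimately have cT: "card T \<le> N"
    using N[unfolded event_bound_def, rule_format, of "axis i 1" "{..<k}" x vl vr "{b 1..b n}" T] s(1) T(1) by simp
  have "sing X \<subseteq> (\<Union>t\<in>T. slice i X t)" by (auto simp: T_def slice_def sing_def)
  then have "card (sing X) \<le> card (\<Union>t\<in>T. slice i X t)"
    using T(1) finite_slice by (intro card_mono) auto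
  also have "\<dots> \<le> (\<Sum>t\<in>T. card (slice i X t))" using T(1) by (rule card_UN_le)
  also have "\<dots> \<le> (\<Sum>t\<in>T. k)" using cover unfolding k_cover_def by (intro sum_mono) blast
  also have "\<dots> \<le> N * k" using cT by simp
  finally show ?thesis .
qed simp

end

theorem theorem22:
  fixes k :: nat
  assumes "CARD('n::finite) \<ge> 2" and "k \<ge> 1"
  shows "\<exists>(\<theta>::real) (C::nat). 0 < \<theta> \<and> \<theta> < pi / 2 \<and>
           (\<forall>(i::'n) (X::(real ^ 'n) set) (m::real ^ 'n \<Rightarrow> real).
              isgn X m \<and> k_cover i k X m \<and> theta_flat i \<theta> X \<and> finite (sing X)
              \<longrightarrow> card (sing X) \<le> C)"
proof -
  \<comment> \<open>The angle enters only through the slope bound \<open>1 / cos (pi / 3)\<close>;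
    \<open>pi / 3\<close> is one choice in the open interval.\<close>
  obtain N where N: "event_bound TYPE(nat) TYPE(real ^ 'n) (1 / cos (pi / 3)) k N"
    using event_bound_exists by blast
  have "card (sing X) \<le> N * k"
    if "isgn X m" "k_cover i k X m" "theta_flat i (pi / 3) X" "finite (sing X)"
    for i :: 'n and X :: "(real ^ 'n) set" and m
  proof -
    interpret flat_cover i X m k "pi / 3"
      by unfold_locales (use that pi_gt_zero in auto)
    show ?thesis using N by (rule card_sing_le)
  qed
  then show ?thesis
    by (intro exI[of _ "pi / 3"] exI[of _ "N * k"]) (use pi_gt_zero in auto)
qed

end
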